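(* Let $\phi$ be a compactly supported contactomorphism of $(\mathbb{R}^{2n}\times S^1,\xi=\ker(dz-y\,dx))$, contact isotopic to the identity through compactly supported contactomorphisms, which is positive, i.e. $\phi$ is the time-1 map of a compactly supported contact isotopy generated by a contact Hamiltonian that is positive in the interior of its support (and $\phi\neq\mathrm{id}$). Then $\phi$ has infinitely many non-trivial, geometrically distinct iterated translated points; that is, there are infinitely many distinct points $q\in\mathbb{R}^{2n}\times S^1$ such that, for some integer $k\geq1$, $q$ is a translated point of $\phi^k$ with nonzero contact action $\mathcal{A}_{\phi^k}(q)\neq0$.
   Context: Coordinates on $\mathbb{R}^{2n}\times S^1$ are $(x,y,z)$ with $x,y\in\mathbb{R}^n$, $z\in S^1=\mathbb{R}/\mathbb{Z}$, and $y\,dx=\sum_i y_i\,dx_i$; the contact form is $\alpha=dz-y\,dx$, whose Reeb vector field is $\partial/\partial z$. For a contactomorphism $\psi$ let $g_\psi$ be the function with $\psi^*\alpha=e^{g_\psi}\alpha$. A point $q$ is a translated point of $\psi$ if $\psi(q)$ and $q$ lie on the same Reeb orbit (i.e. $\psi(q)$ has the same $x,y$ coordinates as $q$) and $g_\psi(q)=0$. An iterated translated point of $\phi$ is a translated point of some iterate $\phi^k$, $k\geq1$. To define the contact action, regard a compactly supported contactomorphism $\psi$ of $\mathbb{R}^{2n}\times S^1$ isotopic to the identity as its lift to a contactomorphism $\psi=(\psi_1,\psi_2,\psi_3)$ of $\mathbb{R}^{2n+1}$ which is 1-periodic in $z$ (the lift equal to the identity outside the preimage of the support); for a translated point $q=(x,y,z)$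 the contact action is the real number $\mathcal{A}_\psi(q)=\psi_3(q)-z$. The translated point is non-trivial if $\mathcal{A}_\psi(q)\neq0$. *)

theory Defs
  imports "HOL-Analysis.Analysis"
begin

text \<open>Points of the lift R^{2n+1} of R^{2n} x S^1: coordinates (x,y,z),
  with z real; the S^1 coordinate is z modulo 1.\<close>
type_synonym 'n pt = "(real^'n) \<times> (real^'n) \<times> real"

coinductive smooth :: "('a::real_normed_vector \<Rightarrow> 'b::real_normed_vector) \<Rightarrow> bool" where
  "\<lbrakk> continuous_on UNIV f; \<forall>x. f differentiable (at x);
     \<forall>v. smooth (\<lambda>x. frechet_derivative f (at x) v) \<rbrakk> \<Longrightarrow> smooth f"

fun alpha :: "'n::finite pt \<Rightarrow> 'n pt \<Rightarrow> real" where
  "alpha (x, y, z) (vx, vy, vz) = vz - y \<bullet> vx"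

text \<open>psi is the identity outside B x R (lift of a map supported in B x S^1).\<close>
definition supported_in :: "((real^'n) \<times> (real^'n)) set \<Rightarrow> ('n::finite pt \<Rightarrow> 'n pt) \<Rightarrow> bool" where
  "supported_in B \<psi> \<longleftrightarrow> (\<forall>x y z. (x, y) \<notin> B \<longrightarrow> \<psi> (x, y, z) = (x, y, z))"

text \<open>Lift (1-periodic in z) of a contactomorphism of R^{2n} x S^1:
  a smooth diffeomorphism of R^{2n+1} commuting with z-translation by 1 and
  satisfying psi^* alpha = e^g alpha for some function g.\<close>
definition contactomorphism :: "('n::finite pt \<Rightarrow> 'n pt) \<Rightarrow> bool" where
  "contactomorphism \<psi> \<longleftrightarrow>
     bij \<psi> \<and> smooth \<psi> \<and> smooth (inv \<psi>) \<and>
     (\<forall>x y z. \<psi> (x, y, z + 1) = \<psi> (x, y, z) + (0, 0, 1)) \<and>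
     (\<exists>g. \<forall>p v. alpha (\<psi> p) (frechet_derivative \<psi> (at p) v) = exp (g p) * alpha p v)"

definition cs_contactomorphism :: "('n::finite pt \<Rightarrow> 'n pt) \<Rightarrow> bool" where
  "cs_contactomorphism \<psi> \<longleftrightarrow>
     contactomorphism \<psi> \<and> (\<exists>B. bounded B \<and> supported_in B \<psi>)"

definition conf_factor :: "('n::finite pt \<Rightarrow> 'n pt) \<Rightarrow> 'n pt \<Rightarrow> real" where
  "conf_factor \<psi> p =
     (THE g. \<forall>v. alpha (\<psi> p) (frechet_derivative \<psi> (at p) v) = exp g * alpha p v)"

text \<open>Translated point: psi(q) on the Reeb orbit of q (same x,y) and g_psi(q) = 0.\<close>
definition translated_point :: "('n::finite pt \<Rightarrow> 'n pt) \<Rightarrow> 'n pt \<Rightarrow> bool" where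
  "translated_point \<psi> q \<longleftrightarrow>
     fst (\<psi> q) = fst q \<and> fst (snd (\<psi> q)) = fst (snd q) \<and> conf_factor \<psi> q = 0"

definition contact_action :: "('n::finite pt \<Rightarrow> 'n pt) \<Rightarrow> 'n pt \<Rightarrow> real" where
  "contact_action \<psi> q = snd (snd (\<psi> q)) - snd (snd q)"

definition proj_S1 :: "'n::finite pt \<Rightarrow> 'n pt" where
  "proj_S1 q = (fst q, fst (snd q), frac (snd (snd q)))"

text \<open>Positive contactomorphism: time-1 map of a compactly supported contact isotopy
  Phi (Phi_0 = id, smooth in (t,p), each Phi_t a contactomorphism supported in a
  fixed bounded B) whose contact Hamiltonian H, defined by
  H_t(Phi_t(p)) = alpha(d/dt Phi_t(p)), is positive in the interior of its support
  (support taken in [0,1] x R^{2n+1}).\<close>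
definition positive_contactomorphism :: "('n::finite pt \<Rightarrow> 'n pt) \<Rightarrow> bool" where
  "positive_contactomorphism \<phi> \<longleftrightarrow>
     (\<exists>(\<Phi> :: real \<Rightarrow> 'n pt \<Rightarrow> 'n pt) (H :: real \<Rightarrow> 'n pt \<Rightarrow> real) B.
        bounded B \<and>
        smooth (\<lambda>(t, p). \<Phi> t p) \<and>
        (\<forall>t\<in>{0..1}. contactomorphism (\<Phi> t) \<and> supported_in B (\<Phi> t)) \<and>
        \<Phi> 0 = id \<and> \<Phi> 1 = \<phi> \<and>
        (\<forall>t\<in>{0..1}. \<forall>p. H t (\<Phi> t p) =
            alpha (\<Phi> t p) (vector_derivative (\<lambda>s. \<Phi> s p) (at t within {0..1}))) \<and>
        (\<forall>t p. (t, p) \<in> interior (closure {(s, q). s \<in> {0..1} \<and> H s q \<noteq> 0})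
                \<longrightarrow> H t p > 0))"

end

(*
A contact isotopy is cut into steps close to the identity, each given by a generating function
f(x, Y, z) = Z - z - Y.(X - x), which is nonnegative because the isotopy is positive. For a closed
chain of N steps the total height gain z_N - z_0 is a function of the positions and momenta
(x_j, p_j) and of z_0 whose critical points are the translated points of the composition and whose
critical values are their actions; it is a nonnegative bounded perturbation of the quadratic form
sum_j p_j.(x_{j+1} - x_j). Linking the negative and null directions of this form with the positive
ones (Brouwer's theorem) gives a minimax critical value c_k > 0 for phi^k, all k with k m < N at once.

Appending one more copy of phi can only raise the functional, and it raises it strictly at the
critical points of phi^k with action different from 0, so c_k < c_{k+1}. Appending instead a step
that displaces the support raises the functional to one whose critical points all lie outside the
support, so its critical values, and hence every c_k, are bounded by the maximum of that step's
generating function. If q is translated by phi^k and by phi^l with actions c_k < c_l, then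
q + (0, 0, c_k) is translated by phi^(l - k) with action c_l - c_k; since the c_k stay bounded while
their number is arbitrary, finitely many points cannot account for all of them.
*)
theory Submission
  imports Defs
begin

text \<open>Two obstacles shape the analysis. First, configurations are unbounded: translating all
  positions or all momenta leaves the quadratic form unchanged, so a minimising family could escape
  along these null directions. But far out along them every step is the identity and the action is
  the bare quadratic form, for which a small gradient means a small action; at positive levels there
  is no escape. This is why the minimax value is shown to be positive before it is shown to be
  critical. Second, the generating functions are only handled as C^1 functions, so the gradient is
  merely continuous and has no flow to offer. The deformation is one straight step along a bounded
  continuous field, and descent is estimated on the whole segment.

  The strict inequality comes from a minimax argument with two functionals \<open>A\<close> and
  \<open>F'\<close>, the second the larger. If both have the same minimax value, sheets almost
  optimal for \<open>F'\<close> yield a critical point of \<open>A\<close> at which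
  \<open>F'\<close> equals \<open>A\<close>; so it suffices to understand where an added copy of the
  map contributes no height. The critical equation for the initial height is the condition that the
  total conformal factor be 1.\<close>

section \<open>Brouwer's theorem with a variable number of coordinates\<close>

lemma tendsto_coordinatewise:
  fixes a :: "nat \<Rightarrow> 'i \<Rightarrow> 'b::topological_space"
  assumes "\<And>i. (\<lambda>m. a m i) \<longlonglongrightarrow> l i"
  shows "a \<longlonglongrightarrow> l"
proof -
  have "limitin (product_topology (\<lambda>i. euclidean) UNIV) a l sequentially"
    using assms by (auto simp: limitin_componentwise)
  then show ?thesis
    by (simp add: euclidean_product_topology)
qed

lemma compact_coordinatewise:
  fixes S :: "'i \<Rightarrow> 'b::topological_space set"
  assumes "\<And>i. compact (S i)"
  shows "compact {u. \<forall>i. u i \<in> S i}"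
proof -
  have "compactin (product_topology (\<lambda>i. euclidean) UNIV) (PiE UNIV S)"
    using assms by (auto simp: compactin_PiE)
  moreover have "PiE UNIV S = {u. \<forall>i. u i \<in> S i}"
    by auto
  ultimately show ?thesis
    by (simp add: euclidean_product_topology)
qed

text \<open>The dimension \<open>n\<close> is a term and not a type because it grows with the number
  of steps. Coordinates from \<open>n\<close> on are pinned to 0, which keeps the cube compact in
  the product topology. The fixed point is a limit of Kuhn cells.\<close>

lemma brouwer_cube_nat:
  fixes f :: "(nat \<Rightarrow> real) \<Rightarrow> nat \<Rightarrow> real" and n :: nat
  defines "B \<equiv> {u. \<forall>i. u i \<in> (if i < n then {0..1} else {0})}"
  assumes cont: "\<And>i. i < n \<Longrightarrow> continuous_on B (\<lambda>u. f u i)"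
    and into: "\<And>u i. u \<in> B \<Longrightarrow> i < n \<Longrightarrow> f u i \<in> {0..1}"
  obtains u where "u \<in> B" "\<And>i. i < n \<Longrightarrow> f u i = u i"
proof -
  define P where "P p x = (\<lambda>i. if i < n then real (x i) / real p else 0)" for p :: nat and x :: "nat \<Rightarrow> nat"
  have PB: "P p x \<in> B" if "\<forall>i<n. x i \<le> p" "p > 0" for p x
    using that by (auto simp: P_def B_def divide_le_eq)
  \<comment> \<open>Label 0 says that \<open>f\<close> does not decrease the coordinate, label 1
    that it does not increase it. The first two cases enforce Kuhn's boundary condition and agree
    with this reading because \<open>f\<close> maps into the cube.\<close>
  define lab where "lab p x i = (if x i = 0 then 0 else if x i = p then 1
      else if P p x i \<le> f (P p x) i then 0 else (1::nat))" for p x i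
  have lab0: "P p x i \<le> f (P p x) i" if "\<forall>i<n. x i \<le> p" "p > 0" "i < n" "lab p x i = 0" for p x i
    using that into[OF PB[OF that(1,2)] that(3)] by (auto simp: lab_def P_def split: if_splits)
  have lab1: "f (P p x) i \<le> P p x i" if "\<forall>i<n. x i \<le> p" "p > 0" "i < n" "lab p x i \<noteq> 0" for p x i
    using that into[OF PB[OF that(1,2)] that(3)] by (auto simp: lab_def P_def split: if_splits)
  define cell where "cell q r \<longleftrightarrow> (\<forall>j<n. q j \<le> r j \<and> r j \<le> q j + 1)" for q r :: "nat \<Rightarrow> nat"
  have "\<exists>q. (\<forall>i<n. q i < p) \<and> (\<forall>i<n. \<exists>r s. cell q r \<and> cell q s \<and> lab p r i \<noteq> lab p s i)" if p: "p > 0" for p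
  proof -
    have "\<forall>x. (\<forall>i<n. x i \<le> p) \<longrightarrow> (\<forall>i<n. lab p x i = 0 \<or> lab p x i = 1)"
      "\<forall>x. (\<forall>i<n. x i \<le> p) \<longrightarrow> (\<forall>i<n. x i = 0 \<longrightarrow> lab p x i = 0)"
      "\<forall>x. (\<forall>i<n. x i \<le> p) \<longrightarrow> (\<forall>i<n. x i = p \<longrightarrow> lab p x i = 1)"
      using p by (auto simp: lab_def)
    from kuhn_lemma[OF p this] show ?thesis unfolding cell_def by metis
  qed
  from this[OF zero_less_Suc] have ex_q: "\<forall>m. \<exists>q. (\<forall>i<n. q i < Suc m) \<and> (\<forall>i<n. \<exists>r s. cell q r \<and> cell q s \<and> lab (Suc m) r i \<noteq> lab (Suc m) s i)"
    by (intro allI)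
  obtain q where q: "\<And>m i. i < n \<Longrightarrow> q m i < Suc m"
    and rs: "\<And>m i. i < n \<Longrightarrow> \<exists>r s. cell (q m) r \<and> cell (q m) s \<and> lab (Suc m) r i \<noteq> lab (Suc m) s i"
    using choice[OF ex_q] by blast
  have rs': "\<exists>r s. cell (q m) r \<and> cell (q m) s \<and> lab (Suc m) r i = 0 \<and> lab (Suc m) s i \<noteq> 0"
    if "i < n" for m i
  proof -
    from rs[OF that, of m] obtain r s where *: "cell (q m) r"
      "cell (q m) s" "lab (Suc m) r i \<noteq> lab (Suc m) s i" by blast
    show ?thesis
    proof (cases "lab (Suc m) r i = 0")
      case True
      moreover have "lab (Suc m) s i \<noteq> 0" using True *(3) by simp
      ultimately show ?thesis using *(1,2) by blast
    next
      case False
      moreover have "lab (Suc m) s i = 0" using False *(3) by (auto simp: lab_def split: if_splits)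
      ultimately show ?thesis using *(1,2) by blast
    qed
  qed
  have compB: "compact B"
    unfolding B_def by (rule compact_coordinatewise) auto
  have "P (Suc m) (q m) \<in> B" for m
    by (rule PB) (use q in \<open>auto intro: less_imp_le\<close>)
  then have PB': "\<forall>m. P (Suc m) (q m) \<in> B" by blast
  have "seq_compact B" using compB by (simp add: compact_eq_seq_compact_metric)
  then obtain u \<sigma> where u: "u \<in> B" and \<sigma>: "strict_mono \<sigma>"
    and lim: "((\<lambda>m. P (Suc m) (q m)) \<circ> \<sigma>) \<longlonglongrightarrow> u"
    using PB' unfolding seq_compact_def by metis
  \<comment> \<open>The vertices of a cell approach its corner as the mesh shrinks, so every choice
    of vertices has the same limit \<open>u\<close>.\<close>
  have near: "(\<lambda>m. P (Suc (\<sigma> m)) (x m)) \<longlonglongrightarrow> u"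
    if x: "\<And>m. cell (q (\<sigma> m)) (x m)" for x
  proof (rule tendsto_coordinatewise)
    fix i
    have lim_i: "(\<lambda>m. P (Suc (\<sigma> m)) (q (\<sigma> m)) i) \<longlonglongrightarrow> u i"
      using continuous_on_tendsto_compose[OF continuous_on_product_coordinates lim]
      by (simp add: o_def)
    have sub: "(\<lambda>m. 1 / real (Suc (\<sigma> m))) \<longlonglongrightarrow> 0"
      using LIMSEQ_subseq_LIMSEQ[OF LIMSEQ_inverse_real_of_nat \<sigma>]
      by (simp add: o_def inverse_eq_divide)
    show "(\<lambda>m. P (Suc (\<sigma> m)) (x m) i) \<longlonglongrightarrow> u i"
    proof (cases "i < n")
      case True
      have "norm (P (Suc (\<sigma> m)) (x m) i - P (Suc (\<sigma> m)) (q (\<sigma> m)) i) \<le> 1 / real (Suc (\<sigma> m))" for m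
      proof -
        have "real (x m i) - real (q (\<sigma> m) i) \<le> 1" "real (x m i) - real (q (\<sigma> m) i) \<ge> 0"
          using x[of m, unfolded cell_def, rule_format, OF True] by linarith+
        then show ?thesis
          using True by (auto simp: P_def diff_divide_distrib[symmetric] divide_le_cancel)
      qed
      then have "(\<lambda>m. P (Suc (\<sigma> m)) (x m) i - P (Suc (\<sigma> m)) (q (\<sigma> m)) i) \<longlonglongrightarrow> 0"
        by (intro Lim_null_comparison[OF always_eventually sub]) auto
      from tendsto_add[OF this lim_i] show ?thesis by simp
    next
      case False
      then have "u i = 0" using u by (auto simp: B_def split: if_splits)
      then show ?thesis using False by (simp add: P_def)
    qed
  qed
  show ?thesis
  proof (rule that[OF u])
    fix i assume i: "i < n"
    from rs'[OF i] have "\<forall>m. \<exists>r s. cell (q (\<sigma> m)) r \<and> cell (q (\<sigma> m)) s \<and> lab (Suc (\<sigma> m)) r i = 0 \<and> lab (Suc (\<sigma> m)) s i \<noteq> 0"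
      by blast
    then obtain r s where r: "\<And>m. cell (q (\<sigma> m)) (r m)"
      and s: "\<And>m. cell (q (\<sigma> m)) (s m)"
      and l: "\<And>m. lab (Suc (\<sigma> m)) (r m) i = 0" "\<And>m. lab (Suc (\<sigma> m)) (s m) i \<noteq> 0"
      unfolding choice_iff by blast
    have rle: "\<forall>j<n. r m j \<le> Suc (\<sigma> m)" and sle: "\<forall>j<n. s m j \<le> Suc (\<sigma> m)" for m
      using r[of m] s[of m] q[of _ "\<sigma> m"] unfolding cell_def by (fastforce simp: Suc_le_eq)+
    have inB: "P (Suc (\<sigma> m)) (r m) \<in> B" "P (Suc (\<sigma> m)) (s m) \<in> B" for m
      by (rule PB, use rle sle in auto)+
    have c: "(\<lambda>m. P (Suc (\<sigma> m)) (x m) i) \<longlonglongrightarrow> u i"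
      "(\<lambda>m. f (P (Suc (\<sigma> m)) (x m)) i) \<longlonglongrightarrow> f u i"
      if "(\<lambda>m. P (Suc (\<sigma> m)) (x m)) \<longlonglongrightarrow> u" "\<And>m. P (Suc (\<sigma> m)) (x m) \<in> B" for x
      using continuous_on_tendsto_compose[OF continuous_on_product_coordinates that(1)]
        continuous_on_tendsto_compose[OF cont[OF i] that(1) u] that(2) by (auto simp: o_def)
    have "u i \<le> f u i"
      by (rule LIMSEQ_le[OF c[OF near[OF r] inB(1)]]) (use lab0[OF rle _ i l(1)] in auto)
    moreover have "f u i \<le> u i"
      by (rule LIMSEQ_le[OF c(2,1)[OF near[OF s] inB(2)]]) (use lab1[OF sle _ i l(2)] in auto)
    ultimately show "f u i = u i" by simp
  qed
qed

text \<open>Brouwer's theorem for \<open>u - g u + t\<close>, which maps a large cube into itself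
  because \<open>g\<close> stays at bounded distance from the identity.\<close>

lemma bounded_perturbation_surj:
  fixes g :: "('i \<Rightarrow> real) \<Rightarrow> 'i \<Rightarrow> real" and t :: "'i \<Rightarrow> real"
  assumes fin: "finite I"
    and cont: "\<And>i. i \<in> I \<Longrightarrow> continuous_on UNIV (\<lambda>u. g u i)"
    and M: "\<And>u i. i \<in> I \<Longrightarrow> \<bar>g u i - u i\<bar> \<le> M"
  obtains u where "\<And>i. i \<in> I \<Longrightarrow> g u i = t i"
proof -
  define n where "n = card I"
  obtain e where e: "bij_betw e {..<n} I"
    using ex_bij_betw_nat_finite[OF fin] by (auto simp: n_def atLeast0LessThan)
  define d where "d = inv_into {..<n} e"
  have de: "d (e k) = k" if "k < n" for k
    using e that by (simp add: d_def bij_betw_inv_into_left)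
  have ed: "e (d i) = i" "d i < n" if "i \<in> I" for i
    using e that bij_betwE[OF bij_betw_inv_into[OF e]] by (auto simp: d_def bij_betw_inv_into_right)
  have eI: "e k \<in> I" if "k < n" for k using e that by (auto simp: bij_betw_def)
  define L where "L = \<bar>M\<bar> + (\<Sum>i\<in>I. \<bar>t i\<bar>) + 1"
  have L: "L > 0" by (auto simp: L_def intro: add_nonneg_pos sum_nonneg)
  have tL: "\<bar>M\<bar> + \<bar>t i\<bar> \<le> L" if "i \<in> I" for i
    using member_le_sum[OF that, of "\<lambda>i. \<bar>t i\<bar>"] fin by (auto simp: L_def)
  \<comment> \<open>\<open>E\<close> carries the unit cube to the cube of half side
    \<open>L\<close>; the \<open>f\<close> below is \<open>u - g u + t\<close> read in unit
    coordinates.\<close>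
  define E where "E v = (\<lambda>i. (2 * v (d i) - 1) * L)" for v :: "nat \<Rightarrow> real"
  define f where "f v k = ((E v (e k) - g (E v) (e k) + t (e k)) / L + 1) / 2" for v k
  have contE: "continuous_on UNIV E"
    unfolding E_def
    by (intro continuous_on_coordinatewise_then_product continuous_intros continuous_on_product_coordinates)
  obtain v where v: "\<And>k. k < n \<Longrightarrow> f v k = v k"
  proof (rule brouwer_cube_nat[of n f])
    fix k assume k: "k < n"
    have 1: "continuous_on UNIV (\<lambda>v. g (E v) (e k))"
      using continuous_on_compose2[OF cont[OF eI[OF k]] contE] by simp
    have 2: "continuous_on UNIV (\<lambda>v. E v (e k))"
      by (rule continuous_on_product_then_coordinatewise[OF contE])
    show "continuous_on {u. \<forall>i. u i \<in> (if i < n then {0..1} else {0})} (\<lambda>u. f u k)"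
      unfolding f_def
      using L by (intro continuous_intros continuous_on_subset[OF 1] continuous_on_subset[OF 2]) auto
    fix u :: "nat \<Rightarrow> real"
    have "\<bar>E u (e k) - g (E u) (e k) + t (e k)\<bar> \<le> L"
      using M[OF eI[OF k], of "E u"] tL[OF eI[OF k]] by (smt (verit))
    then show "f u k \<in> {0..1}"
      using L by (auto simp: f_def abs_le_iff field_simps)
  qed auto
  show ?thesis
  proof (rule that[of "E v"])
    fix i assume i: "i \<in> I"
    have "f v (d i) = v (d i)" using v ed(2)[OF i] by simp
    then have "E v i - g (E v) i + t i = (2 * v (d i) - 1) * L"
      using L ed(1)[OF i] by (simp add: f_def field_simps)
    then show "g (E v) i = t i" by (simp add: E_def)
  qed
qed

section \<open>Generating functions and the discrete action\<close>

text \<open>\<open>g\<close> is the gradient, and C^1 is all the regularity demanded.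
  \<open>1 + snd (snd (g q))\<close> is the conformal factor of the map generated by
  \<open>f\<close>, hence its positivity.\<close>

definition genfun :: "real \<Rightarrow> ('a::euclidean_space \<times> 'a \<times> real \<Rightarrow> real) \<Rightarrow>
    ('a \<times> 'a \<times> real \<Rightarrow> 'a \<times> 'a \<times> real) \<Rightarrow> bool" where
  "genfun R f g \<longleftrightarrow> (\<forall>q. (f has_derivative (\<lambda>v. g q \<bullet> v)) (at q)) \<and> continuous_on UNIV g \<and>
     (\<forall>q. 0 \<le> f q) \<and> (\<forall>q. 0 < 1 + snd (snd (g q))) \<and>
     (\<forall>x p z. f (x, p, z + 1) = f (x, p, z)) \<and>
     (\<forall>x p z. R < norm x \<or> R < norm p \<longrightarrow> f (x, p, z) = 0)"

lemma abs_snd_snd_le: "\<bar>snd (snd q)\<bar> \<le> norm (q :: 'a::real_normed_vector \<times> 'b::real_normed_vector \<times> real)"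
proof -
  have "norm (snd (snd q)) \<le> norm (snd q)" "norm (snd q) \<le> norm q"
    by (metis norm_snd_le prod.collapse)+
  then show ?thesis by simp
qed

lemma periodic_frac:
  fixes h :: "real \<Rightarrow> 'b"
  assumes "\<And>z. h (z + 1) = h z"
  shows "h (frac z) = h z"
proof -
  have nat: "h (z + real n) = h z" for z n
  proof (induction n)
    case (Suc n)
    have "h (z + real (Suc n)) = h ((z + real n) + 1)" by (simp add: algebra_simps)
    then show ?case using assms Suc by simp
  qed simp
  have int: "h (z + of_int k) = h z" for z k
  proof (cases "k \<ge> 0")
    case True
    then show ?thesis using nat[of z "nat k"] by simp
  next
    case False
    then show ?thesis using nat[of "z + of_int k" "nat (-k)"] by simp
  qed
  show ?thesis using int[of "z" "- \<lfloor>z\<rfloor>"] by (simp add: frac_def)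
qed

context
  fixes R :: real and f :: "'a::euclidean_space \<times> 'a \<times> real \<Rightarrow> real" and g
  assumes gf: "genfun R f g"
begin

lemma genfun_deriv: "(f has_derivative (\<lambda>v. g q \<bullet> v)) (at q)"
  and genfun_cont_grad: "continuous_on UNIV g"
  and genfun_nonneg: "0 \<le> f q"
  and genfun_factor_pos: "0 < 1 + snd (snd (g q))"
  and genfun_periodic: "f (x, p, z + 1) = f (x, p, z)"
  and genfun_outside: "R < norm x \<or> R < norm p \<Longrightarrow> f (x, p, z) = 0"
  using gf unfolding genfun_def by blast+

lemma genfun_cont: "continuous_on UNIV f"
  by (rule continuous_at_imp_continuous_on) (blast intro: has_derivative_continuous genfun_deriv)

lemma genfun_grad_unique:
  assumes "(f has_derivative (\<lambda>v. a \<bullet> v)) (at q)"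
  shows "g q = a"
proof -
  have "g q \<bullet> v = a \<bullet> v" for v
    using has_derivative_unique[OF assms genfun_deriv] by metis
  then show ?thesis by (metis vector_eq_rdot)
qed

lemma genfun_grad_periodic: "g (x, p, z + 1) = g (x, p, z)"
proof -
  have sh: "((\<lambda>q. q + (0, 0, 1)) has_derivative (\<lambda>v. v)) (at (x, p, z))"
    by (auto intro!: derivative_eq_intros)
  have "((\<lambda>q. f (q + (0, 0, 1))) has_derivative (\<lambda>v. g ((x, p, z) + (0, 0, 1)) \<bullet> v)) (at (x, p, z))"
    by (rule has_derivative_compose[OF sh genfun_deriv])
  moreover have "(\<lambda>q. f (q + (0, 0, 1))) = f"
    by (auto simp: genfun_periodic)
  ultimately show ?thesis using genfun_grad_unique by fastforce
qed

lemma genfun_grad_outside: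
  assumes "R < norm x \<or> R < norm p"
  shows "g (x, p, z) = 0"
proof -
  define S where "S = {q :: 'a \<times> 'a \<times> real. R < norm (fst q) \<or> R < norm (fst (snd q))}"
  have "open S" unfolding S_def
    by (intro open_Collect_disj open_Collect_less continuous_intros)
  moreover have "(x, p, z) \<in> S" using assms by (auto simp: S_def)
  moreover have "f q = 0" if "q \<in> S" for q
    using that genfun_outside by (cases q) (auto simp: S_def)
  moreover have "((\<lambda>_. 0) has_derivative (\<lambda>v. 0 \<bullet> v)) (at (x, p, z))" by simp
  ultimately have "(f has_derivative (\<lambda>v. 0 \<bullet> v)) (at (x, p, z))"
    using has_derivative_transform_within_open[of "\<lambda>_. 0" _ "(x, p, z)" UNIV S f] by metis
  then show ?thesis by (rule genfun_grad_unique)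
qed

text \<open>Periodicity and vanishing outside \<open>R\<close> reduce everything to a compact set.
  The last bound is for the product of the z-derivative with the unbounded momentum; it holds
  because that derivative vanishes once the momentum exceeds \<open>R\<close>.\<close>

lemma genfun_bounds:
  obtains M m where "0 < m" "\<And>q. f q \<le> M" "\<And>q. norm (g q) \<le> M" "\<And>q. m \<le> 1 + snd (snd (g q))"
    "\<And>x p z. \<bar>snd (snd (g (x, p, z)))\<bar> * norm p \<le> M"
proof -
  define K where "K = cball (0::'a) R \<times> cball (0::'a) R \<times> {0..1::real}"
  have cK: "compact K" unfolding K_def by (intro compact_Times) auto
  have red: "h q \<in> insert 0 (h ` K)"
    if per: "\<And>x p z. h (x, p, z + 1) = h (x, p, z)"
      and out: "\<And>x p z. R < norm x \<or> R < norm p \<Longrightarrow> h (x, p, z) = 0"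
    for h :: "'a \<times> 'a \<times> real \<Rightarrow> 'c::real_normed_vector" and q
  proof -
    obtain x p z where q: "q = (x, p, z)" by (cases q)
    show ?thesis
    proof (cases "R < norm x \<or> R < norm p")
      case False
      then have "(x, p, frac z) \<in> K" by (auto simp: K_def frac_lt_1 less_imp_le)
      moreover have "h q = h (x, p, frac z)"
        unfolding q using periodic_frac[of "\<lambda>z. h (x, p, z)" z] per by simp
      ultimately show ?thesis by auto
    qed (use out q in auto)
  qed
  have "bounded (f ` K)" "bounded (g ` K)"
    by (auto intro!: compact_imp_bounded compact_continuous_image cK
        continuous_on_subset[OF genfun_cont] continuous_on_subset[OF genfun_cont_grad])
  then obtain A B where A: "\<And>q. q \<in> K \<Longrightarrow> norm (f q) \<le> A" and B: "\<And>q. q \<in> K \<Longrightarrow> norm (g q) \<le> B"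
    unfolding bounded_iff by blast
  have fA: "f q \<le> \<bar>A\<bar>" for q
    using red[of f q, OF genfun_periodic genfun_outside] A by fastforce
  have gB: "norm (g q) \<le> \<bar>B\<bar>" for q
    using red[of g q, OF genfun_grad_periodic genfun_grad_outside] B by fastforce
  have "\<exists>m>0. \<forall>q\<in>K. m \<le> 1 + snd (snd (g q))"
  proof (cases "K = {}")
    case False
    have "continuous_on K (\<lambda>q. 1 + snd (snd (g q)))"
      by (intro continuous_intros continuous_on_subset[OF genfun_cont_grad]) auto
    from continuous_attains_inf[OF cK False this] obtain q0 where
      "q0 \<in> K" "\<forall>q\<in>K. 1 + snd (snd (g q0)) \<le> 1 + snd (snd (g q))" by blast
    then show ?thesis using genfun_factor_pos by blast
  qed (auto intro: exI[of _ 1])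
  then obtain m where m: "m > 0" "\<And>q. q \<in> K \<Longrightarrow> m \<le> 1 + snd (snd (g q))" by blast
  have m': "min m 1 \<le> 1 + snd (snd (g q))" for q
  proof -
    have "g q = 0 \<or> (\<exists>q'\<in>K. g q = g q')"
      using red[of g q, OF genfun_grad_periodic genfun_grad_outside] by blast
    then show ?thesis using m(2) by force
  qed
  have "\<bar>snd (snd (g (x, p, z)))\<bar> * norm p \<le> \<bar>B\<bar> * \<bar>R\<bar>" for x p z
  proof (cases "R < norm p")
    case True
    then show ?thesis using genfun_grad_outside by simp
  next
    case False
    have "\<bar>snd (snd (g (x, p, z)))\<bar> \<le> norm (g (x, p, z))"
      using abs_snd_snd_le .
    then show ?thesis using gB[of "(x, p, z)"] False by (intro mult_mono) auto
  qed
  moreover have "0 \<le> \<bar>A\<bar> + \<bar>B\<bar> + \<bar>B\<bar> * \<bar>R\<bar>" "\<bar>A\<bar> \<le> \<bar>A\<bar> + \<bar>B\<bar> + \<bar>B\<bar> * \<bar>R\<bar>"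
    "\<bar>B\<bar> \<le> \<bar>A\<bar> + \<bar>B\<bar> + \<bar>B\<bar> * \<bar>R\<bar>" "\<bar>B\<bar> * \<bar>R\<bar> \<le> \<bar>A\<bar> + \<bar>B\<bar> + \<bar>B\<bar> * \<bar>R\<bar>" by simp_all
  ultimately show ?thesis
    using m(1) m' order_trans[OF fA] order_trans[OF gB]
      order_trans[OF \<open>\<And>x p z. \<bar>snd (snd (g (x, p, z)))\<bar> * norm p \<le> \<bar>B\<bar> * \<bar>R\<bar>\<close>]
    by (intro that[of "min m 1" "\<bar>A\<bar> + \<bar>B\<bar> + \<bar>B\<bar> * \<bar>R\<bar>"]) auto
qed

end

text \<open>A configuration \<open>(x, p, z)\<close> lists the positions \<open>x\<^sub>j\<close> and the new momenta
  \<open>p\<^sub>j = y\<^sub>j\<^sub>+\<^sub>1\<close> of a closed chain of \<open>N\<close> steps (so \<open>x\<^sub>N = x\<^sub>0\<close>) together with the initial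
  height \<open>z = z\<^sub>0\<close>. Entries of index \<open>N\<close> and beyond are irrelevant.\<close>

type_synonym 'a cfg = "(nat \<Rightarrow> 'a) \<times> (nat \<Rightarrow> 'a) \<times> real"

abbreviation cx :: "'a cfg \<Rightarrow> nat \<Rightarrow> 'a" where "cx c \<equiv> fst c"
abbreviation cp :: "'a cfg \<Rightarrow> nat \<Rightarrow> 'a" where "cp c \<equiv> fst (snd c)"
abbreviation cz :: "'a cfg \<Rightarrow> real" where "cz c \<equiv> snd (snd c)"

definition nxt :: "nat \<Rightarrow> nat \<Rightarrow> nat" where "nxt N j = (if Suc j = N then 0 else Suc j)"
definition prv :: "nat \<Rightarrow> nat \<Rightarrow> nat" where "prv N j = (if j = 0 then N - 1 else j - 1)"

lemma sum_nxt_prv: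
  fixes h :: "nat \<Rightarrow> nat \<Rightarrow> 'b::comm_monoid_add"
  assumes "N > 0"
  shows "(\<Sum>j<N. h j (nxt N j)) = (\<Sum>j<N. h (prv N j) j)"
  by (rule sum.reindex_bij_witness[of _ "prv N" "nxt N"])
    (use assms in \<open>auto simp: nxt_def prv_def split: if_splits\<close>)

text \<open>Height is not an independent variable: each step solves the defining equation of the
  generating function for the new height, so only the initial height remains free.\<close>

primrec zc :: "nat \<Rightarrow> (nat \<Rightarrow> 'a::euclidean_space \<times> 'a \<times> real \<Rightarrow> real) \<Rightarrow> 'a cfg \<Rightarrow> nat \<Rightarrow> real" where
  "zc N f c 0 = cz c"
| "zc N f c (Suc j) = zc N f c j + cp c j \<bullet> (cx c (nxt N j) - cx c j) + f j (cx c j, cp c j, zc N f c j)"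

definition pnt where "pnt N f c j = (cx c j, cp c j, zc N f c j)"

definition act where "act N f c = zc N f c N - cz c"

text \<open>Inverse of the accumulated conformal factor; it plays the part of the momentum dual to \<open>z\<close>.\<close>

primrec th :: "nat \<Rightarrow> (nat \<Rightarrow> 'a::euclidean_space \<times> 'a \<times> real \<Rightarrow> real) \<Rightarrow>
    (nat \<Rightarrow> 'a \<times> 'a \<times> real \<Rightarrow> 'a \<times> 'a \<times> real) \<Rightarrow> 'a cfg \<Rightarrow> nat \<Rightarrow> real" where
  "th N f g c 0 = 1"
| "th N f g c (Suc j) = th N f g c j / (1 + snd (snd (g j (pnt N f c j))))"

text \<open>\<open>gX\<close>, \<open>gP\<close> and \<open>gZ\<close> are the partial derivatives
  of \<open>act\<close> times the positive number \<open>th N f g c N\<close>: height gained in step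
  \<open>j\<close> reaches the end multiplied by the quotient of \<open>th\<close> at
  \<open>Suc j\<close> and at \<open>N\<close>. The two terms of \<open>gX\<close> come from the
  steps into and out of position \<open>j\<close>.\<close>

definition gX where "gX N f g c j = th N f g c (Suc (prv N j)) *\<^sub>R cp c (prv N j) +
    th N f g c (Suc j) *\<^sub>R (fst (g j (pnt N f c j)) - cp c j)"
definition gP where "gP N f g c j =
    th N f g c (Suc j) *\<^sub>R (cx c (nxt N j) - cx c j + fst (snd (g j (pnt N f c j))))"
definition gZ where "gZ N f g c = 1 - th N f g c N"

definition dF where "dF N f g c v =
    (\<Sum>j<N. gX N f g c j \<bullet> cx v j + gP N f g c j \<bullet> cp v j) + gZ N f g c * cz v"

text \<open>The move is along \<open>-v\<close>, so directions on which \<open>dF\<close> is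
  positive decrease the action.\<close>

definition mv :: "real \<Rightarrow> 'a::real_vector cfg \<Rightarrow> 'a cfg \<Rightarrow> 'a cfg" where
  "mv s c v = (\<lambda>i. cx c i - s *\<^sub>R cx v i, \<lambda>i. cp c i - s *\<^sub>R cp v i, cz c - s * cz v)"

lemma mv_simps [simp]: "cx (mv s c v) i = cx c i - s *\<^sub>R cx v i"
  "cp (mv s c v) i = cp c i - s *\<^sub>R cp v i" "cz (mv s c v) = cz c - s * cz v"
  by (auto simp: mv_def)

lemma mv_0 [simp]: "mv 0 c v = c"
  by (simp add: mv_def)

definition shift :: "'a cfg \<Rightarrow> 'a cfg" where "shift c = (cx c, cp c, cz c + 1)"

lemma shift_simps [simp]: "cx (shift c) = cx c" "cp (shift c) = cp c" "cz (shift c) = cz c + 1"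
  by (auto simp: shift_def)

lemma cont_cx: "continuous_on UNIV (\<lambda>c::'a::euclidean_space cfg. cx c i)"
  and cont_cp: "continuous_on UNIV (\<lambda>c::'a::euclidean_space cfg. cp c i)"
  and cont_cz: "continuous_on UNIV (\<lambda>c::'a::euclidean_space cfg. cz c)"
  by (intro continuous_on_product_then_coordinatewise[where f = fst]
      continuous_on_product_then_coordinatewise[where f = "\<lambda>c. fst (snd c)"]
      continuous_on_fst continuous_on_snd continuous_on_id)+

section \<open>First variation of the action of a closed chain\<close>

locale chain =
  fixes N :: nat and R :: real
    and f :: "nat \<Rightarrow> 'a::euclidean_space \<times> 'a \<times> real \<Rightarrow> real" and g
  assumes N2: "2 \<le> N" and gen: "\<And>j. genfun R (f j) (g j)"
begin

abbreviation "Z \<equiv> zc N f"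
abbreviation "T \<equiv> th N f g"
abbreviation "Pt \<equiv> pnt N f"
abbreviation "GX \<equiv> gX N f g"
abbreviation "GP \<equiv> gP N f g"
abbreviation "GZ \<equiv> gZ N f g"
abbreviation "D \<equiv> dF N f g"
abbreviation "A \<equiv> act N f"

lemma th_pos: "0 < T c j"
  by (induction j) (auto intro!: divide_pos_pos genfun_factor_pos[OF gen])

lemma th_Suc_mult: "T c (Suc j) * (1 + snd (snd (g j (Pt c j)))) = T c j"
  using genfun_factor_pos[OF gen, of j "Pt c j"] by simp

text \<open>Variation of constants: with f_z the z-derivative, the velocity of the height satisfies
  zd_{j+1} = (1 + f_z) zd_j - r_j, and \<open>th\<close> is the integrating factor.\<close>

lemma zc_deriv:
  fixes c v :: "'a cfg"
  defines "r \<equiv> \<lambda>c i. (cx c (nxt N i) - cx c i + fst (snd (g i (Pt c i)))) \<bullet> cp v i +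
      cp c i \<bullet> cx v (nxt N i) + (fst (g i (Pt c i)) - cp c i) \<bullet> cx v i"
  shows "((\<lambda>s. Z (mv s c v) j) has_real_derivative
     - (cz v + (\<Sum>i<j. T (mv s c v) (Suc i) * r (mv s c v) i)) / T (mv s c v) j) (at s)"
proof (induction j)
  case 0
  show ?case by (auto intro!: derivative_eq_intros)
next
  case (Suc j)
  define c' where "c' = mv s c v"
  define zd where "zd = - (cz v + (\<Sum>i<j. T c' (Suc i) * r c' i)) / T c' j"
  have IH: "((\<lambda>s. Z (mv s c v) j) has_vector_derivative zd) (at s)"
    using Suc by (simp add: zd_def c'_def has_real_derivative_iff_has_vector_derivative)
  have px: "((\<lambda>s. cx (mv s c v) i) has_vector_derivative - cx v i) (at s)"
    and pp: "((\<lambda>s. cp (mv s c v) i) has_vector_derivative - cp v i) (at s)" for i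
    by (auto intro!: derivative_eq_intros simp: has_vector_derivative_def)
  have "((\<lambda>s. Pt (mv s c v) j) has_vector_derivative (- cx v j, - cp v j, zd)) (at s)"
    unfolding pnt_def by (intro has_vector_derivative_Pair px pp IH)
  from vector_derivative_diff_chain_within[OF this has_derivative_at_withinI[OF genfun_deriv[OF gen]]]
  have f: "((\<lambda>s. f j (Pt (mv s c v) j)) has_real_derivative g j (Pt c' j) \<bullet> (- cx v j, - cp v j, zd)) (at s)"
    by (auto simp: o_def c'_def has_real_derivative_iff_has_vector_derivative)
  have b: "((\<lambda>s. cp (mv s c v) j \<bullet> (cx (mv s c v) (nxt N j) - cx (mv s c v) j)) has_real_derivative
       cp c' j \<bullet> (- cx v (nxt N j) + cx v j) - cp v j \<bullet> (cx c' (nxt N j) - cx c' j)) (at s)"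
    unfolding has_field_derivative_def c'_def
    by (auto intro!: derivative_eq_intros simp: algebra_simps fun_eq_iff inner_commute)
  have "((\<lambda>s. Z (mv s c v) (Suc j)) has_real_derivative
      zd + (cp c' j \<bullet> (- cx v (nxt N j) + cx v j) - cp v j \<bullet> (cx c' (nxt N j) - cx c' j)) +
      g j (Pt c' j) \<bullet> (- cx v j, - cp v j, zd)) (at s)"
    using DERIV_add[OF DERIV_add[OF Suc[folded c'_def zd_def] b] f] by (simp add: pnt_def zd_def c'_def)
  moreover have "zd + (cp c' j \<bullet> (- cx v (nxt N j) + cx v j) - cp v j \<bullet> (cx c' (nxt N j) - cx c' j)) +
      g j (Pt c' j) \<bullet> (- cx v j, - cp v j, zd) =
      - (cz v + (\<Sum>i<Suc j. T c' (Suc i) * r c' i)) / T c' (Suc j)" (is "?l = ?r")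
  proof -
    have "g j (Pt c' j) \<bullet> (- cx v j, - cp v j, zd) =
       - (fst (g j (Pt c' j)) \<bullet> cx v j) - fst (snd (g j (Pt c' j))) \<bullet> cp v j + snd (snd (g j (Pt c' j))) * zd"
      by (cases "g j (Pt c' j)") simp
    then have "?l = (1 + snd (snd (g j (Pt c' j)))) * zd - r c' j"
      by (simp add: r_def algebra_simps inner_commute)
    then have "T c' (Suc j) * ?l = T c' j * zd - T c' (Suc j) * r c' j"
      by (simp only: th_Suc_mult[of c' j, symmetric]) (simp add: algebra_simps del: th.simps)
    also have "\<dots> = T c' (Suc j) * ?r"
      using th_pos[of c' j] th_pos[of c' "Suc j"]
      by (simp add: zd_def distrib_left del: th.simps)
    finally show ?thesis by (rule mult_left_cancel[THEN iffD1, OF less_imp_neq[OF th_pos, symmetric]])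
  qed
  ultimately show ?case by (simp only: c'_def)
qed

lemma act_deriv:
  "((\<lambda>s. A (mv s c v)) has_real_derivative - D (mv s c v) v / T (mv s c v) N) (at s)"
proof -
  define c' where "c' = mv s c v"
  define r where "r i = (cx c' (nxt N i) - cx c' i + fst (snd (g i (Pt c' i)))) \<bullet> cp v i +
      cp c' i \<bullet> cx v (nxt N i) + (fst (g i (Pt c' i)) - cp c' i) \<bullet> cx v i" for i
  have 1: "((\<lambda>s. Z (mv s c v) N) has_real_derivative
     - (cz v + (\<Sum>i<N. T c' (Suc i) * r i)) / T c' N) (at s)"
    using zc_deriv[of c v N s] by (simp add: c'_def r_def del: th.simps)
  have 2: "((\<lambda>s. cz (mv s c v)) has_real_derivative - cz v) (at s)"
    by (auto intro!: derivative_eq_intros)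
  \<comment> \<open>Cyclic reindexing: the momentum of a step is charged to the position that the
    step leads to.\<close>
  have "(\<Sum>i<N. T c' (Suc i) * (cp c' i \<bullet> cx v (nxt N i))) =
      (\<Sum>i<N. T c' (Suc (prv N i)) * (cp c' (prv N i) \<bullet> cx v i))"
    by (rule sum_nxt_prv) (use N2 in simp)
  then have "(\<Sum>i<N. T c' (Suc i) * r i) = (\<Sum>j<N. GX c' j \<bullet> cx v j + GP c' j \<bullet> cp v j)"
    by (simp add: r_def gX_def gP_def algebra_simps sum.distrib sum_subtractf del: th.simps)
  then have "- (cz v + (\<Sum>i<N. T c' (Suc i) * r i)) / T c' N - (- cz v) = - D c' v / T c' N"
    using th_pos[of c' N] by (simp add: dF_def gZ_def field_simps)
  then show ?thesis
    using DERIV_diff[OF 1 2] unfolding act_def c'_def by simp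
qed

lemma cont_zc: "continuous_on UNIV (\<lambda>c. Z c j)"
proof (induction j)
  case 0
  show ?case by (simp add: cont_cz)
next
  case (Suc j)
  have "continuous_on UNIV (\<lambda>c. f j (cx c j, cp c j, Z c j))"
    by (rule continuous_on_compose2[OF genfun_cont[OF gen]])
      (auto intro!: continuous_intros Suc cont_cx cont_cp)
  then show ?case
    by (auto intro!: continuous_intros Suc cont_cx cont_cp)
qed

lemma cont_pnt: "continuous_on UNIV (\<lambda>c. Pt c j)"
  unfolding pnt_def by (intro continuous_intros cont_cx cont_cp cont_zc)

lemma cont_g: "continuous_on UNIV (\<lambda>c. g j (Pt c j))"
  by (rule continuous_on_compose2[OF genfun_cont_grad[OF gen] cont_pnt]) simp

lemma cont_act: "continuous_on UNIV A"
  unfolding act_def by (intro continuous_intros cont_zc cont_cz)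

lemma cont_th: "continuous_on UNIV (\<lambda>c. T c j)"
proof (induction j)
  case (Suc j)
  have "1 + snd (snd (g j (Pt c j))) \<noteq> 0" for c
    using genfun_factor_pos[OF gen] by (metis less_irrefl)
  then show ?case
    by (auto intro!: continuous_intros Suc cont_g)
qed simp

lemma cont_gX: "continuous_on UNIV (\<lambda>c. GX c j)"
  and cont_gP: "continuous_on UNIV (\<lambda>c. GP c j)"
  and cont_gZ: "continuous_on UNIV (\<lambda>c. GZ c)"
  unfolding gX_def gP_def gZ_def
  by (intro continuous_intros cont_th cont_g cont_cx cont_cp)+

lemma zc_shift: "Z (shift c) j = Z c j + 1"
  by (induction j) (auto simp: genfun_periodic[OF gen])

lemma act_shift: "A (shift c) = A c"
  by (simp add: act_def zc_shift)

lemma g_shift: "g i (Pt (shift c) j) = g i (Pt c j)"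
  by (simp add: pnt_def zc_shift genfun_grad_periodic[OF gen])

lemma th_shift: "T (shift c) j = T c j"
  by (induction j) (auto simp: g_shift)

lemma grad_shift: "GX (shift c) j = GX c j" "GP (shift c) j = GP c j" "GZ (shift c) = GZ c"
  by (simp_all add: gX_def gP_def gZ_def th_shift g_shift del: th.simps)

lemma unif_bounds:
  obtains M m where "0 < m" "0 \<le> M" "\<And>j q. j < N \<Longrightarrow> f j q \<le> M" "\<And>j q. j < N \<Longrightarrow> norm (g j q) \<le> M"
    "\<And>j q. j < N \<Longrightarrow> m \<le> 1 + snd (snd (g j q))"
    "\<And>j x p z. j < N \<Longrightarrow> \<bar>snd (snd (g j (x, p, z)))\<bar> * norm p \<le> M"
proof -
  have "\<exists>M m. 0 < m \<and> 0 \<le> M \<and> (\<forall>j<k. (\<forall>q. f j q \<le> M \<and> norm (g j q) \<le> M \<and> m \<le> 1 + snd (snd (g j q))) \<and>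
      (\<forall>x p z. \<bar>snd (snd (g j (x, p, z)))\<bar> * norm p \<le> M))" for k
  proof (induction k)
    case 0
    show ?case by (auto intro!: exI[of _ 1])
  next
    case (Suc k)
    then obtain m M where I: "0 < m" "0 \<le> M" "\<And>j q. j < k \<Longrightarrow> f j q \<le> M" "\<And>j q. j < k \<Longrightarrow> norm (g j q) \<le> M"
      "\<And>j q. j < k \<Longrightarrow> m \<le> 1 + snd (snd (g j q))"
      "\<And>j x p z. j < k \<Longrightarrow> \<bar>snd (snd (g j (x, p, z)))\<bar> * norm p \<le> M" by blast
    obtain M' m' where J: "0 < m'" "\<And>q. f k q \<le> M'" "\<And>q. norm (g k q) \<le> M'"
      "\<And>q. m' \<le> 1 + snd (snd (g k q))"
      "\<And>x p z. \<bar>snd (snd (g k (x, p, z)))\<bar> * norm p \<le> M'"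
      by (rule genfun_bounds[OF gen[of k]], rule that)
    have A: "f j q \<le> max M M' \<and> norm (g j q) \<le> max M M' \<and> min m m' \<le> 1 + snd (snd (g j q))"
      if "j < Suc k" for j q
      using I(3-5)[of j q] J(2-4)[of q] that by (auto simp: less_Suc_eq le_max_iff_disj min_le_iff_disj)
    have B: "\<bar>snd (snd (g j (x, p, z)))\<bar> * norm p \<le> max M M'" if "j < Suc k" for j x p z
      using I(6)[of j x p z] J(5)[of x p z] that by (auto simp: less_Suc_eq le_max_iff_disj)
    show ?case
      using I(1,2) J(1) A B by (intro exI[of _ "max M M'"] exI[of _ "min m m'"]) simp
  qed
  from this[of N] show ?thesis using that by blast
qed

lemma th_bounds:
  obtains a b where "0 < a" "\<And>c j. j \<le> N \<Longrightarrow> a \<le> T c j" "\<And>c j. j \<le> N \<Longrightarrow> T c j \<le> b"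
proof -
  obtain M m where M: "0 < m" "0 \<le> M" "\<And>j q. j < N \<Longrightarrow> f j q \<le> M" "\<And>j q. j < N \<Longrightarrow> norm (g j q) \<le> M"
    "\<And>j q. j < N \<Longrightarrow> m \<le> 1 + snd (snd (g j q))"
    "\<And>j x p z. j < N \<Longrightarrow> \<bar>snd (snd (g j (x, p, z)))\<bar> * norm p \<le> M"
    by (rule unif_bounds, rule that)
  have up: "1 + snd (snd (g j q)) \<le> 1 + M" if "j < N" for j q
    using M(4)[OF that, of q] abs_snd_snd_le[of "g j q"] by linarith
  have "\<exists>a b. 0 < a \<and> (\<forall>j\<le>k. \<forall>c. a \<le> T c j \<and> T c j \<le> b)" if "k \<le> N" for k
    using that
  proof (induction k)
    case 0
    show ?case by (auto intro!: exI[of _ 1])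
  next
    case (Suc k)
    then have "\<exists>a b. 0 < a \<and> (\<forall>j\<le>k. \<forall>c. a \<le> T c j \<and> T c j \<le> b)" by simp
    then obtain a b where ab: "0 < a" "\<And>j c. j \<le> k \<Longrightarrow> a \<le> T c j" "\<And>j c. j \<le> k \<Longrightarrow> T c j \<le> b"
      by blast
    have k: "k < N" using Suc by simp
    have lo: "a / (1 + M) \<le> T c (Suc k)" and hi: "T c (Suc k) \<le> b / m" for c
    proof -
      show "a / (1 + M) \<le> T c (Suc k)"
        using ab(1) ab(2)[of k c] up[OF k, of "Pt c k"] M(2) genfun_factor_pos[OF gen, of k "Pt c k"]
        by (auto intro!: frac_le)
      show "T c (Suc k) \<le> b / m"
        using ab(1) ab(2,3)[of k c] M(1) M(5)[OF k, of "Pt c k"]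
        by (auto intro!: frac_le)
    qed
    have "min a (a / (1 + M)) \<le> T c j \<and> T c j \<le> max b (b / m)" if "j \<le> Suc k" for j c
      using ab(2,3)[of j c] lo[of c] hi[of c] that
      by (auto simp: le_Suc_eq min_le_iff_disj le_max_iff_disj simp del: th.simps)
    then show ?case
      using ab(1) M(2) by (intro exI[of _ "min a (a / (1 + M))"] exI[of _ "max b (b / m)"]) simp
  qed
  from this[of N] show ?thesis using that by blast
qed

end

section \<open>Descent away from critical points\<close>

definition LP :: "nat \<Rightarrow> 'a::euclidean_space cfg \<Rightarrow> nat \<Rightarrow> 'a" where
  "LP N c j = cx c (nxt N j) - cx c j"
text \<open>Gradient of the quadratic form in the positions, with the component at 0 left out: there
  \<open>GX\<close> contains \<open>T c N - 1\<close> times the last momentum, a product that the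
  uniform bounds do not control. The other components still determine the momenta up to a common
  translation.\<close>

definition LX :: "'a::euclidean_space cfg \<Rightarrow> nat \<Rightarrow> 'a" where
  "LX c j = (if j = 0 then 0 else cp c (j - 1) - cp c j)"
text \<open>A seminorm that vanishes, as far as the first \<open>N\<close> entries go, exactly on
  the null directions: all positions equal and all momenta equal. \<open>x_near_first\<close> and
  \<open>p_near_last\<close> make this quantitative.\<close>

definition ell :: "nat \<Rightarrow> 'a::euclidean_space cfg \<Rightarrow> real" where
  "ell N c = sqrt (\<Sum>j<N. (norm (LX c j))\<^sup>2 + (norm (LP N c j))\<^sup>2)"

text \<open>Pinning the remaining entries makes closed bounded sets of configurations compact in the
  product topology.\<close>

definition TT :: "nat \<Rightarrow> 'a::euclidean_space cfg set" where
  "TT N = {c. \<forall>j\<ge>N. cx c j = 0 \<and> cp c j = 0}"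

definition close :: "nat \<Rightarrow> real \<Rightarrow> 'a::euclidean_space cfg \<Rightarrow> 'a cfg \<Rightarrow> bool" where
  "close N s c c' \<longleftrightarrow> (\<forall>j<N. norm (cx c' j - cx c j) \<le> s \<and> norm (cp c' j - cp c j) \<le> s)"

lemma ell_nonneg: "0 \<le> ell N c"
  by (simp add: ell_def sum_nonneg)

lemma ell_sq: "(ell N c)\<^sup>2 = (\<Sum>j<N. (norm (LX c j))\<^sup>2 + (norm (LP N c j))\<^sup>2)"
  by (simp add: ell_def sum_nonneg)

lemma LP_le_ell: "j < N \<Longrightarrow> norm (LP N c j) \<le> ell N c"
  and LX_le_ell: "j < N \<Longrightarrow> norm (LX c j) \<le> ell N c"
proof -
  assume j: "j < N"
  have "(norm (LX c j))\<^sup>2 + (norm (LP N c j))\<^sup>2 \<le> (ell N c)\<^sup>2"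
    unfolding ell_sq using j by (intro member_le_sum) auto
  then have "(norm (LX c j))\<^sup>2 \<le> (ell N c)\<^sup>2" "(norm (LP N c j))\<^sup>2 \<le> (ell N c)\<^sup>2"
    by (smt (verit) zero_le_power2)+
  then show "norm (LP N c j) \<le> ell N c" "norm (LX c j) \<le> ell N c"
    using ell_nonneg power2_le_imp_le by blast+
qed

lemma close_LP:
  assumes "close N s c c'" "j < N"
  shows "norm (LP N c' j - LP N c j) \<le> 2 * s"
proof -
  have "nxt N j < N" using assms by (auto simp: nxt_def)
  then have "norm (cx c' (nxt N j) - cx c (nxt N j)) \<le> s" "norm (cx c' j - cx c j) \<le> s"
    using assms by (auto simp: close_def)
  moreover have "LP N c' j - LP N c j = (cx c' (nxt N j) - cx c (nxt N j)) - (cx c' j - cx c j)"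
    by (simp add: LP_def)
  ultimately show ?thesis by (smt (verit) norm_triangle_ineq4)
qed

lemma close_LX:
  assumes "close N s c c'" "j < N" "0 \<le> s"
  shows "norm (LX c' j - LX c j) \<le> 2 * s"
proof (cases "j = 0")
  case False
  then have "norm (cp c' (j - 1) - cp c (j - 1)) \<le> s" "norm (cp c' j - cp c j) \<le> s"
    using assms by (auto simp: close_def)
  moreover have "LX c' j - LX c j = (cp c' (j - 1) - cp c (j - 1)) - (cp c' j - cp c j)"
    using False by (simp add: LX_def)
  ultimately show ?thesis by (smt (verit) norm_triangle_ineq4)
qed (use assms in \<open>simp add: LX_def\<close>)

text \<open>\<open>u\<close> will be a component of the model gradient and \<open>t\<close> times
  \<open>u + w\<close> of the true one; a bounded error \<open>w\<close> costs only a term linear in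
  \<open>norm u\<close>.\<close>

lemma inner_lower:
  fixes u w :: "'a::real_inner"
  assumes "norm w \<le> K" "0 \<le> a" "a \<le> t" "t \<le> b"
  shows "t * ((u + w) \<bullet> u) \<ge> a * (norm u)\<^sup>2 - b * K * norm u"
proof -
  have "\<bar>w \<bullet> u\<bar> \<le> K * norm u"
    using Cauchy_Schwarz_ineq2[of w u] mult_right_mono[OF assms(1) norm_ge_zero[of u]] by linarith
  then have 1: "t * (w \<bullet> u) \<ge> - (t * (K * norm u))"
    using assms by (metis abs_le_D2 minus_le_iff mult_left_mono mult_minus_right order_trans)
  have 2: "t * (K * norm u) \<le> b * (K * norm u)"
    using assms order_trans[OF norm_ge_zero assms(1)] by (intro mult_right_mono) auto
  have 3: "t * (u \<bullet> u) \<ge> a * (u \<bullet> u)"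
    using assms by (intro mult_right_mono) auto
  show ?thesis using 1 2 3 by (simp add: inner_add_left algebra_simps power2_norm_eq_inner)
qed

lemma x_near_first:
  assumes "j < N"
  shows "norm (cx c j - cx c 0) \<le> real N * ell N c"
proof -
  have "norm (cx c j - cx c 0) \<le> real j * ell N c"
    using assms
  proof (induction j)
    case (Suc j)
    have "cx c (Suc j) - cx c 0 = LP N c j + (cx c j - cx c 0)"
      using Suc.prems by (simp add: LP_def nxt_def)
    then have "norm (cx c (Suc j) - cx c 0) \<le> norm (LP N c j) + norm (cx c j - cx c 0)"
      by (simp only: norm_triangle_ineq)
    then show ?case using Suc LP_le_ell[of j N c] by (simp add: algebra_simps)
  qed simp
  also have "\<dots> \<le> real N * ell N c"
    using assms by (intro mult_right_mono ell_nonneg) simp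
  finally show ?thesis .
qed

lemma p_near_last:
  assumes "j < N"
  shows "norm (cp c j - cp c (N - 1)) \<le> real N * ell N c"
proof -
  have "norm (cp c (N - 1 - k) - cp c (N - 1)) \<le> real k * ell N c" if "k < N" for k
    using that
  proof (induction k)
    case (Suc k)
    have "cp c (N - 1 - Suc k) - cp c (N - 1) = LX c (N - 1 - k) + (cp c (N - 1 - k) - cp c (N - 1))"
      using Suc.prems by (auto simp: LX_def)
    then have "norm (cp c (N - 1 - Suc k) - cp c (N - 1)) \<le>
        norm (LX c (N - 1 - k)) + norm (cp c (N - 1 - k) - cp c (N - 1))"
      by (simp only: norm_triangle_ineq)
    then show ?case using Suc LX_le_ell[of "N - 1 - k" N c] by (simp add: algebra_simps)
  qed simp
  from this[of "N - 1 - j"] have "norm (cp c j - cp c (N - 1)) \<le> real (N - 1 - j) * ell N c"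
    using assms by simp
  also have "\<dots> \<le> real N * ell N c"
    by (intro mult_right_mono ell_nonneg) simp
  finally show ?thesis .
qed

lemma sum_LP: "N > 0 \<Longrightarrow> (\<Sum>j<N. LP N c j) = 0"
  using sum_nxt_prv[of N "\<lambda>j k. cx c k"] by (simp add: LP_def sum_subtractf)

text \<open>The increments of a closed chain sum to 0, so the last momentum may be subtracted
  throughout. This exhibits the last momentum and the first position as null directions.\<close>

lemma quad_form:
  assumes "2 \<le> N"
  shows "(\<Sum>j<N. cp c j \<bullet> LP N c j) = (\<Sum>j<N-1. (cp c j - cp c (N - 1)) \<bullet> LP N c j)"
proof -
  obtain n where N: "N = Suc n" using assms by (cases N) auto
  have "(\<Sum>j<N. cp c j \<bullet> LP N c j) = (\<Sum>j<N. (cp c j - cp c (N - 1)) \<bullet> LP N c j)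
      + cp c (N - 1) \<bullet> (\<Sum>j<N. LP N c j)"
    by (simp add: inner_sum_right sum.distrib[symmetric] inner_diff_left)
  then show ?thesis using sum_LP[of N c] by (simp add: N)
qed

lemma continuous_on_cfg:
  assumes "\<And>i. continuous_on S (\<lambda>c. X c i)" "\<And>i. continuous_on S (\<lambda>c. P c i)" "continuous_on S z"
  shows "continuous_on S (\<lambda>c. (X c, P c, z c))"
  using assms by (intro continuous_on_Pair continuous_on_coordinatewise_then_product)

context chain
begin

lemma th_inactive:
  "(\<forall>j<N. R < norm (cx c j) \<or> R < norm (cp c j)) \<Longrightarrow> j \<le> N \<Longrightarrow> T c j = 1"
  by (induction j) (auto simp: pnt_def genfun_grad_outside[OF gen])

text \<open>Two directions of descent: \<open>Uv\<close>, the model gradient built from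
  \<open>LX\<close> and \<open>LP\<close>, for use far out, and \<open>gv\<close>, the rescaled true
  gradient, for use on a compact part.\<close>

definition Uv :: "'a cfg \<Rightarrow> 'a cfg" where
  "Uv c = (\<lambda>j. if j < N then LX c j else 0, \<lambda>j. if j < N then LP N c j else 0, 0)"
definition gv :: "'a cfg \<Rightarrow> 'a cfg" where
  "gv c = (\<lambda>j. if j < N then GX c j else 0, \<lambda>j. if j < N then GP c j else 0, GZ c)"
definition gsq :: "'a cfg \<Rightarrow> real" where
  "gsq c = (\<Sum>j<N. (norm (GX c j))\<^sup>2 + (norm (GP c j))\<^sup>2) + (GZ c)\<^sup>2"

lemma D_Uv: "D c' (Uv c) = (\<Sum>j<N. GX c' j \<bullet> LX c j + GP c' j \<bullet> LP N c j)"
  by (simp add: dF_def Uv_def)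

lemma D_gv: "D c (gv c) = gsq c"
  unfolding dF_def gv_def gsq_def power2_norm_eq_inner by (simp add: power2_eq_square)

text \<open>The true gradient differs from a weighted model gradient by bounded terms, so the error
  is only linear in \<open>ell\<close>. The derivative is taken at \<open>c'\<close> in the
  direction belonging to \<open>c\<close> because the deformation follows a segment whose direction
  is fixed at its start.\<close>

lemma far_estimate:
  obtains m C where "0 < m" "0 \<le> C"
    "\<And>c c'. close N 1 c c' \<Longrightarrow> m * (ell N c)\<^sup>2 - C * ell N c \<le> D c' (Uv c)"
proof -
  obtain a b where ab: "0 < a" "\<And>c j. j \<le> N \<Longrightarrow> a \<le> T c j" "\<And>c j. j \<le> N \<Longrightarrow> T c j \<le> b"
    by (rule th_bounds, rule that)
  obtain M m where M: "0 < m" "0 \<le> M" "\<And>j q. j < N \<Longrightarrow> f j q \<le> M" "\<And>j q. j < N \<Longrightarrow> norm (g j q) \<le> M"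
    "\<And>j q. j < N \<Longrightarrow> m \<le> 1 + snd (snd (g j q))"
    "\<And>j x p z. j < N \<Longrightarrow> \<bar>snd (snd (g j (x, p, z)))\<bar> * norm p \<le> M"
    by (rule unif_bounds, rule that)
  have b0: "0 \<le> b" using ab(1) ab(2,3)[of 0] by force
  define C where "C = real N * (b * (2 + M) + (b * 2 + b * (2 * M)))"
  have "a * (ell N c)\<^sup>2 - C * ell N c \<le> D c' (Uv c)" if cl: "close N 1 c c'" for c c'
  proof -
    have P: "a * (norm (LP N c j))\<^sup>2 - b * (2 + M) * ell N c \<le> GP c' j \<bullet> LP N c j" if j: "j < N" for j
    proof -
      define w where "w = LP N c' j - LP N c j + fst (snd (g j (Pt c' j)))"
      have "norm (fst (snd (g j (Pt c' j)))) \<le> norm (snd (g j (Pt c' j)))"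
        "norm (snd (g j (Pt c' j))) \<le> norm (g j (Pt c' j))"
        by (metis norm_fst_le norm_snd_le prod.collapse)+
      then have "norm w \<le> 2 + M"
        unfolding w_def
        using norm_triangle_ineq[of "LP N c' j - LP N c j" "fst (snd (g j (Pt c' j)))"]
          close_LP[OF cl j] M(4)[OF j, of "Pt c' j"] by linarith
      from inner_lower[OF this, of a "T c' (Suc j)" b "LP N c j"] ab(1) ab(2,3)[of "Suc j" c'] j
      have "a * (norm (LP N c j))\<^sup>2 - b * (2 + M) * norm (LP N c j) \<le> T c' (Suc j) * ((LP N c j + w) \<bullet> LP N c j)"
        by (simp del: th.simps)
      also have "\<dots> = GP c' j \<bullet> LP N c j"
        by (simp add: gP_def w_def LP_def del: th.simps)
      finally show ?thesis
        using mult_left_mono[OF LP_le_ell[OF j, of c], of "b * (2 + M)"] b0 M(2) by simp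
    qed
    have X: "a * (norm (LX c j))\<^sup>2 - (b * 2 + b * (2 * M)) * ell N c \<le> GX c' j \<bullet> LX c j" if j: "j < N" for j
    proof (cases "j = 0")
      case True
      then show ?thesis using b0 M(2) ell_nonneg[of N c] by (simp add: LX_def)
    next
      case False
      define w where "w = LX c' j - LX c j"
      \<comment> \<open>Writing \<open>T c' j\<close> as \<open>T c' (Suc j)\<close> times the
        conformal factor splits off the momentum difference exactly. In the remainder
        \<open>y\<close> the unbounded momentum occurs only multiplied by the z-derivative.\<close>
      define y where "y = fst (g j (Pt c' j)) + snd (snd (g j (Pt c' j))) *\<^sub>R cp c' j"
      have w: "norm w \<le> 2" unfolding w_def using close_LX[OF cl j] by simp
      from inner_lower[OF this, of a "T c' j" b "LX c j"] ab(1) ab(2,3)[of j c'] j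
      have 1: "a * (norm (LX c j))\<^sup>2 - b * 2 * norm (LX c j) \<le> T c' j * ((LX c j + w) \<bullet> LX c j)"
        by simp
      have "norm (fst (g j (Pt c' j))) \<le> norm (g j (Pt c' j))"
        by (metis norm_fst_le prod.collapse)
      then have y: "norm y \<le> 2 * M"
        unfolding y_def
        using norm_triangle_ineq[of "fst (g j (Pt c' j))" "snd (snd (g j (Pt c' j))) *\<^sub>R cp c' j"]
          M(4)[OF j, of "Pt c' j"] M(6)[OF j, of "cx c' j" "cp c' j" "Z c' j"]
        by (simp add: pnt_def)
      have "\<bar>y \<bullet> LX c j\<bar> \<le> 2 * M * norm (LX c j)"
        using Cauchy_Schwarz_ineq2[of y "LX c j"] mult_right_mono[OF y norm_ge_zero[of "LX c j"]] by linarith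
      then have "T c' (Suc j) * \<bar>y \<bullet> LX c j\<bar> \<le> b * (2 * M * norm (LX c j))"
        using ab(3)[of "Suc j" c'] th_pos[of c' "Suc j"] j b0 by (intro mult_mono) auto
      moreover have "\<bar>T c' (Suc j) * (y \<bullet> LX c j)\<bar> = T c' (Suc j) * \<bar>y \<bullet> LX c j\<bar>"
        using th_pos[of c' "Suc j"] by (simp only: abs_mult abs_of_pos)
      ultimately have 2: "- (b * (2 * M) * norm (LX c j)) \<le> T c' (Suc j) * (y \<bullet> LX c j)"
        by (simp del: th.simps add: mult.assoc)
      have "GX c' j = T c' j *\<^sub>R cp c' (j - 1) + T c' (Suc j) *\<^sub>R (fst (g j (Pt c' j)) - cp c' j)"
        using False by (simp add: gX_def prv_def del: th.simps)
      also have "\<dots> = T c' j *\<^sub>R (cp c' (j - 1) - cp c' j) + T c' (Suc j) *\<^sub>R y"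
        unfolding y_def th_Suc_mult[of c' j, symmetric]
        by (simp add: algebra_simps del: th.simps)
      also have "\<dots> = T c' j *\<^sub>R (LX c j + w) + T c' (Suc j) *\<^sub>R y"
        using False by (simp add: w_def LX_def)
      finally have "GX c' j \<bullet> LX c j = T c' j * ((LX c j + w) \<bullet> LX c j) + T c' (Suc j) * (y \<bullet> LX c j)"
        by (simp add: inner_add_left del: th.simps)
      then have "a * (norm (LX c j))\<^sup>2 - (b * 2 + b * (2 * M)) * norm (LX c j) \<le> GX c' j \<bullet> LX c j"
        using 1 2 by (simp add: algebra_simps del: th.simps)
      then show ?thesis
        using mult_left_mono[OF LX_le_ell[OF j, of c], of "b * 2 + b * (2 * M)"] b0 M(2) by simp
    qed
    have "(\<Sum>j<N. (a * (norm (LX c j))\<^sup>2 - (b * 2 + b * (2 * M)) * ell N c) +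
          (a * (norm (LP N c j))\<^sup>2 - b * (2 + M) * ell N c)) \<le> D c' (Uv c)"
      unfolding D_Uv using P X by (intro sum_mono add_mono) auto
    moreover have "(\<Sum>j<N. (a * (norm (LX c j))\<^sup>2 - (b * 2 + b * (2 * M)) * ell N c) +
          (a * (norm (LP N c j))\<^sup>2 - b * (2 + M) * ell N c)) = a * (ell N c)\<^sup>2 - C * ell N c"
      by (simp add: ell_sq C_def sum.distrib sum_subtractf sum_distrib_left algebra_simps)
    ultimately show ?thesis by simp
  qed
  moreover have "0 \<le> C" using b0 M(2) by (simp add: C_def)
  ultimately show ?thesis using that[of a C] ab(1) by blast
qed

definition inactive :: "'a cfg \<Rightarrow> bool" where
  "inactive c \<longleftrightarrow> (\<forall>j<N. R < norm (cx c j) \<or> R < norm (cp c j))"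

lemma inactive_act:
  assumes "inactive c"
  shows "A c = (\<Sum>j<N. cp c j \<bullet> LP N c j)"
proof -
  have "j \<le> N \<Longrightarrow> Z c j = cz c + (\<Sum>i<j. cp c i \<bullet> LP N c i)" for j
    using assms by (induction j) (auto simp: inactive_def LP_def genfun_outside[OF gen])
  then show ?thesis by (simp add: act_def)
qed

lemma inactive_grad:
  assumes "inactive c" "j < N"
  shows "GP c j = LP N c j" "j \<noteq> 0 \<Longrightarrow> GX c j = LX c j"
proof -
  have g0: "g j (Pt c j) = 0"
    using assms by (auto simp: inactive_def pnt_def intro: genfun_grad_outside[OF gen])
  have T1: "k \<le> N \<Longrightarrow> T c k = 1" for k
    using th_inactive assms by (auto simp: inactive_def)
  show "GP c j = LP N c j"
    using assms(2) g0 T1[of "Suc j"] by (simp add: gP_def LP_def del: th.simps)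
  show "j \<noteq> 0 \<Longrightarrow> GX c j = LX c j"
    using assms(2) g0 T1[of "Suc j"] T1[of j] by (simp add: gX_def LX_def prv_def del: th.simps)
qed

text \<open>Here the true gradient at \<open>c'\<close> is the model gradient, and a move by
  \<open>s\<close> changes each component by at most \<open>2 * s\<close>. In contrast to
  \<open>far_estimate\<close> the error vanishes with \<open>s\<close>.\<close>

lemma inactive_descent:
  assumes "inactive c'" "close N s c c'" "0 \<le> s"
  shows "(ell N c)\<^sup>2 - 4 * s * real N * ell N c \<le> D c' (Uv c)"
proof -
  have *: "(norm (LX c j))\<^sup>2 + (norm (LP N c j))\<^sup>2 - 4 * s * ell N c \<le> GX c' j \<bullet> LX c j + GP c' j \<bullet> LP N c j"
    if j: "j < N" for j
  proof -
    have 1: "(norm (LP N c j))\<^sup>2 - 2 * s * norm (LP N c j) \<le> GP c' j \<bullet> LP N c j"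
      using inner_lower[OF close_LP[OF assms(2) j], of 1 1 1 "LP N c j"]
      by (simp add: inactive_grad[OF assms(1) j])
    have 2: "(norm (LX c j))\<^sup>2 - 2 * s * norm (LX c j) \<le> GX c' j \<bullet> LX c j"
    proof (cases "j = 0")
      case True
      then show ?thesis by (simp add: LX_def)
    next
      case False
      then show ?thesis
        using inner_lower[OF close_LX[OF assms(2) j assms(3)], of 1 1 1 "LX c j"]
        by (simp add: inactive_grad[OF assms(1) j])
    qed
    have "2 * s * norm (LP N c j) \<le> 2 * s * ell N c" "2 * s * norm (LX c j) \<le> 2 * s * ell N c"
      using assms(3) by (auto intro!: mult_left_mono LP_le_ell LX_le_ell j)
    then show ?thesis using 1 2 by linarith
  qed
  have "(\<Sum>j<N. (norm (LX c j))\<^sup>2 + (norm (LP N c j))\<^sup>2 - 4 * s * ell N c) \<le> D c' (Uv c)"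
    unfolding D_Uv by (rule sum_mono) (use * in auto)
  then show ?thesis by (simp add: ell_sq sum_subtractf algebra_simps)
qed

text \<open>Cauchy-Schwarz in \<open>quad_form\<close>. Read backwards, a positive action keeps
  \<open>ell\<close> away from 0, which rules out escape of almost critical configurations along the
  null directions.\<close>

lemma inactive_act_le:
  assumes "inactive c"
  shows "A c \<le> (real N * ell N c)\<^sup>2"
proof -
  have "A c = (\<Sum>j<N-1. (cp c j - cp c (N - 1)) \<bullet> LP N c j)"
    using inactive_act[OF assms] quad_form[OF N2] by simp
  also have "\<dots> \<le> (\<Sum>j<N-1. real N * ell N c * ell N c)"
  proof (rule sum_mono)
    fix j assume "j \<in> {..<N-1}"
    then have j: "j < N" by auto
    have "(cp c j - cp c (N - 1)) \<bullet> LP N c j \<le> norm (cp c j - cp c (N - 1)) * norm (LP N c j)"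
      by (rule norm_cauchy_schwarz)
    also have "\<dots> \<le> real N * ell N c * ell N c"
      using ell_nonneg[of N c] by (intro mult_mono p_near_last[OF j] LP_le_ell[OF j]) auto
    finally show "(cp c j - cp c (N - 1)) \<bullet> LP N c j \<le> real N * ell N c * ell N c" .
  qed
  also have "\<dots> \<le> real N * (real N * ell N c * ell N c)"
    using ell_nonneg[of N c] by (auto intro!: mult_right_mono)
  finally show ?thesis by (simp add: power2_eq_square algebra_simps)
qed

text \<open>Proper up to translation of the height: \<open>ell\<close> bounds the spread of the
  chain, the other two terms its location.\<close>

definition rho :: "'a cfg \<Rightarrow> real" where
  "rho c = ell N c + norm (cx c 0) + norm (cp c (N - 1))"

text \<open>The spread of the chain is at most \<open>real N * r\<close>, so a large
  \<open>rho\<close> puts all positions or all momenta beyond \<open>R\<close>; the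
  \<open>+ 1\<close> absorbs the move from \<open>c\<close> to \<open>c'\<close>.\<close>

lemma inactive_far:
  assumes "ell N c \<le> r" "r + 2 * (\<bar>R\<bar> + real N * r + 1) < rho c" "close N 1 c c'"
  shows "inactive c'"
  unfolding inactive_def
proof (intro allI impI)
  fix j assume j: "j < N"
  have Nl: "real N * ell N c \<le> real N * r" using assms(1) by (intro mult_left_mono) auto
  have "\<bar>R\<bar> + real N * r + 1 < norm (cx c 0) \<or> \<bar>R\<bar> + real N * r + 1 < norm (cp c (N - 1))"
    using assms(1,2) unfolding rho_def by argo
  moreover have "norm (cx c 0) \<le> norm (cx c' j) + norm (cx c j - cx c 0) + norm (cx c' j - cx c j)"
    using norm_triangle_ineq4[of "cx c' j" "(cx c j - cx c 0) + (cx c' j - cx c j)"]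
      norm_triangle_ineq[of "cx c j - cx c 0" "cx c' j - cx c j"] by simp
  moreover have "norm (cp c (N - 1)) \<le> norm (cp c' j) + norm (cp c j - cp c (N - 1)) + norm (cp c' j - cp c j)"
    using norm_triangle_ineq4[of "cp c' j" "(cp c j - cp c (N - 1)) + (cp c' j - cp c j)"]
      norm_triangle_ineq[of "cp c j - cp c (N - 1)" "cp c' j - cp c j"] by simp
  ultimately show "R < norm (cx c' j) \<or> R < norm (cp c' j)"
    using x_near_first[OF j, of c] p_near_last[OF j, of c] Nl assms(3) j
    unfolding close_def by (smt (verit))
qed

definition lam :: "real \<Rightarrow> 'a cfg \<Rightarrow> real" where
  "lam r c = max 0 (min 1 (rho c - r))"

definition cmb :: "real \<Rightarrow> 'a cfg \<Rightarrow> real \<Rightarrow> 'a cfg \<Rightarrow> 'a cfg" where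
  "cmb a u b v = (\<lambda>j. a *\<^sub>R cx u j + b *\<^sub>R cx v j, \<lambda>j. a *\<^sub>R cp u j + b *\<^sub>R cp v j, a * cz u + b * cz v)"

text \<open>The denominators bound every component by 1, so a deformation along \<open>V\<close>
  stays at bounded distance from the identity and preserves the class \<open>Gam\<close>. The field
  passes from \<open>gv\<close> to \<open>Uv\<close> as \<open>rho\<close> runs from
  \<open>r\<close> to \<open>r + 1\<close>.\<close>

definition V :: "real \<Rightarrow> 'a cfg \<Rightarrow> 'a cfg" where
  "V r c = cmb (lam r c / (1 + ell N c)) (Uv c) ((1 - lam r c) / (1 + gsq c)) (gv c)"

lemma D_cmb: "D c (cmb a u b v) = a * D c u + b * D c v"
  by (simp add: dF_def cmb_def inner_add_right sum.distrib sum_distrib_left algebra_simps)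

lemma gsq_nonneg: "0 \<le> gsq c"
  by (simp add: gsq_def sum_nonneg)

lemma V_bound:
  "norm (cx (V r c) j) \<le> 1" "norm (cp (V r c) j) \<le> 1" "\<bar>cz (V r c)\<bar> \<le> 1"
proof -
  have l: "0 \<le> lam r c" "lam r c \<le> 1" by (auto simp: lam_def)
  have e: "0 \<le> ell N c" by (rule ell_nonneg)
  have q: "0 \<le> gsq c" by (rule gsq_nonneg)
  have le_sq: "t \<le> 1 + s" if "t\<^sup>2 \<le> s" for t s :: real
    using that zero_le_power2[of "t - 1"] by (simp add: power2_diff) (smt (verit) zero_le_power2)
  have cx: "norm (cx (Uv c) j) \<le> 1 + ell N c" "norm (cp (Uv c) j) \<le> 1 + ell N c"
    using LX_le_ell[of j N c] LP_le_ell[of j N c] e by (auto simp: Uv_def)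
  have gx: "(norm (GX c j))\<^sup>2 + (norm (GP c j))\<^sup>2 \<le> gsq c" if "j < N"
    using member_le_sum[of j "{..<N}" "\<lambda>j. (norm (GX c j))\<^sup>2 + (norm (GP c j))\<^sup>2"] that
    by (simp add: gsq_def) (smt (verit) zero_le_power2)
  have gxx: "norm (cx (gv c) j) \<le> 1 + gsq c" "norm (cp (gv c) j) \<le> 1 + gsq c"
    using gx q by (auto simp: gv_def intro!: le_sq) (smt (verit) zero_le_power2)+
  have gz: "\<bar>cz (gv c)\<bar> \<le> 1 + gsq c"
    by (auto simp: gv_def gsq_def sum_nonneg intro!: le_sq)
  have comb: "norm ((lam r c / (1 + ell N c)) *\<^sub>R x + ((1 - lam r c) / (1 + gsq c)) *\<^sub>R y) \<le> 1"
    if "norm x \<le> 1 + ell N c" "norm y \<le> 1 + gsq c" for x y :: "'c::real_normed_vector"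
  proof -
    have "norm ((lam r c / (1 + ell N c)) *\<^sub>R x) \<le> lam r c"
      using l e mult_left_mono[OF that(1) l(1)] by (simp add: field_simps)
    moreover have "norm (((1 - lam r c) / (1 + gsq c)) *\<^sub>R y) \<le> 1 - lam r c"
      using l q mult_left_mono[OF that(2), of "1 - lam r c"] by (simp add: field_simps)
    ultimately show ?thesis
      using norm_triangle_ineq[of "(lam r c / (1 + ell N c)) *\<^sub>R x" "((1 - lam r c) / (1 + gsq c)) *\<^sub>R y"]
      by linarith
  qed
  show "norm (cx (V r c) j) \<le> 1" "norm (cp (V r c) j) \<le> 1"
    unfolding V_def cmb_def using comb[OF cx(1) gxx(1)] comb[OF cx(2) gxx(2)] by auto
  have "\<bar>cz (Uv c)\<bar> \<le> 1 + ell N c" using e by (simp add: Uv_def)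
  then show "\<bar>cz (V r c)\<bar> \<le> 1"
    unfolding V_def cmb_def using comb[of "cz (Uv c)" "cz (gv c)"] gz by simp
qed

lemma close_mv_V: "0 \<le> s \<Longrightarrow> close N s c (mv s c (V r c))"
  using mult_left_mono[OF V_bound(1), of s r c] mult_left_mono[OF V_bound(2), of s r c]
  by (auto simp: close_def)

lemma cont_LP: "continuous_on UNIV (\<lambda>c::'a cfg. LP N c j)"
  and cont_LX: "continuous_on UNIV (\<lambda>c::'a cfg. LX c j)"
  unfolding LP_def LX_def by (cases "j = 0"; auto intro!: continuous_on_diff cont_cx cont_cp)+

lemma cont_ell: "continuous_on UNIV (ell N :: 'a cfg \<Rightarrow> real)"
  unfolding ell_def by (intro continuous_intros cont_LP cont_LX)

lemma cont_rho: "continuous_on UNIV rho"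
  unfolding rho_def by (intro continuous_intros cont_ell cont_cx cont_cp)

lemma cont_gsq: "continuous_on UNIV gsq"
  unfolding gsq_def by (intro continuous_intros cont_gX cont_gP cont_gZ)

lemma one_plus_nz: "1 + ell N c \<noteq> 0" "1 + gsq c \<noteq> 0"
  using ell_nonneg[of N c] gsq_nonneg[of c] by auto

lemma cont_V: "continuous_on UNIV (\<lambda>c. cx (V r c) j)" "continuous_on UNIV (\<lambda>c. cp (V r c) j)"
  "continuous_on UNIV (\<lambda>c. cz (V r c))"
proof -
  have a: "continuous_on UNIV (\<lambda>c. lam r c / (1 + ell N c))"
    and b: "continuous_on UNIV (\<lambda>c. (1 - lam r c) / (1 + gsq c))"
    unfolding lam_def using one_plus_nz
    by (auto intro!: continuous_intros cont_rho cont_ell cont_gsq)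
  have u: "continuous_on UNIV (\<lambda>c. cx (Uv c) j)" "continuous_on UNIV (\<lambda>c. cp (Uv c) j)"
    "continuous_on UNIV (\<lambda>c. cz (Uv c))"
    unfolding Uv_def by (cases "j < N"; simp add: cont_LX cont_LP)+
  have v: "continuous_on UNIV (\<lambda>c. cx (gv c) j)" "continuous_on UNIV (\<lambda>c. cp (gv c) j)"
    "continuous_on UNIV (\<lambda>c. cz (gv c))"
    unfolding gv_def by (cases "j < N"; simp add: cont_gX cont_gP cont_gZ)+
  show "continuous_on UNIV (\<lambda>c. cx (V r c) j)" "continuous_on UNIV (\<lambda>c. cp (V r c) j)"
    "continuous_on UNIV (\<lambda>c. cz (V r c))"
    unfolding V_def cmb_def fst_conv snd_conv
    by (intro continuous_on_add continuous_on_scaleR continuous_on_mult a b u v)+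
qed

text \<open>Either \<open>ell\<close> is large and the quadratic term of \<open>far_estimate\<close>
  dominates, or it is small; then the chain, being far out, is inactive, and its action bounds
  \<open>ell\<close> from below.\<close>

lemma far_descent:
  assumes c0: "0 < c0"
  obtains r s0 k where "0 < s0" "0 < k" "s0 \<le> 1"
    "\<And>c c' s. \<lbrakk>r < rho c; c0 / 2 \<le> A c; close N s c c'; 0 \<le> s; s \<le> s0\<rbrakk>
       \<Longrightarrow> k \<le> D c' (Uv c) / (1 + ell N c)"
proof -
  obtain m C where mC: "0 < m" "0 \<le> C"
    "\<And>c c'. close N 1 c c' \<Longrightarrow> m * (ell N c)\<^sup>2 - C * ell N c \<le> D c' (Uv c)"
    by (rule far_estimate, rule that)
  \<comment> \<open>From \<open>r0\<close> on, \<open>far_estimate\<close> yields at least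
    \<open>ell\<close>. \<open>e0\<close> is the lower bound for \<open>ell\<close> forced by action
    \<open>c0 / 2\<close>, and \<open>s0\<close> lets the error of \<open>inactive_descent\<close>
    consume at most half of the gain.\<close>
  define r0 where "r0 = (C + 1) / m + 1"
  define e0 where "e0 = sqrt (c0 / 2) / real N"
  have Npos: "0 < real N" using N2 by simp
  have e0: "0 < e0" using c0 Npos by (simp add: e0_def)
  define s0 where "s0 = min 1 (e0 / (8 * real N))"
  define k where "k = min (1 / 2) (e0 / 2 * (e0 / (1 + e0)))"
  have s0: "0 < s0" "s0 \<le> 1" "s0 \<le> e0 / (8 * real N)" using e0 Npos by (auto simp: s0_def)
  have "k \<le> D c' (Uv c) / (1 + ell N c)"
    if H: "r0 + 2 * (\<bar>R\<bar> + real N * r0 + 1) < rho c" "c0 / 2 \<le> A c" "close N s c c'" "0 \<le> s" "s \<le> s0"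
    for c c' s
  proof -
    have cl1: "close N 1 c c'" using H(3,5) s0(2) by (force simp: close_def)
    have l0: "0 \<le> ell N c" by (rule ell_nonneg)
    show ?thesis
    proof (cases "ell N c \<le> r0")
      case False
      then have "m * r0 \<le> m * ell N c" using mC(1) by simp
      moreover have "m * r0 = C + 1 + m" using mC(1) by (simp add: r0_def field_simps)
      ultimately have "1 \<le> m * ell N c - C" using mC(1) by linarith
      then have "ell N c * 1 \<le> ell N c * (m * ell N c - C)" by (intro mult_left_mono l0)
      then have "ell N c \<le> D c' (Uv c)"
        using mC(3)[OF cl1] by (simp add: power2_eq_square algebra_simps)
      moreover have "1 \<le> ell N c"
        using False divide_nonneg_pos[of "C + 1" m] mC(1,2) unfolding r0_def by linarith
      ultimately have "1 / 2 \<le> D c' (Uv c) / (1 + ell N c)" by (simp add: field_simps)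
      then show ?thesis unfolding k_def by linarith
    next
      case True
      have "close N 1 c c" by (simp add: close_def)
      then have ic: "inactive c" by (rule inactive_far[OF True H(1)])
      have ic': "inactive c'" by (rule inactive_far[OF True H(1) cl1])
      have "c0 / 2 \<le> (real N * ell N c)\<^sup>2" using inactive_act_le[OF ic] H(2) by simp
      then have "sqrt (c0 / 2) \<le> real N * ell N c"
        using l0 by (simp add: real_le_lsqrt)
      then have e0l: "e0 \<le> ell N c" using Npos by (simp add: e0_def field_simps)
      have "s * (8 * real N) \<le> s0 * (8 * real N)" using H(5) by (intro mult_right_mono) auto
      moreover have "s0 * (8 * real N) \<le> e0" using s0(3) Npos by (simp add: field_simps)
      ultimately have "4 * s * real N \<le> e0 / 2" by linarith
      then have "4 * s * real N * ell N c \<le> e0 / 2 * ell N c" by (intro mult_right_mono l0)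
      moreover have "e0 * ell N c \<le> ell N c * ell N c" by (intro mult_right_mono e0l l0)
      ultimately have 1: "e0 / 2 * ell N c \<le> D c' (Uv c)"
        using inactive_descent[OF ic' H(3,4)] by (simp add: power2_eq_square)
      have "e0 / 2 * (e0 / (1 + e0)) \<le> e0 / 2 * (ell N c / (1 + ell N c))"
        using e0 e0l l0 by (intro mult_left_mono) (auto simp: field_simps)
      also have "\<dots> = (e0 / 2 * ell N c) / (1 + ell N c)" by simp
      also have "\<dots> \<le> D c' (Uv c) / (1 + ell N c)"
        by (rule divide_right_mono[OF 1]) (use l0 in simp)
      finally show ?thesis by (simp add: k_def)
    qed
  qed
  moreover have "0 < k" using e0 by (simp add: k_def)
  ultimately show ?thesis using that s0 by blast
qed

section \<open>Uniform descent at a positive level without critical points\<close>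

definition nearq :: "real \<Rightarrow> real \<Rightarrow> 'a cfg \<Rightarrow> real" where
  "nearq r s c = D (mv s c (V r c)) (gv c) / (1 + gsq c)"

lemma cont_mv:
  assumes s: "continuous_on S s" and c: "continuous_on S c" and v: "continuous_on S c2"
  shows "continuous_on S (\<lambda>w. mv (s w) (c w) (V r (c2 w)) :: 'a cfg)"
proof -
  have 1: "continuous_on S (\<lambda>w. cx (c w) i)" "continuous_on S (\<lambda>w. cp (c w) i)" "continuous_on S (\<lambda>w. cz (c w))" for i
    by (rule continuous_on_compose2[OF cont_cx c], simp)
      (rule continuous_on_compose2[OF cont_cp c], simp, rule continuous_on_compose2[OF cont_cz c], simp)
  have 2: "continuous_on S (\<lambda>w. cx (V r (c2 w)) i)" "continuous_on S (\<lambda>w. cp (V r (c2 w)) i)"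
    "continuous_on S (\<lambda>w. cz (V r (c2 w)))" for i
    by (rule continuous_on_compose2[OF cont_V(1) v], simp)
      (rule continuous_on_compose2[OF cont_V(2) v], simp, rule continuous_on_compose2[OF cont_V(3) v], simp)
  show ?thesis
    unfolding mv_def
    by (intro continuous_on_cfg continuous_on_diff continuous_on_scaleR continuous_on_mult 1 2 s)
qed

lemma cont_nearq: "continuous_on UNIV (\<lambda>w. nearq r (fst w) (snd w))"
proof -
  have m: "continuous_on UNIV (\<lambda>w. mv (fst w) (snd w) (V r (snd w)))"
    by (intro cont_mv continuous_on_fst continuous_on_snd continuous_on_id)
  note c = continuous_on_compose2[OF _ m, simplified]
  note d = continuous_on_compose2[OF _ continuous_on_snd[OF continuous_on_id[of UNIV]], simplified]
  have D: "D c' (gv c) = (\<Sum>j<N. GX c' j \<bullet> GX c j + GP c' j \<bullet> GP c j) + GZ c' * GZ c" for c' c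
    by (simp add: dF_def gv_def)
  show ?thesis
    unfolding nearq_def D
    by (intro continuous_on_divide continuous_on_add continuous_on_sum continuous_on_inner
        continuous_on_mult continuous_on_const c[OF cont_gX] c[OF cont_gP] c[OF cont_gZ]
        d[OF cont_gX] d[OF cont_gP] d[OF cont_gZ] d[OF cont_gsq]) (use one_plus_nz in auto)
qed

lemma ell_shift: "ell N (shift c) = ell N c"
  by (simp add: ell_def LP_def LX_def cong: if_cong)

lemma rho_shift: "rho (shift c) = rho c"
  by (simp add: rho_def ell_shift)

lemma gsq_shift: "gsq (shift c) = gsq c"
  by (simp add: gsq_def grad_shift)

lemma gv_shift: "gv (shift c) = gv c"
  by (simp add: gv_def grad_shift cong: if_cong)

lemma V_shift: "V r (shift c) = V r c"
proof -
  have "Uv (shift c) = Uv c" by (simp add: Uv_def LP_def LX_def cong: if_cong)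
  then show ?thesis by (simp add: V_def lam_def rho_shift ell_shift gsq_shift gv_shift)
qed

lemma mv_shift: "mv s (shift c) v = shift (mv s c v)"
  by (simp add: mv_def shift_def)

lemma D_shift: "D (shift c) v = D c v"
  by (simp add: dF_def grad_shift)

lemma nearq_shift: "nearq r s (shift c) = nearq r s c"
  by (simp add: nearq_def V_shift mv_shift D_shift gsq_shift gv_shift)

lemma compact_near: "compact {c \<in> TT N. rho c \<le> r \<and> 0 \<le> cz c \<and> cz c \<le> 1}" (is "compact ?K")
proof -
  define B where "B = \<bar>r\<bar> + real N * \<bar>r\<bar>"
  define S where "S = (\<lambda>j. if j < N then cball (0::'a) B else {0})"
  have "compact ({u. \<forall>j. u j \<in> S j} \<times> {u. \<forall>j. u j \<in> S j} \<times> {0..1::real})"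
    by (intro compact_Times compact_coordinatewise) (auto simp: S_def)
  moreover have "?K \<subseteq> {u. \<forall>j. u j \<in> S j} \<times> {u. \<forall>j. u j \<in> S j} \<times> {0..1::real}"
  proof
    fix c assume c: "c \<in> ?K"
    have b: "ell N c \<le> \<bar>r\<bar>" "norm (cx c 0) \<le> \<bar>r\<bar>" "norm (cp c (N - 1)) \<le> \<bar>r\<bar>"
      using c ell_nonneg[of N c] norm_ge_zero[of "cx c 0"] norm_ge_zero[of "cp c (N - 1)"]
      by (auto simp: rho_def simp del: norm_ge_zero)
    have Nl: "real N * ell N c \<le> real N * \<bar>r\<bar>" using b by (intro mult_left_mono) auto
    have "cx c j \<in> S j" "cp c j \<in> S j" for j
    proof -
      have "norm (cx c j) \<le> B" "norm (cp c j) \<le> B" if "j < N"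
        using x_near_first[OF that, of c] p_near_last[OF that, of c] Nl b(2,3)
          norm_triangle_ineq[of "cx c j - cx c 0" "cx c 0"]
          norm_triangle_ineq[of "cp c j - cp c (N - 1)" "cp c (N - 1)"]
        by (simp_all add: B_def)
      then show "cx c j \<in> S j" "cp c j \<in> S j"
        using c by (auto simp: S_def TT_def)
    qed
    then show "c \<in> {u. \<forall>j. u j \<in> S j} \<times> {u. \<forall>j. u j \<in> S j} \<times> {0..1::real}"
      using c by (cases c) auto
  qed
  moreover have "closed ?K"
  proof -
    have "?K = (\<Inter>j\<in>{N..}. {c. cx c j = 0} \<inter> {c. cp c j = 0}) \<inter> {c. rho c \<le> r} \<inter> {c. 0 \<le> cz c} \<inter> {c. cz c \<le> 1}"
      by (auto simp: TT_def)
    then show ?thesis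
      by (auto intro!: closed_Int closed_INT closed_Collect_eq closed_Collect_le continuous_on_const
          cont_cx cont_cp cont_cz cont_rho)
  qed
  ultimately show ?thesis
    using compact_Int_closed[of "{u. \<forall>j. u j \<in> S j} \<times> {u. \<forall>j. u j \<in> S j} \<times> {0..1::real}" ?K]
    by (simp only: Int_absorb1)
qed

text \<open>\<open>Dl\<close> stands for the excess of a second functional over \<open>A\<close>.
  Critical points are excluded only where it vanishes, and descent is claimed only where it is
  small.\<close>

lemma descent:
  assumes c0: "0 < c0" and contD: "continuous_on UNIV Dl" and posD: "\<And>c. 0 \<le> Dl c"
    and perD: "\<And>c. Dl (shift c) = Dl c"
    and nocrit: "\<And>c. \<lbrakk>c \<in> TT N; A c = c0; Dl c = 0\<rbrakk> \<Longrightarrow> gsq c \<noteq> 0"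
  obtains r s0 e k where "0 < s0" "0 < e" "0 < k"
    "\<And>c s. \<lbrakk>c \<in> TT N; \<bar>A c - c0\<bar> \<le> e; Dl c \<le> e; 0 \<le> s; s \<le> s0\<rbrakk> \<Longrightarrow> k \<le> D (mv s c (V r c)) (V r c)"
proof -
  obtain r s1 k1 where far: "0 < s1" "0 < k1" "s1 \<le> 1"
    "\<And>c c' s. \<lbrakk>r < rho c; c0 / 2 \<le> A c; close N s c c'; 0 \<le> s; s \<le> s1\<rbrakk>
       \<Longrightarrow> k1 \<le> D c' (Uv c) / (1 + ell N c)"
    by (rule far_descent[OF c0], rule that)
  define K where "K = {c \<in> TT N. rho c \<le> r + 1 \<and> 0 \<le> cz c \<and> cz c \<le> 1}"
  have cK: "compact K" unfolding K_def by (rule compact_near)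
  \<comment> \<open>\<open>q\<close> vanishes only at critical points of level \<open>c0\<close>
    with \<open>Dl c = 0\<close>, so it has a lower bound \<open>3 * e1\<close> on the compact set.
    Where the first two summands are at most \<open>e1\<close>, the third is at least
    \<open>e1\<close>.\<close>
  define q where "q c = \<bar>A c - c0\<bar> + Dl c + gsq c" for c
  have cq: "continuous_on UNIV q"
    unfolding q_def by (intro continuous_intros cont_act contD cont_gsq)
  have qpos: "0 < q c" if "c \<in> K" for c
    using nocrit[of c] posD[of c] gsq_nonneg[of c] that by (auto simp: q_def K_def add_nonneg_eq_0_iff less_le)
  have "\<exists>e>0. \<forall>c\<in>K. 3 * e \<le> q c"
  proof (cases "K = {}")
    case False
    from continuous_attains_inf[OF cK False continuous_on_subset[OF cq subset_UNIV]]
    obtain c1 where "c1 \<in> K" "\<And>c. c \<in> K \<Longrightarrow> q c1 \<le> q c" by blast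
    then show ?thesis using qpos by (intro exI[of _ "q c1 / 3"]) auto
  qed (auto intro: exI[of _ 1])
  then obtain e1 where e1: "0 < e1" "\<And>c. c \<in> K \<Longrightarrow> 3 * e1 \<le> q c" by blast
  \<comment> \<open>Half of the lower bound for \<open>gsq / (1 + gsq)\<close>, the rate at
    \<open>s = 0\<close>; uniform continuity may cost the other half.\<close>
  define k3 where "k3 = e1 / (1 + e1) / 2"
  have k3: "0 < k3" using e1 by (simp add: k3_def)
  define Ke where "Ke = K \<inter> {c. \<bar>A c - c0\<bar> \<le> e1} \<inter> {c. Dl c \<le> e1}"
  have cKe: "compact Ke"
    unfolding Ke_def
    by (intro compact_Int_closed cK closed_Collect_le continuous_intros cont_act contD)
  have near0: "2 * k3 \<le> nearq r 0 c" if "c \<in> Ke" for c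
  proof -
    have "e1 \<le> gsq c" using e1(2)[of c] that by (auto simp: Ke_def q_def)
    then show ?thesis using e1(1) by (simp add: nearq_def D_gv k3_def field_simps)
  qed
  have "uniformly_continuous_on ({0..1} \<times> Ke) (\<lambda>w. nearq r (fst w) (snd w))"
    by (intro compact_uniformly_continuous compact_Times cKe continuous_on_subset[OF cont_nearq]) auto
  then obtain d where d: "0 < d" "\<And>w w'. \<lbrakk>w \<in> {0..1} \<times> Ke; w' \<in> {0..1} \<times> Ke; dist w' w < d\<rbrakk>
      \<Longrightarrow> dist (nearq r (fst w') (snd w')) (nearq r (fst w) (snd w)) < k3"
    using k3 unfolding uniformly_continuous_on_def by metis
  define s3 where "s3 = min 1 (d / 2)"
  have s3: "0 < s3" "s3 \<le> 1" "s3 < d" using d(1) by (auto simp: s3_def)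
  have nearKe: "k3 \<le> nearq r s c" if "c \<in> Ke" "0 \<le> s" "s \<le> s3" for c s
  proof -
    have "dist (s, c) (0, c) < d" using that s3 by (simp add: dist_Pair_Pair)
    then have "dist (nearq r s c) (nearq r 0 c) < k3"
      using d(2)[of "(0, c)" "(s, c)"] that s3 by simp
    then show ?thesis using near0[OF that(1)] by (simp add: dist_real_def)
  qed
  have near: "k3 \<le> nearq r s c"
    if H: "c \<in> TT N" "rho c \<le> r + 1" "\<bar>A c - c0\<bar> \<le> e1" "Dl c \<le> e1" "0 \<le> s" "s \<le> s3" for c s
  proof -
    \<comment> \<open>All quantities involved are invariant under \<open>shift\<close>, so the
      height may be taken in [0, 1) and the configuration in the compact set.\<close>
    define c1 where "c1 = (cx c, cp c, frac (cz c))"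
    have sh: "h c1 = h c" if "\<And>c. h (shift c) = h c" for h :: "'a cfg \<Rightarrow> real"
    proof -
      have "h (cx c, cp c, z + 1) = h (cx c, cp c, z)" for z
        using that[of "(cx c, cp c, z)"] by (simp add: shift_def)
      from periodic_frac[of "\<lambda>z. h (cx c, cp c, z)", OF this, of "cz c"] show ?thesis
        by (simp add: c1_def)
    qed
    have "c1 \<in> Ke"
      using H frac_lt_1[of "cz c"] sh[where h = rho, OF rho_shift] sh[where h = A, OF act_shift] sh[where h = Dl, OF perD]
      by (simp add: Ke_def K_def TT_def) (simp add: c1_def)
    from nearKe[OF this H(5,6)] show ?thesis using sh[of "nearq r s"] nearq_shift by simp
  qed
  show ?thesis
  proof (rule that[of "min s1 s3" "min e1 (c0 / 2)" "min k1 k3" r])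
    fix c s assume H: "c \<in> TT N" "\<bar>A c - c0\<bar> \<le> min e1 (c0 / 2)" "Dl c \<le> min e1 (c0 / 2)" "0 \<le> s" "s \<le> min s1 s3"
    define c' where "c' = mv s c (V r c)"
    define k where "k = min k1 k3"
    define l where "l = lam r c"
    have l: "0 \<le> l" "l \<le> 1" by (auto simp: l_def lam_def)
    have D: "D c' (V r c) = l * (D c' (Uv c) / (1 + ell N c)) + (1 - l) * nearq r s c"
      unfolding V_def[of r c] D_cmb by (simp add: nearq_def c'_def V_def l_def)
    have "l * k \<le> l * (D c' (Uv c) / (1 + ell N c))"
    proof (cases "l = 0")
      case False
      then have "r < rho c" by (auto simp: l_def lam_def)
      moreover have "c0 / 2 \<le> A c" using H(2) by (auto simp: abs_le_iff min_def split: if_splits)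
      ultimately have "k1 \<le> D c' (Uv c) / (1 + ell N c)"
        using H(4,5) close_mv_V[OF H(4)] unfolding c'_def by (intro far(4)[where s = s]) auto
      then show ?thesis using l by (intro mult_left_mono) (auto simp: k_def)
    qed simp
    moreover have "(1 - l) * k \<le> (1 - l) * nearq r s c"
    proof (cases "l = 1")
      case False
      then have "rho c \<le> r + 1" by (auto simp: l_def lam_def)
      then have "k3 \<le> nearq r s c" using H by (intro near) auto
      then show ?thesis using l by (intro mult_left_mono) (auto simp: k_def)
    qed simp
    ultimately have "k \<le> D c' (V r c)" using D by (simp add: algebra_simps)
    then show "min k1 k3 \<le> D (mv s c (V r c)) (V r c)" by (simp add: k_def c'_def)
  qed (use far e1 c0 k3 s3 in auto)
qed

text \<open>A single move of length at most \<open>s0\<close> along the direction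
  \<open>V r c\<close>, switched off by \<open>cut\<close> away from the level. Since no
  differential equation is solved, a continuous field is enough.\<close>

lemma deform:
  assumes c0: "0 < c0" and contD: "continuous_on UNIV Dl" and posD: "\<And>c. 0 \<le> Dl c"
    and perD: "\<And>c. Dl (shift c) = Dl c"
    and nocrit: "\<And>c. \<lbrakk>c \<in> TT N; A c = c0; Dl c = 0\<rbrakk> \<Longrightarrow> gsq c \<noteq> 0"
  obtains \<eta> \<delta> where "0 < \<delta>" "continuous_on UNIV \<eta>" "\<And>c. c \<in> TT N \<Longrightarrow> \<eta> c \<in> TT N"
    "\<And>c j. norm (cx (\<eta> c) j - cx c j) \<le> 1" "\<And>c j. norm (cp (\<eta> c) j - cp c j) \<le> 1"
    "\<And>c. \<bar>cz (\<eta> c) - cz c\<bar> \<le> 1"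
    "\<And>c. c \<in> TT N \<Longrightarrow> A c + Dl c \<le> c0 + \<delta> \<Longrightarrow> A (\<eta> c) \<le> c0 - \<delta>"
proof -
  obtain r s1 e k where de: "0 < s1" "0 < e" "0 < k"
    "\<And>c s. \<lbrakk>c \<in> TT N; \<bar>A c - c0\<bar> \<le> e; Dl c \<le> e; 0 \<le> s; s \<le> s1\<rbrakk> \<Longrightarrow> k \<le> D (mv s c (V r c)) (V r c)"
    by (rule descent[OF c0 contD posD perD nocrit], assumption+, rule that)
  obtain a b where ab: "0 < a" "\<And>c j. j \<le> N \<Longrightarrow> a \<le> T c j" "\<And>c j. j \<le> N \<Longrightarrow> T c j \<le> b"
    by (rule th_bounds, rule that)
  have b: "0 < b" using ab(1) ab(2,3)[of 0] by force
  define s0 where "s0 = min 1 s1"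
  \<comment> \<open>Equal to 1 while both the distance to the level and the excess are at most
    \<open>e / 2\<close>, and to 0 once one of them reaches \<open>e\<close>.\<close>
  define cut where "cut c = max 0 (min 1 (2 - 2 * max \<bar>A c - c0\<bar> (Dl c) / e))" for c
  define \<eta> where "\<eta> c = mv (s0 * cut c) c (V r c)" for c
  \<comment> \<open>A full move gains at least \<open>2 * \<delta>\<close>, enough to pass from
    \<open>c0 + \<delta>\<close> to \<open>c0 - \<delta>\<close>; the bound \<open>e / 4\<close>
    serves the cases in which the move is not full.\<close>
  define \<delta> where "\<delta> = min (e / 4) (s0 * k / b / 2)"
  have s0: "0 < s0" "s0 \<le> 1" "s0 \<le> s1" using de by (auto simp: s0_def)
  have cut: "0 \<le> cut c" "cut c \<le> 1" for c by (auto simp: cut_def)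
  have sc: "0 \<le> s0 * cut c" "s0 * cut c \<le> s0" for c
    using s0 cut[of c] by (auto intro: mult_left_le)
  have step: "A (mv s c (V r c)) \<le> A c - s * (k / b)"
    if H: "c \<in> TT N" "\<bar>A c - c0\<bar> \<le> e" "Dl c \<le> e" "0 \<le> s" "s \<le> s1" for c s
  proof -
    define h where "h t = A (mv t c (V r c)) + t * (k / b)" for t
    have "h s \<le> h 0"
    proof (rule DERIV_nonpos_imp_nonincreasing[OF H(4)])
      fix t assume t: "0 \<le> t" "t \<le> s"
      have dh: "(h has_real_derivative - D (mv t c (V r c)) (V r c) / T (mv t c (V r c)) N + k / b) (at t)"
        unfolding h_def using b by (auto intro!: derivative_eq_intros act_deriv)
      have "k / b \<le> D (mv t c (V r c)) (V r c) / T (mv t c (V r c)) N"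
        using de(3) de(4)[of c t] H t ab(3)[of N] th_pos by (intro frac_le) (auto intro: order_trans[of 0 k])
      then show "\<exists>y. (h has_real_derivative y) (at t) \<and> y \<le> 0" using dh by force
    qed
    then show ?thesis by (simp add: h_def)
  qed
  have noninc: "A (\<eta> c) \<le> A c" if "c \<in> TT N" for c
  proof (cases "\<bar>A c - c0\<bar> \<le> e \<and> Dl c \<le> e")
    case True
    have "0 \<le> s0 * cut c * (k / b)" using de b by (intro mult_nonneg_nonneg[OF sc(1)]) auto
    then show ?thesis
      using step[OF that, of "s0 * cut c"] True sc[of c] s0(3) unfolding \<eta>_def by linarith
  next
    case False
    then have "cut c = 0" using de(2) by (auto simp: cut_def field_simps max_def)
    then show ?thesis by (simp add: \<eta>_def)
  qed
  have dec: "A (\<eta> c) \<le> A c - s0 * (k / b)" if "c \<in> TT N" "\<bar>A c - c0\<bar> \<le> e / 2" "Dl c \<le> e / 2" for c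
  proof -
    have "cut c = 1" using that de(2) by (auto simp: cut_def field_simps max_def)
    then show ?thesis using step[of c s0] that s0 de(2) by (simp add: \<eta>_def)
  qed
  have vb: "norm ((s0 * cut c) *\<^sub>R w) \<le> 1" if "norm w \<le> 1" for c and w :: "'c::real_normed_vector"
  proof -
    have "norm ((s0 * cut c) *\<^sub>R w) = (s0 * cut c) * norm w" using sc(1)[of c] by (simp add: abs_of_nonneg)
    also have "\<dots> \<le> 1 * 1" using sc[of c] s0(2) that by (intro mult_mono) (linarith | simp)+
    finally show ?thesis by simp
  qed
  show ?thesis
  proof (rule that[of \<delta> \<eta>])
    show "0 < \<delta>" using de b s0 by (simp add: \<delta>_def)
    have "continuous_on UNIV cut"
      unfolding cut_def using de(2) by (intro continuous_intros cont_act contD) auto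
    then show "continuous_on UNIV \<eta>"
      unfolding \<eta>_def by (intro cont_mv continuous_on_mult continuous_on_const continuous_on_id)
    show "norm (cx (\<eta> c) j - cx c j) \<le> 1" "norm (cp (\<eta> c) j - cp c j) \<le> 1" for c j
      using vb[OF V_bound(1), of c r c j] vb[OF V_bound(2), of c r c j] by (simp_all add: \<eta>_def)
    show "\<bar>cz (\<eta> c) - cz c\<bar> \<le> 1" for c
      using vb[of "cz (V r c)" c] V_bound(3) by (simp add: \<eta>_def)
    show "\<eta> c \<in> TT N" if "c \<in> TT N" for c
      using that by (simp add: TT_def \<eta>_def V_def cmb_def Uv_def gv_def)
    show "A (\<eta> c) \<le> c0 - \<delta>" if H: "c \<in> TT N" "A c + Dl c \<le> c0 + \<delta>" for c
    proof -
      have d: "\<delta> \<le> e / 4" "\<delta> \<le> s0 * (k / b) / 2" by (auto simp: \<delta>_def)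
      \<comment> \<open>In the first case the action is already low, and in the third the large
        excess forces it down, because the hypothesis bounds the sum of both. Only the second case
        needs the gain of a full move.\<close>
      consider "A c \<le> c0 - e / 2" | "A c > c0 - e / 2" "Dl c \<le> e / 2" | "Dl c > e / 2" by linarith
      then show ?thesis
      proof cases
        case 1
        then show ?thesis using noninc[OF H(1)] d de(2) by linarith
      next
        case 2
        then have "\<bar>A c - c0\<bar> \<le> e / 2" using H posD[of c] d de(2) by linarith
        then show ?thesis using dec[OF H(1)] 2 H(2) posD[of c] d by fastforce
      next
        case 3
        then show ?thesis using noninc[OF H(1)] H(2) d de(2) by linarith
      qed
    qed
  qed
qed

end

section \<open>The minimax value\<close>

text \<open>The index \<open>None\<close> stands for the height \<open>z\<close>; \<open>Some (j, b)\<close> for the \<open>b\<close>-component of the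
  negative direction \<open>(e\<^sub>j - d\<^sub>j) / 2\<close> of the quadratic form \<open>\<Sum> e\<^sub>j \<bullet> d\<^sub>j\<close>,
  \<open>e\<^sub>j = p\<^sub>j - p\<^sub>N\<^sub>-\<^sub>1\<close>, \<open>d\<^sub>j = x\<^sub>j\<^sub>+\<^sub>1 - x\<^sub>j\<close>, if \<open>j < N - 1\<close>; the null directions are
  \<open>p\<^sub>N\<^sub>-\<^sub>1\<close> and \<open>x\<^sub>0\<close>.\<close>

definition negp :: "nat \<Rightarrow> 'a::euclidean_space cfg \<Rightarrow> nat \<Rightarrow> 'a" where
  "negp N c j = (if j < N - 1 then (1/2) *\<^sub>R (cp c j - cp c (N - 1) - (cx c (Suc j) - cx c j))
     else if j = N - 1 then cp c (N - 1) else cx c 0)"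

fun prj :: "nat \<Rightarrow> 'a::euclidean_space cfg \<Rightarrow> (nat \<times> 'a) option \<Rightarrow> real" where
  "prj N c None = cz c"
| "prj N c (Some (j, b)) = negp N c j \<bullet> b"

definition idx :: "nat \<Rightarrow> (nat \<times> 'a::euclidean_space) option set" where
  "idx N = insert None (Some ` ({..N} \<times> Basis))"

text \<open>Sheets parametrised by the negative, null and height directions. The uniform bound plays
  the part of the boundary condition in a linking argument; only coordinates in \<open>idx\<close>
  are constrained, so the positive directions are free.\<close>

definition Gam :: "nat \<Rightarrow> (((nat \<times> 'a::euclidean_space) option \<Rightarrow> real) \<Rightarrow> 'a cfg) set" where
  "Gam N = {h. continuous_on UNIV h \<and> range h \<subseteq> TT N \<and>
     (\<exists>M. \<forall>u. \<forall>i\<in>idx N. \<bar>prj N (h u) i - u i\<bar> \<le> M)}"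

text \<open>Upper bounds on sheets instead of suprema: a sheet on which \<open>F\<close> is
  unbounded above contributes nothing, and the infimum is the usual inf-sup.\<close>

definition levels :: "nat \<Rightarrow> ('a::euclidean_space cfg \<Rightarrow> real) \<Rightarrow> real set" where
  "levels N F = {a. \<exists>h\<in>Gam N. \<forall>u. F (h u) \<le> a}"

definition minmax :: "nat \<Rightarrow> ('a::euclidean_space cfg \<Rightarrow> real) \<Rightarrow> real" where
  "minmax N F = Inf (levels N F)"

lemma finite_idx: "finite (idx N)"
  by (simp add: idx_def)

lemma cont_negp: "continuous_on UNIV (\<lambda>c. negp N c j)"
  unfolding negp_def
  by (cases "j < N - 1"; cases "j = N - 1"; simp; intro continuous_intros cont_cx cont_cp)

lemma cont_prj: "continuous_on UNIV (\<lambda>c. prj N c i)"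
proof (cases i)
  case (Some w)
  then show ?thesis by (cases w) (auto intro!: continuous_intros cont_negp)
qed (simp add: cont_cz)

text \<open>By surjectivity of bounded perturbations of the identity, a sheet meets the space of
  positive directions over every prescribed height and null coordinates. The freedom in
  \<open>x\<close>, \<open>p\<close>, \<open>z\<close> is exploited in
  \<open>minmax_pos\<close>.\<close>

lemma linking:
  assumes h: "h \<in> Gam N" and N: "0 < N"
  obtains u where "cz (h u) = z" "cx (h u) 0 = x" "cp (h u) (N - 1) = p"
    "\<And>j. j < N - 1 \<Longrightarrow> cp (h u) j - cp (h u) (N - 1) = cx (h u) (Suc j) - cx (h u) j"
proof -
  obtain M where M: "\<And>u i. i \<in> idx N \<Longrightarrow> \<bar>prj N (h u) i - u i\<bar> \<le> M"
    using h by (auto simp: Gam_def)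
  define t where "t i = (case i of None \<Rightarrow> z | Some (j, b) \<Rightarrow>
      (if j < N - 1 then 0 else if j = N - 1 then p else x) \<bullet> b)" for i :: "(nat \<times> 'a) option"
  have "continuous_on UNIV h" using h by (simp add: Gam_def)
  then have c: "continuous_on UNIV (\<lambda>u. prj N (h u) i)" for i
    by (intro continuous_on_compose2[OF cont_prj]) auto
  obtain u where u: "\<And>i. i \<in> idx N \<Longrightarrow> prj N (h u) i = t i"
    by (rule bounded_perturbation_surj[OF finite_idx c M, of _ t], assumption, rule that)
  have neg: "negp N (h u) j = (if j < N - 1 then 0 else if j = N - 1 then p else x)" if "j \<le> N" for j
  proof (rule euclidean_eqI)
    fix b :: 'a assume "b \<in> Basis"
    then have "Some (j, b) \<in> idx N" using that by (auto simp: idx_def)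
    from u[OF this] show "negp N (h u) j \<bullet> b = (if j < N - 1 then 0 else if j = N - 1 then p else x) \<bullet> b"
      by (simp add: t_def)
  qed
  show ?thesis
  proof (rule that[of u])
    show "cz (h u) = z" using u[of None] by (simp add: idx_def t_def)
    show "cp (h u) (N - 1) = p" using neg[of "N - 1"] by (simp add: negp_def)
    show "cp (h u) j - cp (h u) (N - 1) = cx (h u) (Suc j) - cx (h u) j" if "j < N - 1" for j
      using neg[of j] that by (simp add: negp_def)
    show "cx (h u) 0 = x" using neg[of N] N by (auto simp: negp_def split: if_splits)
  qed
qed


lemma minmax_mono:
  assumes "\<And>c. F c \<le> F' c" "levels N F' \<noteq> {}" "\<And>a. a \<in> levels N F \<Longrightarrow> 0 \<le> a"
  shows "minmax N F \<le> minmax N F'"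
  unfolding minmax_def
proof (rule cInf_superset_mono[OF assms(2)])
  show "bdd_below (levels N F)" using assms(3) by (auto simp: bdd_below_def)
  show "levels N F' \<subseteq> levels N F"
    unfolding levels_def using assms(1) by (blast intro: order_trans)
qed

lemma Gam_comp:
  assumes h: "h \<in> Gam N" and c: "continuous_on UNIV \<eta>" and T: "\<And>c. c \<in> TT N \<Longrightarrow> \<eta> c \<in> TT N"
    and dx: "\<And>c j. norm (cx (\<eta> c) j - cx c j) \<le> 1" and dp: "\<And>c j. norm (cp (\<eta> c) j - cp c j) \<le> 1"
    and dz: "\<And>c. \<bar>cz (\<eta> c) - cz c\<bar> \<le> 1"
  shows "\<eta> \<circ> h \<in> Gam N"
proof -
  have n: "norm (negp N (\<eta> c) j - negp N c j) \<le> 2" for c j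
  proof -
    have "norm (\<beta> - \<gamma> - (\<delta> - \<epsilon>)) \<le> 4" if "norm \<beta> \<le> 1" "norm \<gamma> \<le> 1" "norm \<delta> \<le> 1" "norm \<epsilon> \<le> 1"
      for \<beta> \<gamma> \<delta> \<epsilon> :: 'a
      using norm_triangle_ineq4[of "\<beta> - \<gamma>" "\<delta> - \<epsilon>"] norm_triangle_ineq4[of \<beta> \<gamma>] norm_triangle_ineq4[of \<delta> \<epsilon>] that
      by linarith
    from this[OF dp[of c j] dp[of c "N - 1"] dx[of c "Suc j"] dx[of c j]]
    have "norm ((1/2::real) *\<^sub>R (cp (\<eta> c) j - cp c j - (cp (\<eta> c) (N-1) - cp c (N-1)) -
        ((cx (\<eta> c) (Suc j) - cx c (Suc j)) - (cx (\<eta> c) j - cx c j)))) \<le> 2"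
      by simp
    then have "norm ((1/2::real) *\<^sub>R (cp (\<eta> c) j - cp (\<eta> c) (N - 1) - (cx (\<eta> c) (Suc j) - cx (\<eta> c) j)) -
        (1/2::real) *\<^sub>R (cp c j - cp c (N - 1) - (cx c (Suc j) - cx c j))) \<le> 2"
      unfolding scaleR_diff_right[symmetric] by (simp add: algebra_simps)
    then show ?thesis
      using order_trans[OF dx, of 2 c 0] order_trans[OF dp, of 2 c "N - 1"] by (simp add: negp_def)
  qed
  have p: "\<bar>prj N (\<eta> c) i - prj N c i\<bar> \<le> 2" if "i \<in> idx N" for c i
  proof (cases i)
    case None
    then show ?thesis using order_trans[OF dz, of 2 c] by simp
  next
    case (Some w)
    then obtain j b where w: "i = Some (j, b)" by (cases w) auto
    then have b: "b \<in> Basis" using that by (auto simp: idx_def)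
    have "\<bar>(negp N (\<eta> c) j - negp N c j) \<bullet> b\<bar> \<le> 2"
      using Basis_le_norm[OF b] n[of c j] order_trans by blast
    then show ?thesis by (simp add: w inner_diff_left)
  qed
  obtain M where M: "\<And>u i. i \<in> idx N \<Longrightarrow> \<bar>prj N (h u) i - u i\<bar> \<le> M"
    using h by (auto simp: Gam_def)
  have "\<bar>prj N (\<eta> (h u)) i - u i\<bar> \<le> 2 + M" if "i \<in> idx N" for u i
    using p[OF that, of "h u"] M[OF that, of u] by linarith
  moreover have "continuous_on UNIV (\<eta> \<circ> h)"
    using h by (intro continuous_on_compose continuous_on_subset[OF c]) (auto simp: Gam_def)
  moreover have "range (\<eta> \<circ> h) \<subseteq> TT N"
  proof
    fix c assume "c \<in> range (\<eta> \<circ> h)"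
    then obtain u where "c = \<eta> (h u)" by auto
    moreover have "h u \<in> TT N" using h by (auto simp: Gam_def)
    ultimately show "c \<in> TT N" using T by simp
  qed
  ultimately show ?thesis unfolding Gam_def o_def by blast
qed

text \<open>The standard sheet: if \<open>b j\<close> has coordinates
  \<open>u (Some (j, _))\<close>, then for \<open>j < N - 1\<close> the difference of momenta is
  \<open>b j\<close> and that of positions \<open>- b j\<close>. The positive components vanish and
  \<open>negp\<close> returns \<open>b j\<close>.\<close>

definition incl :: "nat \<Rightarrow> ((nat \<times> 'a::euclidean_space) option \<Rightarrow> real) \<Rightarrow> 'a cfg" where
  "incl N u = (let b = (\<lambda>j. \<Sum>b\<in>Basis. u (Some (j, b)) *\<^sub>R b) in
     (\<lambda>j. if j < N then b N - (\<Sum>i<j. b i) else 0,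
      \<lambda>j. if j < N - 1 then b (N - 1) + b j else if j = N - 1 then b (N - 1) else 0, u None))"

lemma incl_negp:
  assumes "2 \<le> N" "j \<le> N"
  shows "negp N (incl N u) j = (\<Sum>b\<in>Basis. u (Some (j, b)) *\<^sub>R b)"
proof -
  consider "j < N - 1" | "j = N - 1" | "j = N" using assms by linarith
  then show ?thesis
  proof cases
    case 1
    then have "Suc j < N" by simp
    with 1 show ?thesis by (simp add: negp_def incl_def Let_def scaleR_2[symmetric] del: scaleR_2)
  qed (use assms in \<open>auto simp: negp_def incl_def Let_def\<close>)
qed

lemma incl_Gam:
  assumes N: "2 \<le> N"
  shows "incl N \<in> Gam N"
proof -
  have "prj N (incl N u) i = u i" if "i \<in> idx N" for u :: "(nat \<times> 'a) option \<Rightarrow> real" and i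
  proof (cases i)
    case (Some w)
    then obtain j b where w: "i = Some (j, b)" by (cases w) auto
    then show ?thesis
      using that incl_negp[OF N, of j u]
      by (auto simp: idx_def inner_sum_left inner_Basis if_distrib cong: if_cong)
  qed (simp add: incl_def Let_def)
  moreover have "continuous_on UNIV (incl N :: ((nat \<times> 'a) option \<Rightarrow> real) \<Rightarrow> 'a cfg)"
  proof -
    have b: "continuous_on UNIV (\<lambda>u::(nat \<times> 'a) option \<Rightarrow> real. \<Sum>b\<in>Basis. u (Some (j, b)) *\<^sub>R b)" for j
      by (intro continuous_on_sum continuous_on_scaleR continuous_on_const continuous_on_product_coordinates)
    show ?thesis
      unfolding incl_def Let_def
    proof (rule continuous_on_cfg)
      show "continuous_on UNIV (\<lambda>u::(nat \<times> 'a) option \<Rightarrow> real. if i < N then (\<Sum>b\<in>Basis. u (Some (N, b)) *\<^sub>R b) -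
          (\<Sum>i<i. \<Sum>b\<in>Basis. u (Some (i, b)) *\<^sub>R b) else 0)" for i
        by (cases "i < N") (simp_all, intro continuous_on_diff continuous_on_sum[of "{..<i}"] b)
      show "continuous_on UNIV (\<lambda>u::(nat \<times> 'a) option \<Rightarrow> real. if j < N - 1 then (\<Sum>b\<in>Basis. u (Some (N - 1, b)) *\<^sub>R b) +
          (\<Sum>b\<in>Basis. u (Some (j, b)) *\<^sub>R b) else if j = N - 1 then \<Sum>b\<in>Basis. u (Some (N - 1, b)) *\<^sub>R b else 0)" for j
        using b[of "N - 1"] continuous_on_add[OF b[of "N - 1"] b[of j]]
        by (cases "j < N - 1"; cases "j = N - 1") auto
    qed (rule continuous_on_product_coordinates)
  qed
  moreover have "incl N u \<in> TT N" for u :: "(nat \<times> 'a) option \<Rightarrow> real"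
    using N by (auto simp: TT_def incl_def Let_def)
  ultimately show ?thesis by (auto simp: Gam_def intro!: exI[of _ 0])
qed

section \<open>Positivity and criticality of the minimax value\<close>

context chain
begin

lemma act_eq: "A c = (\<Sum>j<N. cp c j \<bullet> LP N c j) + (\<Sum>j<N. f j (Pt c j))"
proof -
  have "Z c j = cz c + (\<Sum>i<j. cp c i \<bullet> LP N c i) + (\<Sum>i<j. f i (Pt c i))" for j
    by (induction j) (auto simp: LP_def pnt_def)
  then show ?thesis by (simp add: act_def)
qed

lemma act_eq': "A c = (\<Sum>j<N-1. (cp c j - cp c (N - 1)) \<bullet> LP N c j) + (\<Sum>j<N. f j (Pt c j))"
  using act_eq quad_form[OF N2] by simp

text \<open>On the standard sheet the quadratic form is nonpositive and the generating functions are
  bounded.\<close>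

lemma levels_nonempty: "levels N A \<noteq> {}"
proof -
  obtain M m where M: "0 < m" "0 \<le> M" "\<And>j q. j < N \<Longrightarrow> f j q \<le> M" "\<And>j q. j < N \<Longrightarrow> norm (g j q) \<le> M"
    "\<And>j q. j < N \<Longrightarrow> m \<le> 1 + snd (snd (g j q))"
    "\<And>j x p z. j < N \<Longrightarrow> \<bar>snd (snd (g j (x, p, z)))\<bar> * norm p \<le> M"
    by (rule unif_bounds, rule that)
  have "A (incl N u) \<le> (\<Sum>j<N. M)" for u
  proof -
    have "(\<Sum>j<N-1. (cp (incl N u) j - cp (incl N u) (N - 1)) \<bullet> LP N (incl N u) j) \<le> 0"
    proof (rule sum_nonpos)
      fix j assume "j \<in> {..<N-1}"
      then have "Suc j < N" by auto
      then show "(cp (incl N u) j - cp (incl N u) (N - 1)) \<bullet> LP N (incl N u) j \<le> 0"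
        by (simp add: incl_def Let_def LP_def nxt_def)
    qed
    moreover have "(\<Sum>j<N. f j (Pt (incl N u) j)) \<le> (\<Sum>j<N. M)"
      by (rule sum_mono) (use M in auto)
    ultimately show ?thesis by (simp add: act_eq')
  qed
  then show ?thesis using incl_Gam[OF N2] by (auto simp: levels_def)
qed

text \<open>The quadratic form becomes a sum of squares here, and the nonnegative generating
  functions only add to it.\<close>

lemma act_positive_directions:
  assumes "\<And>j. j < N - 1 \<Longrightarrow> cp c j - cp c (N - 1) = cx c (Suc j) - cx c j"
  shows "(\<Sum>j<N-1. (norm (cx c (Suc j) - cx c j))\<^sup>2) \<le> A c"
proof -
  have "(\<Sum>j<N-1. (cp c j - cp c (N - 1)) \<bullet> LP N c j) = (\<Sum>j<N-1. (norm (cx c (Suc j) - cx c j))\<^sup>2)"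
  proof (rule sum.cong)
    fix j assume "j \<in> {..<N-1}"
    then have j: "j < N - 1" by simp
    then show "(cp c j - cp c (N - 1)) \<bullet> LP N c j = (norm (cx c (Suc j) - cx c j))\<^sup>2"
      unfolding assms[OF j] by (simp add: LP_def nxt_def power2_norm_eq_inner)
  qed simp
  moreover have "0 \<le> (\<Sum>j<N. f j (Pt c j))"
    by (intro sum_nonneg genfun_nonneg[OF gen])
  ultimately show ?thesis by (simp add: act_eq')
qed

lemma levels_nonneg: "a \<in> levels N A \<Longrightarrow> 0 \<le> a"
proof -
  assume "a \<in> levels N A"
  then obtain h where h: "h \<in> Gam N" "\<And>u. A (h u) \<le> a" by (auto simp: levels_def)
  obtain u where u: "\<And>j. j < N - 1 \<Longrightarrow> cp (h u) j - cp (h u) (N - 1) = cx (h u) (Suc j) - cx (h u) j"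
    by (rule linking[OF h(1), of 0 0 0]) (use N2 in simp, rule that)
  have "0 \<le> (\<Sum>j<N-1. (norm (cx (h u) (Suc j) - cx (h u) j))\<^sup>2)" by (simp add: sum_nonneg)
  then show ?thesis using act_positive_directions[OF u] h(2)[of u] by linarith
qed

text \<open>If the value were at most 0, sheets of arbitrarily small level would meet the positive
  directions over \<open>(x, p, z)\<close>, where the action bounds the squared differences. The
  intersection points would converge to the constant configuration, whose action is
  positive.\<close>

lemma minmax_pos:
  assumes A0: "0 < A (\<lambda>j. if j < N then x else 0, \<lambda>j. if j < N then p else 0, z)" (is "0 < A ?c")
  shows "0 < minmax N A"
proof (rule ccontr)
  assume "\<not> 0 < minmax N A"
  have "\<exists>c. c \<in> TT N \<and> cz c = z \<and> cx c 0 = x \<and> cp c (N - 1) = p \<and>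
      (\<forall>j<N-1. cp c j - cp c (N - 1) = cx c (Suc j) - cx c j) \<and> A c \<le> 1 / real (Suc n)" for n
  proof -
    have "minmax N A < 1 / real (Suc n)"
      using \<open>\<not> 0 < minmax N A\<close> by (smt (verit) divide_pos_pos of_nat_0_less_iff zero_less_Suc)
    then obtain a where a: "a \<in> levels N A" "a < 1 / real (Suc n)"
      unfolding minmax_def using cInf_lessD[OF levels_nonempty] by blast
    then obtain h where h: "h \<in> Gam N" "\<And>u. A (h u) \<le> a" by (auto simp: levels_def)
    obtain u where u: "cz (h u) = z" "cx (h u) 0 = x" "cp (h u) (N - 1) = p"
      "\<And>j. j < N - 1 \<Longrightarrow> cp (h u) j - cp (h u) (N - 1) = cx (h u) (Suc j) - cx (h u) j"
      by (rule linking[OF h(1)]) (use N2 in simp, rule that)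
    have "h u \<in> TT N" using h by (auto simp: Gam_def)
    then show ?thesis using u h(2)[of u] a(2) by (intro exI[of _ "h u"]) auto
  qed
  then obtain c where c: "\<And>n. c n \<in> TT N" "\<And>n. cz (c n) = z" "\<And>n. cx (c n) 0 = x" "\<And>n. cp (c n) (N - 1) = p"
    "\<And>n j. j < N - 1 \<Longrightarrow> cp (c n) j - cp (c n) (N - 1) = cx (c n) (Suc j) - cx (c n) j"
    "\<And>n. A (c n) \<le> 1 / real (Suc n)"
    by metis
  have lim0: "(\<lambda>n. 1 / real (Suc n)) \<longlonglongrightarrow> 0"
    using LIMSEQ_inverse_real_of_nat by (simp add: inverse_eq_divide)
  have d: "(\<lambda>n. cx (c n) (Suc j) - cx (c n) j) \<longlonglongrightarrow> 0" if j: "j < N - 1" for j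
  proof -
    have "norm ((norm (cx (c n) (Suc j) - cx (c n) j))\<^sup>2) \<le> 1 / real (Suc n)" for n
    proof -
      have "(norm (cx (c n) (Suc j) - cx (c n) j))\<^sup>2 \<le> (\<Sum>j<N-1. (norm (cx (c n) (Suc j) - cx (c n) j))\<^sup>2)"
        using j by (intro member_le_sum) auto
      also have "\<dots> \<le> A (c n)" by (intro act_positive_directions c(5))
      finally show ?thesis using c(6)[of n] by simp
    qed
    then have "(\<lambda>n. (norm (cx (c n) (Suc j) - cx (c n) j))\<^sup>2) \<longlonglongrightarrow> 0"
      by (intro Lim_null_comparison[OF always_eventually lim0]) auto
    then have "(\<lambda>n. sqrt ((norm (cx (c n) (Suc j) - cx (c n) j))\<^sup>2)) \<longlonglongrightarrow> sqrt 0"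
      by (rule tendsto_real_sqrt)
    then show ?thesis by (simp add: tendsto_norm_zero_iff)
  qed
  have x: "j < N \<Longrightarrow> (\<lambda>n. cx (c n) j) \<longlonglongrightarrow> x" for j
  proof (induction j)
    case (Suc j)
    then have "(\<lambda>n. (cx (c n) (Suc j) - cx (c n) j) + cx (c n) j) \<longlonglongrightarrow> 0 + x"
      by (intro tendsto_add d) auto
    then show ?case by simp
  qed (simp add: c)
  have p: "(\<lambda>n. cp (c n) j) \<longlonglongrightarrow> p" if "j < N" for j
  proof (cases "j = N - 1")
    case False
    then have j: "j < N - 1" using that by simp
    have "(\<lambda>n. (cx (c n) (Suc j) - cx (c n) j) + cp (c n) (N - 1)) \<longlonglongrightarrow> 0 + p"
      using c(4) by (intro tendsto_add d[OF j]) auto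
    moreover have "(cx (c n) (Suc j) - cx (c n) j) + cp (c n) (N - 1) = cp (c n) j" for n
      using c(5)[OF j, of n] by (simp add: algebra_simps)
    ultimately show ?thesis by simp
  qed (simp only: c tendsto_const)
  have "(\<lambda>n. (cx (c n), cp (c n), cz (c n))) \<longlonglongrightarrow> ?c"
  proof (intro tendsto_Pair tendsto_coordinatewise)
    show "(\<lambda>n. cx (c n) j) \<longlonglongrightarrow> (if j < N then x else 0)" for j
      using x[of j] c(1) by (cases "j < N") (auto simp: TT_def)
    show "(\<lambda>n. cp (c n) j) \<longlonglongrightarrow> (if j < N then p else 0)" for j
      using p[of j] c(1) by (cases "j < N") (auto simp: TT_def)
  qed (simp add: c)
  then have "(\<lambda>n. A (c n)) \<longlonglongrightarrow> A ?c"
    using continuous_on_tendsto_compose[OF cont_act, of c ?c] by simp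
  then have "A ?c \<le> 0"
    by (rule LIMSEQ_le[OF _ lim0]) (use c(6) in auto)
  then show False using A0 by simp
qed

text \<open>Without such a critical point, \<open>deform\<close> would push a sheet almost optimal
  for \<open>F'\<close> below the minimax value of \<open>A\<close>. Taking \<open>F'\<close> equal
  to \<open>A\<close> gives the ordinary minimax principle; a larger \<open>F'\<close> with the same
  value gives the rigidity behind \<open>minmax_F_strict\<close>.\<close>

lemma minmax_critical:
  assumes le: "\<And>c. A c \<le> F' c" and cont: "continuous_on UNIV F'" and per: "\<And>c. F' (shift c) = F' c"
    and ne: "levels N F' \<noteq> {}" and mm: "minmax N F' \<le> minmax N A" and pos: "0 < minmax N A"
  shows "\<exists>c. c \<in> TT N \<and> A c = minmax N A \<and> F' c = A c \<and> gsq c = 0"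
proof (rule ccontr)
  assume no: "\<not> ?thesis"
  define c0 where "c0 = minmax N A"
  obtain \<eta> \<delta> where d: "0 < \<delta>" "continuous_on UNIV \<eta>" "\<And>c. c \<in> TT N \<Longrightarrow> \<eta> c \<in> TT N"
    "\<And>c j. norm (cx (\<eta> c) j - cx c j) \<le> 1" "\<And>c j. norm (cp (\<eta> c) j - cp c j) \<le> 1"
    "\<And>c. \<bar>cz (\<eta> c) - cz c\<bar> \<le> 1"
    "\<And>c. c \<in> TT N \<Longrightarrow> A c + (F' c - A c) \<le> c0 + \<delta> \<Longrightarrow> A (\<eta> c) \<le> c0 - \<delta>"
  proof (rule deform[of c0 "\<lambda>c. F' c - A c"])
    show "0 < c0" using pos by (simp add: c0_def)
    show "continuous_on UNIV (\<lambda>c. F' c - A c)" by (intro continuous_on_diff cont cont_act)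
    show "gsq c \<noteq> 0" if "c \<in> TT N" "A c = c0" "F' c - A c = 0" for c
    proof -
      have "F' c = A c" using that(3) by simp
      with no that(1,2) show ?thesis unfolding c0_def by blast
    qed
  qed (use le per act_shift in auto)
  have "minmax N F' < c0 + \<delta>" using mm d(1) by (simp add: c0_def)
  then obtain a where a: "a \<in> levels N F'" "a < c0 + \<delta>"
    unfolding minmax_def using cInf_lessD[OF ne] by blast
  then obtain h where h: "h \<in> Gam N" "\<And>u. F' (h u) \<le> a" by (auto simp: levels_def)
  have "h u \<in> TT N" for u using h by (auto simp: Gam_def)
  then have "A (\<eta> (h u)) \<le> c0 - \<delta>" for u
    using d(7)[of "h u"] h(2)[of u] a(2) by simp
  moreover have "\<eta> \<circ> h \<in> Gam N"
    by (rule Gam_comp[OF h(1) d(2-6)])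
  ultimately have "c0 - \<delta> \<in> levels N A"
    unfolding levels_def by (intro CollectI bexI[of _ "\<eta> \<circ> h"]) auto
  then have "minmax N A \<le> c0 - \<delta>"
    unfolding minmax_def using levels_nonneg by (intro cInf_lower) (auto simp: bdd_below_def)
  then show False using d(1) by (simp add: c0_def)
qed

end

section \<open>Critical points as closed chains\<close>

lemma genfun_0: "genfun R (\<lambda>_. 0) (\<lambda>_. 0)"
  by (simp add: genfun_def)

lemma genfun_larger: "genfun R f g \<Longrightarrow> R \<le> R' \<Longrightarrow> genfun R' f g"
  unfolding genfun_def by force

lemma genfun_zero_grad:
  assumes "genfun R f g" "f q = 0"
  shows "g q = 0"
proof -
  have "(\<lambda>v. g q \<bullet> v) = (\<lambda>v. 0)"
    by (rule has_derivative_local_min[OF genfun_deriv[OF assms(1), of q]])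
      (simp add: assms(2) genfun_nonneg[OF assms(1)])
  then have "g q \<bullet> g q = 0" by metis
  then show ?thesis by simp
qed

text \<open>The derivative of the new height with respect to the old one is the positive conformal
  factor. Hence height gained in an early step is not lost again later.\<close>

lemma genfun_height_mono:
  assumes "genfun R f g" "z \<le> z'"
  shows "z + f (x, p, z) \<le> z' + f (x, p, z')"
proof (rule DERIV_nonneg_imp_nondecreasing[OF assms(2), of "\<lambda>z. z + f (x, p, z)"])
  fix t
  have "((\<lambda>z::real. (x, p, z)) has_derivative (\<lambda>w. (0, 0, w))) (at t)"
    by (auto intro!: derivative_eq_intros)
  from has_derivative_compose[OF this, of f "\<lambda>v. g (x, p, t) \<bullet> v"] genfun_deriv[OF assms(1), of "(x, p, t)"]
  have "((\<lambda>z. f (x, p, z)) has_real_derivative snd (snd (g (x, p, t)))) (at t)"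
    by (cases "g (x, p, t)") (simp add: has_field_derivative_def mult.commute)
  then have "((\<lambda>z. z + f (x, p, z)) has_real_derivative 1 + snd (snd (g (x, p, t)))) (at t)"
    by (intro DERIV_add DERIV_ident)
  then show "\<exists>y. ((\<lambda>z. z + f (x, p, z)) has_real_derivative y) (at t) \<and> 0 \<le> y"
    using genfun_factor_pos[OF assms(1), of "(x, p, t)"] by (intro exI[of _ "1 + snd (snd (g (x, p, t)))"]) simp
qed

lemma zc_mono:
  assumes "\<And>j. genfun R (f j) (g j)" "\<And>j q. f j q \<le> f' j q"
  shows "zc N f c j \<le> zc N f' c j"
proof (induction j)
  case (Suc j)
  have "zc N f c j + f j (cx c j, cp c j, zc N f c j) \<le> zc N f' c j + f j (cx c j, cp c j, zc N f' c j)"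
    by (rule genfun_height_mono[OF assms(1) Suc])
  then show ?case using assms(2)[of j "(cx c j, cp c j, zc N f' c j)"] by simp
qed simp

lemma act_mono:
  assumes "\<And>j. genfun R (f j) (g j)" "\<And>j q. f j q \<le> f' j q"
  shows "act N f c \<le> act N f' c"
  unfolding act_def by (intro diff_right_mono zc_mono[OF assms])

text \<open>The formulas come from comparing coefficients in dZ - P dX = E (dz - y dx), where Z = z
  + f(x, P, z) + P.(X - x). The implicit equation for \<open>P\<close> is a premise, so a critical
  chain, which supplies \<open>P\<close>, yields the image of its point at once.\<close>

definition gen_by :: "('a::euclidean_space \<times> 'a \<times> real \<Rightarrow> 'a \<times> 'a \<times> real) \<Rightarrow> ('a \<times> 'a \<times> real \<Rightarrow> real) \<Rightarrow>
    ('a \<times> 'a \<times> real \<Rightarrow> real) \<Rightarrow> ('a \<times> 'a \<times> real \<Rightarrow> 'a \<times> 'a \<times> real) \<Rightarrow> bool" where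
  "gen_by \<sigma> E f g \<longleftrightarrow> (\<forall>x y z P. P = (1 + snd (snd (g (x, P, z)))) *\<^sub>R y + fst (g (x, P, z)) \<longrightarrow>
     \<sigma> (x, y, z) = (x - fst (snd (g (x, P, z))), P, z + f (x, P, z) - P \<bullet> fst (snd (g (x, P, z)))) \<and>
     E (x, y, z) = 1 + snd (snd (g (x, P, z))))"

lemma gen_by_id: "gen_by id (\<lambda>_. 1) (\<lambda>_. 0) (\<lambda>_. 0)"
  by (simp add: gen_by_def)

lemma gen_by_fix:
  assumes "gen_by \<sigma> E f g" "g (x, y, z) = 0" "f (x, y, z) = 0"
  shows "\<sigma> (x, y, z) = (x, y, z)"
  using assms(1)[unfolded gen_by_def, rule_format, of y x z y] assms(2,3) by simp

text \<open>The phase point before step \<open>j\<close>; its momentum is the one produced by the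
  preceding step, cyclically. At \<open>j = N\<close> position and momentum are those of
  \<open>j = 0\<close> again, so these two points differ only in height, by the action.\<close>

definition pos :: "nat \<Rightarrow> (nat \<Rightarrow> 'a::euclidean_space \<times> 'a \<times> real \<Rightarrow> real) \<Rightarrow> 'a cfg \<Rightarrow> nat \<Rightarrow> 'a \<times> 'a \<times> real" where
  "pos N f c j = (cx c (j mod N), cp c (prv N j), zc N f c j)"

context chain
begin

lemma critD:
  assumes "gsq c = 0"
  shows "T c N = 1" "j < N \<Longrightarrow> cx c (nxt N j) = cx c j - fst (snd (g j (Pt c j)))"
    "j < N \<Longrightarrow> cp c j = (1 + snd (snd (g j (Pt c j)))) *\<^sub>R cp c (prv N j) + fst (g j (Pt c j))"
proof -
  have s: "0 \<le> (\<Sum>j<N. (norm (GX c j))\<^sup>2 + (norm (GP c j))\<^sup>2)" by (intro sum_nonneg) simp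
  then have z: "GZ c = 0" and s0: "(\<Sum>j<N. (norm (GX c j))\<^sup>2 + (norm (GP c j))\<^sup>2) = 0"
    using assms unfolding gsq_def by (auto simp: add_nonneg_eq_0_iff)
  have xp: "GX c j = 0 \<and> GP c j = 0" if "j < N" for j
  proof -
    have "(norm (GX c j))\<^sup>2 + (norm (GP c j))\<^sup>2 = 0"
      using s0 that by (subst (asm) sum_nonneg_eq_0_iff) auto
    then show ?thesis by (auto simp: add_nonneg_eq_0_iff)
  qed
  show T1: "T c N = 1" using z by (simp add: gZ_def)
  show "cx c (nxt N j) = cx c j - fst (snd (g j (Pt c j)))" if "j < N"
  proof -
    have "T c (Suc j) *\<^sub>R (cx c (nxt N j) - cx c j + fst (snd (g j (Pt c j)))) = 0"
      using xp[OF that] by (simp add: gP_def del: th.simps)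
    then have "cx c (nxt N j) - cx c j + fst (snd (g j (Pt c j))) = 0"
      using th_pos[of c "Suc j"] by (simp del: th.simps)
    then show ?thesis by (simp add: algebra_simps)
  qed
  show "cp c j = (1 + snd (snd (g j (Pt c j)))) *\<^sub>R cp c (prv N j) + fst (g j (Pt c j))" if "j < N"
  proof -
    \<comment> \<open>For \<open>j = 0\<close> the formula of \<open>gX\<close> has
      \<open>T c N\<close> in place of \<open>T c 0\<close>; at a critical point both are 1.\<close>
    have "T c (Suc (prv N j)) = T c j"
      using that T1 by (cases j) (simp_all add: prv_def del: th.simps(2))
    then have "T c j *\<^sub>R cp c (prv N j) + T c (Suc j) *\<^sub>R (fst (g j (Pt c j)) - cp c j) = 0"
      using xp[OF that] by (simp add: gX_def del: th.simps)
    then have "T c (Suc j) *\<^sub>R ((1 + snd (snd (g j (Pt c j)))) *\<^sub>R cp c (prv N j) + fst (g j (Pt c j)) - cp c j) = 0"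
      unfolding th_Suc_mult[of c j, symmetric] by (simp add: algebra_simps del: th.simps)
    then show ?thesis using th_pos[of c "Suc j"] by (simp del: th.simps)
  qed
qed

lemma crit_chain:
  assumes "gsq c = 0" "j < N" "gen_by \<sigma> E (f j) (g j)"
  shows "pos N f c (Suc j) = \<sigma> (pos N f c j)" "T c (Suc j) = T c j / E (pos N f c j)"
proof -
  note d = critD(2,3)[OF assms(1,2)]
  have Pt: "Pt c j = (cx c j, cp c j, Z c j)" by (simp add: pnt_def)
  have G: "\<sigma> (cx c j, cp c (prv N j), Z c j) = (cx c j - fst (snd (g j (Pt c j))), cp c j,
      Z c j + f j (Pt c j) - cp c j \<bullet> fst (snd (g j (Pt c j)))) \<and>
      E (cx c j, cp c (prv N j), Z c j) = 1 + snd (snd (g j (Pt c j)))"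
    using assms(3) d(2) unfolding gen_by_def Pt by blast
  have p: "pos N f c j = (cx c j, cp c (prv N j), Z c j)"
    using assms(2) by (simp add: pos_def)
  have "Suc j mod N = nxt N j" using assms(2) by (auto simp: nxt_def)
  then show "pos N f c (Suc j) = \<sigma> (pos N f c j)"
    using G d(1) unfolding p by (simp add: pos_def prv_def Pt inner_diff_right)
  show "T c (Suc j) = T c j / E (pos N f c j)"
    using G unfolding p by simp
qed

end

section \<open>A displacing generating function\<close>

text \<open>Squaring the positive part makes the cutoff C^1, the regularity that
  \<open>genfun\<close> asks for.\<close>

lemma cutoff_deriv:
  fixes u :: "'a::euclidean_space"
  shows "((\<lambda>u. (max 0 (s - u \<bullet> u))\<^sup>2) has_derivative (\<lambda>v. (- 4 * max 0 (s - u \<bullet> u)) *\<^sub>R u \<bullet> v)) (at u)"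
proof -
  have sq: "((\<lambda>t::real. (max 0 t)\<^sup>2) has_real_derivative 2 * max 0 t) (at t)" for t
  proof -
    consider "t < 0" | "t = 0" | "t > 0" by linarith
    then show ?thesis
    proof cases
      case 1
      have "((\<lambda>t::real. 0) has_real_derivative 0) (at t)" by simp
      then have "((\<lambda>t::real. (max 0 t)\<^sup>2) has_real_derivative 0) (at t)"
        by (rule has_field_derivative_transform_within_open[of _ _ _ "{..<0}"]) (use 1 in auto)
      then show ?thesis using 1 by simp
    next
      case 3
      have "((\<lambda>t::real. t\<^sup>2) has_real_derivative 2 * t) (at t)"
        by (auto intro!: derivative_eq_intros)
      then have "((\<lambda>t::real. (max 0 t)\<^sup>2) has_real_derivative 2 * t) (at t)"
        by (rule has_field_derivative_transform_within_open[of _ _ _ "{0<..}"]) (use 3 in auto)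
      then show ?thesis using 3 by simp
    next
      case 2
      have "((\<lambda>h::real. ((max 0 h)\<^sup>2) / h) \<longlongrightarrow> 0) (at 0)"
      proof (rule Lim_null_comparison)
        show "\<forall>\<^sub>F h::real in at 0. norm ((max 0 h)\<^sup>2 / h) \<le> \<bar>h\<bar>"
          by (rule always_eventually) (auto simp: max_def power2_eq_square)
        show "((\<lambda>h::real. \<bar>h\<bar>) \<longlongrightarrow> 0) (at 0)" by (auto intro!: tendsto_eq_intros)
      qed
      then show ?thesis using 2 by (simp add: DERIV_def)
    qed
  qed
  have "((\<lambda>u. s - u \<bullet> u) has_derivative (\<lambda>v. - 2 * (u \<bullet> v))) (at u)"
    by (auto intro!: derivative_eq_intros simp: inner_commute)
  from has_derivative_compose[OF this sq[unfolded has_field_derivative_def]]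
  show ?thesis by (simp add: algebra_simps)
qed

text \<open>A product of bumps, independent of height. Its momentum derivative has to exceed the
  diameter of the ball of positions, so the bump in the momentum is centred at \<open>p0\<close>,
  outside the ball of radius \<open>R\<close>, and its gradient has no zero in that ball.\<close>

lemma displacing_genfun:
  fixes R :: real
  assumes "0 \<le> R"
  obtains R' h gh C where "R \<le> R'" "genfun R' h (gh :: 'a::euclidean_space \<times> 'a \<times> real \<Rightarrow> _)" "\<And>q. h q \<le> C"
    "\<And>x p z. norm x \<le> R \<Longrightarrow> norm p \<le> R \<Longrightarrow> 2 * R < norm (fst (snd (gh (x, p, z))))"
proof -
  obtain b :: 'a where b: "b \<in> Basis" by (meson nonempty_Basis ex_in_conv)
  define p0 where "p0 = (R + 1) *\<^sub>R b"
  have np0: "norm p0 = R + 1" using b assms by (simp add: p0_def)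
  \<comment> \<open>On the ball \<open>norm x\<close> is at most \<open>R\<close> and
    \<open>norm (p - p0)\<close> lies between 1 and \<open>2 * R + 1\<close>. This \<open>S\<close>
    keeps both positive parts at least 1, and the momentum derivative is then at least
    \<open>4 * (R + 1)\<close>.\<close>
  define S where "S = 2 * R + 3"
  define \<beta> where "\<beta> u = (max 0 (S\<^sup>2 - u \<bullet> u))\<^sup>2" for u :: 'a
  define \<beta>' where "\<beta>' u = (- 4 * max 0 (S\<^sup>2 - u \<bullet> u)) *\<^sub>R u" for u :: 'a
  define h where "h = (\<lambda>q :: 'a \<times> 'a \<times> real. (R + 1) * \<beta> (fst q) * \<beta> (fst (snd q) - p0))"
  define gh where "gh = (\<lambda>q :: 'a \<times> 'a \<times> real. (((R + 1) * \<beta> (fst (snd q) - p0)) *\<^sub>R \<beta>' (fst q),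
      ((R + 1) * \<beta> (fst q)) *\<^sub>R \<beta>' (fst (snd q) - p0), 0 :: real))"
  have S: "0 < S" using assms by (simp add: S_def)
  have \<beta>d: "(\<beta> has_derivative (\<lambda>v. \<beta>' u \<bullet> v)) (at u)" for u
    unfolding \<beta>_def \<beta>'_def by (rule cutoff_deriv)
  have \<beta>c: "continuous_on UNIV \<beta>" "continuous_on UNIV \<beta>'"
    unfolding \<beta>_def \<beta>'_def by (auto intro!: continuous_intros)
  have \<beta>0: "0 \<le> \<beta> u" for u by (simp add: \<beta>_def)
  have out: "\<beta> u = 0" if "S \<le> norm u" for u
  proof -
    have "S\<^sup>2 \<le> (norm u)\<^sup>2" using that S by (intro power_mono) auto
    then show ?thesis by (simp add: \<beta>_def power2_norm_eq_inner)
  qed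
  have \<beta>ub: "\<beta> u \<le> (S\<^sup>2)\<^sup>2" for u
    unfolding \<beta>_def by (intro power_mono) auto
  have hd: "(h has_derivative (\<lambda>v. gh q \<bullet> v)) (at q)" for q
  proof -
    have 1: "((\<lambda>q. \<beta> (fst q)) has_derivative (\<lambda>v. \<beta>' (fst q) \<bullet> fst v)) (at q)"
      by (rule has_derivative_compose[OF _ \<beta>d]) (auto intro!: derivative_eq_intros)
    have "((\<lambda>q. fst (snd q) - p0) has_derivative (\<lambda>v. fst (snd v))) (at q)"
      by (auto intro!: derivative_eq_intros)
    from has_derivative_compose[OF this \<beta>d]
    have 2: "((\<lambda>q. \<beta> (fst (snd q) - p0)) has_derivative (\<lambda>v. \<beta>' (fst (snd q) - p0) \<bullet> fst (snd v))) (at q)" .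
    show ?thesis
      unfolding h_def gh_def
      by (rule has_derivative_eq_rhs[OF has_derivative_mult[OF has_derivative_mult_right[OF 1] 2]])
        (auto simp: fun_eq_iff inner_prod_def algebra_simps)
  qed
  have "continuous_on UNIV gh"
    unfolding gh_def
    by (intro continuous_intros continuous_on_compose2[OF \<beta>c(1)] continuous_on_compose2[OF \<beta>c(2)]) auto
  moreover have "h (x, p, z) = 0" if "S + R + 1 < norm x \<or> S + R + 1 < norm p" for x p z
  proof -
    have "S \<le> norm x \<or> S \<le> norm (p - p0)"
      using that norm_triangle_ineq2[of p p0] np0 assms by auto
    then show ?thesis using out by (auto simp: h_def)
  qed
  moreover have "0 \<le> h q" for q using \<beta>0 assms by (simp add: h_def)
  ultimately have "genfun (S + R + 1) h gh"
    using hd by (auto simp: genfun_def) (auto simp: gh_def h_def)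
  moreover have "h q \<le> (R + 1) * (S\<^sup>2)\<^sup>2 * (S\<^sup>2)\<^sup>2" for q
    unfolding h_def using \<beta>ub \<beta>0 assms by (intro mult_mono) auto
  moreover have "2 * R < norm (fst (snd (gh (x, p, z))))" if "norm x \<le> R" "norm p \<le> R" for x p z
  proof -
    have "(norm x)\<^sup>2 \<le> R\<^sup>2" using that by (intro power_mono) auto
    then have "1 \<le> S\<^sup>2 - x \<bullet> x"
    proof -
      have "S\<^sup>2 = 4 * R\<^sup>2 + 12 * R + 9" by (simp add: S_def power2_eq_square algebra_simps)
      then show ?thesis using \<open>(norm x)\<^sup>2 \<le> R\<^sup>2\<close> assms zero_le_power2[of R]
        unfolding power2_norm_eq_inner by linarith
    qed
    then have bx: "1 \<le> \<beta> x" by (simp add: \<beta>_def)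
    have u: "1 \<le> norm (p - p0)" using norm_triangle_ineq2[of p0 p] np0 that by (simp add: norm_minus_commute)
    have "norm (p - p0) \<le> 2 * R + 1" using norm_triangle_ineq4[of p p0] np0 that by simp
    then have "(norm (p - p0))\<^sup>2 \<le> (2 * R + 1)\<^sup>2" by (intro power_mono) auto
    then have "1 \<le> S\<^sup>2 - (p - p0) \<bullet> (p - p0)"
      using assms by (simp add: S_def power2_norm_eq_inner power2_sum field_simps)
    then have "1 * 1 \<le> max 0 (S\<^sup>2 - (p - p0) \<bullet> (p - p0)) * norm (p - p0)"
      using u by (intro mult_mono) auto
    moreover have "norm (\<beta>' (p - p0)) = 4 * (max 0 (S\<^sup>2 - (p - p0) \<bullet> (p - p0)) * norm (p - p0))"
      unfolding \<beta>'_def norm_scaleR abs_mult by simp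
    ultimately have b': "4 \<le> norm (\<beta>' (p - p0))" by linarith
    have "(R + 1) * 1 * 4 \<le> (R + 1) * \<beta> x * norm (\<beta>' (p - p0))"
      using bx b' assms by (intro mult_mono) auto
    also have "\<dots> = norm (fst (snd (gh (x, p, z))))"
      using assms \<beta>0[of x] by (simp add: gh_def abs_mult)
    finally have "(R + 1) * 1 * 4 \<le> norm (fst (snd (gh (x, p, z))))" .
    moreover have "2 * R < (R + 1) * 1 * 4" using assms by simp
    ultimately show ?thesis by (rule less_le_trans[rotated])
  qed
  ultimately show ?thesis
    using S assms by (intro that[of "S + R + 1" h gh "(R + 1) * (S\<^sup>2)\<^sup>2 * (S\<^sup>2)\<^sup>2"]) auto
qed

section \<open>Spectral values of iterates\<close>

locale word =
  fixes m :: nat and R :: real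
    and \<sigma> :: "nat \<Rightarrow> 'a::euclidean_space \<times> 'a \<times> real \<Rightarrow> 'a \<times> 'a \<times> real"
    and E :: "nat \<Rightarrow> 'a \<times> 'a \<times> real \<Rightarrow> real" and f g
  assumes m: "0 < m" and R: "0 \<le> R"
    and gens: "\<And>i. genfun R (f i) (g i)" and genby: "\<And>i. gen_by (\<sigma> i) (E i) (f i) (g i)"
    and injs: "\<And>i. inj (\<sigma> i)"
begin

primrec cmpo :: "nat \<Rightarrow> 'a \<times> 'a \<times> real \<Rightarrow> 'a \<times> 'a \<times> real" where
  "cmpo 0 q = q"
| "cmpo (Suc j) q = \<sigma> (j mod m) (cmpo j q)"

primrec fac :: "nat \<Rightarrow> 'a \<times> 'a \<times> real \<Rightarrow> real" where
  "fac 0 q = 1"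
| "fac (Suc j) q = fac j q * E (j mod m) (cmpo j q)"

definition inside :: "('a \<times> 'a \<times> real) \<Rightarrow> bool" where
  "inside q \<longleftrightarrow> norm (fst q) \<le> R \<and> norm (fst (snd q)) \<le> R"

lemma fix_outside: "\<not> inside q \<Longrightarrow> \<sigma> i q = q"
  using gen_by_fix[OF genby, of i] genfun_grad_outside[OF gens] genfun_outside[OF gens]
  by (cases q) (auto simp: inside_def not_le)

lemma cmpo_outside: "\<not> inside q \<Longrightarrow> cmpo j q = q"
  by (induction j) (simp_all add: fix_outside)

text \<open>An image point outside would be fixed, hence by injectivity equal to the point it came
  from.\<close>

lemma inside_step: "inside q \<Longrightarrow> inside (\<sigma> i q)"
  using fix_outside[of "\<sigma> i q" i] injs by (metis injD)

lemma cmpo_inside: "inside q \<Longrightarrow> inside (cmpo j q)"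
  by (induction j) (simp_all add: inside_step)

lemma inj_cmpo: "inj (cmpo j)"
proof (induction j)
  case (Suc j)
  have "cmpo (Suc j) = \<sigma> (j mod m) \<circ> cmpo j" by auto
  then show ?case using inj_compose[OF injs Suc] by (simp only:)
qed (simp add: inj_def)

lemma cmpo_add: "cmpo (j + k * m) q = cmpo j (cmpo (k * m) q)"
  by (induction j) simp_all

lemma cmpo_power: "cmpo (k * m) = cmpo m ^^ k"
proof (induction k)
  case (Suc k)
  then show ?case using cmpo_add[of m k] by (auto simp: fun_eq_iff)
qed (simp add: fun_eq_iff)

lemma fac_add: "fac (j + k * m) q = fac (k * m) q * fac j (cmpo (k * m) q)"
  by (induction j) (simp_all add: cmpo_add)

text \<open>Padding with trivial steps puts all iterates into one configuration space, where their
  functionals are comparable pointwise.\<close>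

definition wfun :: "nat \<Rightarrow> nat \<Rightarrow> 'a \<times> 'a \<times> real \<Rightarrow> real" where
  "wfun k j = (if j < k * m then f (j mod m) else (\<lambda>_. 0))"
definition wgrad :: "nat \<Rightarrow> nat \<Rightarrow> 'a \<times> 'a \<times> real \<Rightarrow> 'a \<times> 'a \<times> real" where
  "wgrad k j = (if j < k * m then g (j mod m) else (\<lambda>_. 0))"

lemma wgen: "genfun R (wfun k j) (wgrad k j)"
  by (simp add: wfun_def wgrad_def gens genfun_0)

lemma wfun_mono: "k \<le> k' \<Longrightarrow> wfun k j q \<le> wfun k' j q"
  by (auto simp: wfun_def genfun_nonneg[OF gens] dest: mult_le_mono1[of k k' m])

lemma wchain: "2 \<le> N \<Longrightarrow> chain N R (wfun k) (wgrad k)"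
  by (simp add: chain_def wgen)

definition F :: "nat \<Rightarrow> nat \<Rightarrow> 'a cfg \<Rightarrow> real" where
  "F N k = act N (wfun k)"

text \<open>Formulated for every chain that begins with \<open>k\<close> copies of the word, so that
  it serves the padded words and also the chain ending in a displacing step.\<close>

lemma follows:
  assumes ch: "chain N R' fs gs" and crit: "chain.gsq N fs gs c = 0"
    and eq: "\<And>j. j < k * m \<Longrightarrow> fs j = f (j mod m) \<and> gs j = g (j mod m)" and j: "j \<le> k * m" "k * m \<le> N"
  shows "pos N fs c j = cmpo j (pos N fs c 0) \<and> th N fs gs c j * fac j (pos N fs c 0) = 1"
  using j(1)
proof (induction j)
  case (Suc j)
  then have IH: "pos N fs c j = cmpo j (pos N fs c 0)" "th N fs gs c j * fac j (pos N fs c 0) = 1" by auto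
  have jN: "j < N" "j < k * m" using Suc.prems j(2) by auto
  have gb: "gen_by (\<sigma> (j mod m)) (E (j mod m)) (fs j) (gs j)" using eq[OF jN(2)] genby by simp
  note cc = chain.crit_chain[OF ch crit jN(1) gb]
  have "th N fs gs c j \<noteq> 0" using chain.th_pos[OF ch] by (metis less_irrefl)
  have "0 < th N fs gs c (Suc j)" "0 < th N fs gs c j" by (rule chain.th_pos[OF ch])+
  then have "E (j mod m) (pos N fs c j) \<noteq> 0" using cc(2) by (metis division_ring_divide_zero less_irrefl)
  then show ?case using cc IH by (simp del: th.simps)
qed (simp add: pos_def)

text \<open>Minimality of \<open>i\<close> keeps the height of a constant configuration at its
  initial value up to step \<open>i\<close>, so \<open>minmax_F_pos\<close> can evaluate
  \<open>f i\<close> at \<open>q\<close> itself.\<close>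

lemma first_active:
  assumes "cmpo m \<noteq> id"
  obtains i q where "i < m" "0 < f i q" "\<And>j. j < i \<Longrightarrow> f j = (\<lambda>_. 0)"
proof -
  have "\<exists>i<m. \<exists>q. f i q \<noteq> 0"
  proof (rule ccontr)
    assume "\<not> ?thesis"
    then have z: "f i q = 0" if "i < m" for i q using that by blast
    have "j \<le> m \<Longrightarrow> cmpo j q = q" for j q
    proof (induction j)
      case (Suc j)
      then show ?case
        using z[of j] gen_by_fix[OF genby, of j] genfun_zero_grad[OF gens, of j] by (cases q) auto
    qed simp
    then show False using assms by (auto simp: fun_eq_iff)
  qed
  then have ex: "\<exists>i. i < m \<and> (\<exists>q. f i q \<noteq> 0)" by blast
  define i where "i = (LEAST i. i < m \<and> (\<exists>q. f i q \<noteq> 0))"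
  have "i < m \<and> (\<exists>q. f i q \<noteq> 0)" unfolding i_def by (rule LeastI_ex[OF ex])
  then obtain q where i: "i < m" "f i q \<noteq> 0" by blast
  have "f j = (\<lambda>_. 0)" if "j < i" for j
    using not_less_Least[OF that[unfolded i_def]] that i(1) by (auto simp: fun_eq_iff)
  then show ?thesis using i genfun_nonneg[OF gens, of i q] by (intro that[of i q]) auto
qed

lemma minmax_F_pos:
  assumes "cmpo m \<noteq> id" "2 \<le> N" "1 \<le> k" "k * m \<le> N"
  shows "0 < minmax N (F N k)"
proof -
  interpret chain N R "wfun k" "wgrad k" by (rule wchain[OF assms(2)])
  obtain i q where i: "i < m" "0 < f i q" "\<And>j. j < i \<Longrightarrow> f j = (\<lambda>_. 0)"
    by (rule first_active[OF assms(1)], rule that)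
  obtain x p z where q: "q = (x, p, z)" by (cases q)
  define c where "c = (\<lambda>j. if j < N then x else 0, \<lambda>j. if j < N then p else 0, z)"
  have mk: "m \<le> k * m" using assms(3) by simp
  then have iN: "i < N" using i(1) assms(4) by linarith
  have wi: "wfun k j = f j" if "j \<le> i" for j
  proof -
    have "j < k * m" "j < m" using that i(1) mk by linarith+
    then show ?thesis by (simp add: wfun_def)
  qed
  have LP0: "LP N c j = 0" if "j < N" for j
    using that assms(2) by (auto simp: LP_def c_def nxt_def)
  have Zi: "j \<le> i \<Longrightarrow> zc N (wfun k) c j = z" for j
  proof (induction j)
    case 0
    show ?case by (simp add: c_def)
  next
    case (Suc j)
    then show ?case using LP0[of j] wi[of j] i(3)[of j] iN by (simp add: LP_def)
  qed
  have "wfun k i (pnt N (wfun k) c i) = f i q"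
    using Zi[of i] wi[of i] iN by (simp add: pnt_def q c_def)
  moreover have "wfun k i (pnt N (wfun k) c i) \<le> (\<Sum>j<N. wfun k j (pnt N (wfun k) c j))"
    using iN by (intro member_le_sum genfun_nonneg[OF wgen]) auto
  moreover have "act N (wfun k) c = (\<Sum>j<N. wfun k j (pnt N (wfun k) c j))"
    unfolding act_eq using LP0 by simp
  ultimately have "0 < act N (wfun k) c" using i(2) by simp
  then show ?thesis unfolding F_def c_def by (rule minmax_pos)
qed

lemma F_mono: "k \<le> k' \<Longrightarrow> F N k c \<le> F N k' c"
  unfolding F_def by (rule act_mono[OF wgen wfun_mono])

lemma minmax_F_mono:
  assumes "2 \<le> N" "k \<le> k'"
  shows "minmax N (F N k) \<le> minmax N (F N k')"
proof (rule minmax_mono[OF F_mono[OF assms(2)]])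
  show "levels N (F N k') \<noteq> {}" unfolding F_def by (rule chain.levels_nonempty[OF wchain[OF assms(1)]])
  show "0 \<le> a" if "a \<in> levels N (F N k)" for a
    using chain.levels_nonneg[OF wchain[OF assms(1)]] that unfolding F_def by blast
qed

lemma critical_F:
  assumes "2 \<le> N" "k * m < N" "chain.gsq N (wfun k) (wgrad k) c = 0"
  defines "q \<equiv> pos N (wfun k) c 0"
  shows "cmpo (k * m) q = q + (0, 0, F N k c)" "fac (k * m) q = 1"
    "\<And>j. k * m \<le> j \<Longrightarrow> j \<le> N \<Longrightarrow> pos N (wfun k) c j = cmpo (k * m) q"
proof -
  interpret chain N R "wfun k" "wgrad k" by (rule wchain[OF assms(1)])
  have "wfun k j = f (j mod m) \<and> wgrad k j = g (j mod m)" if "j < k * m" for j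
    using that by (simp add: wfun_def wgrad_def)
  from follows[OF chain_axioms assms(3) this, of k "k * m"] assms(2)
  have fo: "pos N (wfun k) c (k * m) = cmpo (k * m) q" "th N (wfun k) (wgrad k) c (k * m) * fac (k * m) q = 1"
    unfolding q_def by auto
  have rest: "pos N (wfun k) c j = pos N (wfun k) c (k * m) \<and> th N (wfun k) (wgrad k) c j = th N (wfun k) (wgrad k) c (k * m)"
    if "k * m \<le> j" "j \<le> N" for j
    using that
  proof (induction j rule: dec_induct)
    case (step j)
    have "gen_by id (\<lambda>_. 1) (wfun k j) (wgrad k j)" using step by (simp add: wfun_def wgrad_def gen_by_id)
    from crit_chain[OF assms(3) _ this] step show ?case by (simp del: th.simps)
  qed simp
  show r: "pos N (wfun k) c j = cmpo (k * m) q" if "k * m \<le> j" "j \<le> N" for j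
    using rest[OF that] fo(1) by simp
  have "pos N (wfun k) c N = q + (0, 0, F N k c)"
    using assms(1) by (simp add: q_def pos_def F_def act_def prv_def)
  then show "cmpo (k * m) q = q + (0, 0, F N k c)" using r[of N] assms(2) by simp
  show "fac (k * m) q = 1" using rest[of N] critD(1)[OF assms(3)] fo(2) assms(2) by (simp del: th.simps)
qed

text \<open>If the values agreed, there would be a critical point for the k-th iterate at which
  another copy of the word adds no height. The nonnegative generating functions of its letters then
  all vanish at the end point, which is therefore fixed by the whole word, and the action is
  0.\<close>

lemma minmax_F_strict:
  assumes ne: "cmpo m \<noteq> id" and "2 \<le> N" "1 \<le> k" "Suc k * m < N"
  shows "minmax N (F N k) < minmax N (F N (Suc k))"
proof (rule ccontr)
  assume "\<not> ?thesis"
  then have le: "minmax N (F N (Suc k)) \<le> minmax N (F N k)" by simp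
  interpret chain N R "wfun k" "wgrad k" by (rule wchain[OF assms(2)])
  interpret C': chain N R "wfun (Suc k)" "wgrad (Suc k)" by (rule wchain[OF assms(2)])
  have pos: "0 < minmax N (F N k)" by (rule minmax_F_pos) (use assms in auto)
  obtain c where c: "act N (wfun k) c = minmax N (F N k)"
    "act N (wfun (Suc k)) c = act N (wfun k) c" "gsq c = 0"
    using minmax_critical[of "act N (wfun (Suc k))"] act_mono[OF wgen wfun_mono[of k "Suc k"]]
      C'.cont_act C'.act_shift C'.levels_nonempty le pos unfolding F_def by auto
  define q where "q = pos N (wfun k) c 0"
  have km: "k * m < N" using assms(4) by simp
  note cr = critical_F[OF assms(2) km c(3), folded q_def]
  obtain x y z where q': "cmpo (k * m) q = (x, y, z)" by (cases "cmpo (k * m) q")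
  have P: "pos N (wfun k) c j = (x, y, z)" if "k * m \<le> j" "j \<le> N" for j
    using cr(3)[OF that] q' by simp
  have xj: "cx c (j mod N) = x" and zj: "zc N (wfun k) c j = z" if "k * m \<le> j" "j \<le> N" for j
    using P[OF that] by (auto simp: pos_def)
  \<comment> \<open>The momentum chosen in step \<open>j\<close> is the one recorded by
    \<open>pos\<close> at \<open>Suc j\<close>.\<close>
  have pj: "cp c j = y" if "k * m \<le> j" "j < N" for j
    using P[of "Suc j"] that by (simp add: pos_def prv_def)
  define Z' where "Z' = zc N (wfun (Suc k)) c"
  have step: "Z' (Suc j) = Z' j + wfun (Suc k) j (x, y, Z' j)" if "k * m \<le> j" "j < N" for j
  proof -
    have "nxt N j = Suc j mod N" using that by (auto simp: nxt_def)
    then show ?thesis using xj[of j] xj[of "Suc j"] pj[OF that] that by (simp add: Z'_def)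
  qed
  have start: "j \<le> k * m \<Longrightarrow> Z' j = zc N (wfun k) c j" for j
    by (induction j) (simp_all add: Z'_def wfun_def)
  \<comment> \<open>Position and momentum stand still from \<open>k * m\<close> on, so each step
    changes the height by the value of its generating function. Equal heights at both ends make the
    height constant.\<close>
  have up: "Z' i \<le> Z' j" if "k * m \<le> i" "i \<le> j" "j \<le> N" for i j
    using that(2,3)
  proof (induction j rule: dec_induct)
    case (step j)
    then show ?case
      using \<open>\<And>j. k * m \<le> j \<Longrightarrow> j < N \<Longrightarrow> Z' (Suc j) = Z' j + wfun (Suc k) j (x, y, Z' j)\<close>[of j]
        genfun_nonneg[OF wgen[of "Suc k" j], of "(x, y, Z' j)"] that(1) by simp
  qed simp
  have "Z' N = z" using c(2) zj[of N] km by (simp add: act_def Z'_def)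
  moreover have "Z' (k * m) = z" using start[of "k * m"] zj[of "k * m"] km by simp
  ultimately have const: "Z' j = z" if "k * m \<le> j" "j \<le> N" for j
    using up[of "k * m" j] up[of j N] that km by simp
  have f0: "f i (x, y, z) = 0" if "i < m" for i
  proof -
    have "k * m + i < Suc k * m" using that by simp
    then have "wfun (Suc k) (k * m + i) (x, y, z) = 0"
      using step[of "k * m + i"] const[of "k * m + i"] const[of "Suc (k * m + i)"] assms(4) by simp
    then show ?thesis using that by (simp add: wfun_def)
  qed
  have "j \<le> m \<Longrightarrow> cmpo j (x, y, z) = (x, y, z)" for j
  proof (induction j)
    case (Suc j)
    then show ?case using f0[of j] gen_by_fix[OF genby, of j] genfun_zero_grad[OF gens, of j] by auto
  qed simp
  then have "cmpo m (x, y, z) = (x, y, z)" by simp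
  then have fix1: "cmpo m (cmpo (k * m) q) = cmpo (k * m) q" by (simp add: q')
  \<comment> \<open>The word commutes with its powers; as these are injective, fixing the image of
    \<open>q\<close> means fixing \<open>q\<close>.\<close>
  have "cmpo (k * m) (cmpo m q) = cmpo m (cmpo (k * m) q)"
    unfolding cmpo_power by (simp add: funpow_swap1)
  then have "cmpo m q = q" using fix1 inj_cmpo by (metis injD)
  then have "cmpo (k * m) q = q"
    unfolding cmpo_power by (induction k) auto
  then have "F N k c = 0" using cr(1) by (cases q) auto
  then show False using c(1) pos by (simp add: F_def)
qed

lemma minmax_F_bounded:
  assumes ne: "cmpo m \<noteq> id"
  obtains C where "\<And>K. 1 \<le> K \<Longrightarrow> minmax (Suc (K * m)) (F (Suc (K * m)) K) \<le> C"
proof -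
  obtain R' h gh C where h: "R \<le> R'" "genfun R' h (gh :: 'a \<times> 'a \<times> real \<Rightarrow> _)" "\<And>q. h q \<le> C"
    "\<And>x p z. norm x \<le> R \<Longrightarrow> norm p \<le> R \<Longrightarrow> 2 * R < norm (fst (snd (gh (x, p, z))))"
    by (rule displacing_genfun[OF R], rule that)
  have "minmax (Suc (K * m)) (F (Suc (K * m)) K) \<le> C" if K: "1 \<le> K" for K
  proof -
    \<comment> \<open>One slot more than the \<open>K\<close> copies of the word, for the displacing
      step. The bound \<open>C\<close> on \<open>h\<close> was chosen before
      \<open>K\<close>.\<close>
    define N where "N = Suc (K * m)"
    have N2: "2 \<le> N" using K m by (simp add: N_def Suc_le_eq)
    define fs where "fs j = (if j < K * m then f (j mod m) else h)" for j
    define gs where "gs j = (if j < K * m then g (j mod m) else gh)" for j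
    have gs: "genfun R' (fs j) (gs j)" for j
      using h(2) genfun_larger[OF gens h(1)] by (simp add: fs_def gs_def)
    interpret chain N R' fs gs using N2 gs by unfold_locales
    have le: "minmax N (F N K) \<le> minmax N (act N fs)"
    proof (rule minmax_mono)
      show "F N K c \<le> act N fs c" for c
        unfolding F_def
        by (rule act_mono[OF wgen]) (auto simp: wfun_def fs_def genfun_nonneg[OF h(2)])
      show "levels N (act N fs) \<noteq> {}" by (rule levels_nonempty)
      show "0 \<le> a" if "a \<in> levels N (F N K)" for a
        using chain.levels_nonneg[OF wchain[OF N2]] that unfolding F_def by blast
    qed
    moreover have "0 < minmax N (F N K)"
      by (rule minmax_F_pos[OF ne N2 K]) (simp add: N_def)
    ultimately obtain c where c: "act N fs c = minmax N (act N fs)" "gsq c = 0"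
      using minmax_critical[of "act N fs"] cont_act act_shift levels_nonempty by auto
    define q where "q = pos N fs c 0"
    have "pos N fs c (K * m) = cmpo (K * m) q"
      using follows[OF chain_axioms c(2), of K "K * m"] by (simp add: q_def fs_def gs_def N_def)
    moreover have "pos N fs c (K * m) = (cx c (N - 1), cp c (prv N (N - 1)), zc N fs c (N - 1))"
      by (simp add: pos_def N_def)
    ultimately have q1: "cmpo (K * m) q = (cx c (N - 1), cp c (prv N (N - 1)), zc N fs c (N - 1))" by simp
    have q0: "q = (cx c 0, cp c (N - 1), cz c)" using N2 by (simp add: q_def pos_def prv_def)
    have last: "fs (N - 1) = h" "gs (N - 1) = gh" by (simp_all add: fs_def gs_def N_def)
    have nx: "nxt N (N - 1) = 0" by (simp add: nxt_def N_def)
    have hp: "cx c 0 = cx c (N - 1) - fst (snd (gh (cx c (N - 1), cp c (N - 1), zc N fs c (N - 1))))"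
      using critD(2)[OF c(2), of "N - 1"] N2 unfolding nx last pnt_def by simp
    \<comment> \<open>A point inside stays inside under the word, and the last step would have to
      return its position within the ball although it displaces by more than the diameter.\<close>
    have "\<not> inside q"
    proof
      assume iq: "inside q"
      then have "inside (cmpo (K * m) q)" by (rule cmpo_inside)
      then have n1: "norm (cx c (N - 1)) \<le> R" by (simp add: q1 inside_def)
      have n2: "norm (cx c 0) \<le> R" "norm (cp c (N - 1)) \<le> R" using iq by (auto simp: q0 inside_def)
      have "norm (cx c (N - 1) - cx c 0) \<le> 2 * R"
        using norm_triangle_ineq4[of "cx c (N - 1)" "cx c 0"] n1 n2 by linarith
      moreover have "2 * R < norm (fst (snd (gh (cx c (N - 1), cp c (N - 1), zc N fs c (N - 1)))))"
        by (rule h(4)[OF n1 n2(2)])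
      moreover have "cx c (N - 1) - cx c 0 = fst (snd (gh (cx c (N - 1), cp c (N - 1), zc N fs c (N - 1))))"
        using hp by (simp add: algebra_simps)
      ultimately show False by simp
    qed
    then have "cmpo (K * m) q = q" by (rule cmpo_outside)
    then have "cx c (N - 1) = cx c 0" "zc N fs c (N - 1) = cz c" using q0 q1 by auto
    moreover have "zc N fs c N = zc N fs c (N - 1) + cp c (N - 1) \<bullet> (cx c (nxt N (N - 1)) - cx c (N - 1)) +
        fs (N - 1) (cx c (N - 1), cp c (N - 1), zc N fs c (N - 1))"
      by (simp add: N_def)
    ultimately have "act N fs c = h (cx c 0, cp c (N - 1), cz c)"
      using last(1) nx by (simp add: act_def)
    then show ?thesis using le c(1) h(3) unfolding N_def[symmetric] by (metis order_trans)
  qed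
  then show ?thesis by (rule that)
qed

text \<open>Values and points may change with \<open>K\<close>, because the number \<open>N\<close>
  of steps does; only \<open>C\<close> is uniform.\<close>

lemma spectral_values:
  assumes ne: "cmpo m \<noteq> id"
  obtains C where "\<And>K. \<exists>a q. (\<forall>k\<in>{1..K}. 0 < a k \<and> a k \<le> C \<and> (cmpo m ^^ k) (q k) = q k + (0, 0, a k) \<and>
      fac (k * m) (q k) = 1) \<and> (\<forall>k\<in>{1..K}. \<forall>l\<in>{1..K}. k < l \<longrightarrow> a k < (a l :: real))"
proof -
  obtain C where C: "\<And>K. 1 \<le> K \<Longrightarrow> minmax (Suc (K * m)) (F (Suc (K * m)) K) \<le> C"
    by (rule minmax_F_bounded[OF ne], rule that)
  show ?thesis
  proof (rule that[of C])
    fix K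
    show "\<exists>a q. (\<forall>k\<in>{1..K}. 0 < a k \<and> a k \<le> C \<and> (cmpo m ^^ k) (q k) = q k + (0, 0, a k) \<and>
      fac (k * m) (q k) = 1) \<and> (\<forall>k\<in>{1..K}. \<forall>l\<in>{1..K}. k < l \<longrightarrow> a k < a l)"
    proof (cases "1 \<le> K")
      case True
      define N where "N = Suc (K * m)"
      have N2: "2 \<le> N" using True m by (simp add: N_def Suc_le_eq)
      define a where "a k = minmax N (F N k)" for k
      have kN: "k * m < N" if "k \<le> K" for k
        using mult_le_mono1[OF that, of m] unfolding N_def by linarith
      have ap: "0 < a k" if "1 \<le> k" "k \<le> K" for k
        unfolding a_def using kN[of k] that by (intro minmax_F_pos[OF ne N2]) auto
      have "\<exists>q. (cmpo m ^^ k) q = q + (0, 0, a k) \<and> fac (k * m) q = 1" if k: "1 \<le> k" "k \<le> K" for k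
      proof -
        interpret chain N R "wfun k" "wgrad k" by (rule wchain[OF N2])
        obtain c where c: "act N (wfun k) c = a k" "gsq c = 0"
          using minmax_critical[of "act N (wfun k)"] cont_act act_shift levels_nonempty ap[OF k]
          unfolding a_def F_def by auto
        show ?thesis
          using critical_F(1,2)[OF N2 kN[OF k(2)] c(2)] c(1) unfolding F_def cmpo_power
          by (intro exI[of _ "pos N (wfun k) c 0"]) simp
      qed
      then have "\<forall>k. \<exists>q. 1 \<le> k \<and> k \<le> K \<longrightarrow> (cmpo m ^^ k) q = q + (0, 0, a k) \<and> fac (k * m) q = 1"
        by blast
      then obtain q where q: "\<And>k. 1 \<le> k \<Longrightarrow> k \<le> K \<Longrightarrow> (cmpo m ^^ k) (q k) = q k + (0, 0, a k) \<and> fac (k * m) (q k) = 1"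
        using choice_iff by metis
      have aC: "a k \<le> C" if "k \<le> K" for k
        using minmax_F_mono[OF N2 that] C[OF True] by (simp add: a_def N_def)
      have st: "a k < a l" if "1 \<le> k" "k < l" "l \<le> K" for k l
      proof -
        have "a k < a (Suc k)"
          unfolding a_def using kN[of "Suc k"] that by (intro minmax_F_strict[OF ne N2]) auto
        also have "\<dots> \<le> a l"
          unfolding a_def using that by (intro minmax_F_mono[OF N2]) auto
        finally show ?thesis .
      qed
      show ?thesis
        by (intro exI[of _ a] exI[of _ q]) (use ap aC q st in auto)
    qed auto
  qed
qed

end

section \<open>Generating functions of contactomorphisms close to the identity\<close>

text \<open>A chain rule for \<open>u\<close> known only to be Lipschitz at the point. As the
  derivative of \<open>K\<close> factors through that of \<Psi>, the difference between
  \<open>K\<close> and \<open>G\<close> after \<Psi> has derivative 0, and composing with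
  \<open>u\<close> preserves this. It takes the place of the inverse function theorem, with
  \<open>u\<close> built from the inverse of \<open>Psi\<close>.\<close>

lemma has_derivative_via:
  fixes K :: "'b::real_normed_vector \<Rightarrow> 'c::real_normed_vector"
    and \<Psi> :: "'b \<Rightarrow> 'd::real_normed_vector" and u :: "'a::real_normed_vector \<Rightarrow> 'b"
  assumes K: "(K has_derivative (\<lambda>v. G (\<Psi>' v))) (at (u a))" and \<Psi>: "(\<Psi> has_derivative \<Psi>') (at (u a))"
    and G: "bounded_linear G" and J: "((\<lambda>a. \<Psi> (u a)) has_derivative J) (at a)"
    and lip: "\<forall>\<^sub>F a' in at a. norm (u a' - u a) \<le> C * norm (a' - a)"
  shows "((\<lambda>a. K (u a)) has_derivative (\<lambda>h. G (J h))) (at a)"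
proof -
  define e where "e w = K w - G (\<Psi> w)" for w
  have "(e has_derivative (\<lambda>v. G (\<Psi>' v) - G (\<Psi>' v))) (at (u a))"
    unfolding e_def
    by (intro has_derivative_diff K has_derivative_compose[OF \<Psi> bounded_linear_imp_has_derivative[OF G]])
  then have e: "(e has_derivative (\<lambda>v. 0)) (at (u a))" by simp
  define c where "c = \<bar>C\<bar> + 1"
  have c: "0 < c" "\<bar>C\<bar> \<le> c" by (auto simp: c_def)
  have "((\<lambda>a. e (u a)) has_derivative (\<lambda>h. 0)) (at a)"
    unfolding has_derivative_within_alt
  proof (intro conjI allI impI)
    fix r :: real assume r: "0 < r"
    then have "0 < r / c" using c by simp
    then obtain d where d: "0 < d" "\<And>w. norm (w - u a) < d \<Longrightarrow> norm (e w - e (u a) - 0) \<le> r / c * norm (w - u a)"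
      using e unfolding has_derivative_within_alt by blast
    obtain d' where d': "0 < d'" "\<And>a'. a' \<noteq> a \<Longrightarrow> dist a' a < d' \<Longrightarrow> norm (u a' - u a) \<le> C * norm (a' - a)"
      using lip unfolding eventually_at by blast
    have "norm (e (u y) - e (u a) - 0) \<le> r * norm (y - a)" if y: "norm (y - a) < min d' (d / c)" for y
    proof (cases "y = a")
      case False
      have 1: "norm (u y - u a) \<le> c * norm (y - a)"
      proof -
        have "norm (u y - u a) \<le> C * norm (y - a)" using d'(2)[OF False] y by (simp add: dist_norm)
        also have "\<dots> \<le> c * norm (y - a)" using c(2) by (intro mult_right_mono) auto
        finally show ?thesis .
      qed
      also have "\<dots> < d" using y c(1) by (simp add: field_simps)
      finally have "norm (e (u y) - e (u a) - 0) \<le> r / c * norm (u y - u a)" by (rule d(2))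
      also have "\<dots> \<le> r / c * (c * norm (y - a))" using 1 r c by (intro mult_left_mono) auto
      finally show ?thesis using c by simp
    qed simp
    then show "\<exists>d>0. \<forall>y\<in>UNIV. norm (y - a) < d \<longrightarrow> norm (e (u y) - e (u a) - 0) \<le> r * norm (y - a)"
      using d(1) d'(1) c(1) by (intro exI[of _ "min d' (d / c)"]) auto
  qed simp
  moreover have "((\<lambda>a. G (\<Psi> (u a))) has_derivative (\<lambda>h. G (J h))) (at a)"
    by (rule has_derivative_compose[OF J bounded_linear_imp_has_derivative[OF G]])
  ultimately have "((\<lambda>a. e (u a) + G (\<Psi> (u a))) has_derivative (\<lambda>h. 0 + G (J h))) (at a)"
    by (rule has_derivative_add)
  then show ?thesis by (simp add: e_def)
qed

lemma has_derivative_lip_at: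
  assumes "(u has_derivative u') (at a)"
  obtains C where "\<forall>\<^sub>F y in at a. norm (u y - u a) \<le> C * norm (y - a)"
proof -
  obtain K where K: "\<And>h. norm (u' h) \<le> norm h * K"
    using bounded_linear.bounded[OF has_derivative_bounded_linear[OF assms]] by blast
  obtain d where d: "0 < d" "\<And>y. norm (y - a) < d \<Longrightarrow> norm (u y - u a - u' (y - a)) \<le> 1 * norm (y - a)"
    using assms unfolding has_derivative_within_alt by (metis UNIV_I zero_less_one)
  have "norm (u y - u a) \<le> (1 + K) * norm (y - a)" if "norm (y - a) < d" for y
    using d(2)[OF that] K[of "y - a"] norm_triangle_sub[of "u y - u a" "u' (y - a)"]
    by (simp add: algebra_simps)
  then have "\<forall>\<^sub>F y in at a. norm (u y - u a) \<le> (1 + K) * norm (y - a)"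
    using d(1) by (auto simp: eventually_at dist_norm)
  then show ?thesis by (rule that)
qed

lemma alpha_eq: "alpha p v = snd (snd v) - fst (snd p) \<bullet> fst v"
  by (cases p; cases v) simp

text \<open>Passage to the mixed coordinates (x, Y, z) on which the generating function lives;
  \<open>KK\<close> is that function in the original coordinates.\<close>

definition Psi :: "('n::finite pt \<Rightarrow> 'n pt) \<Rightarrow> 'n pt \<Rightarrow> 'n pt" where
  "Psi \<sigma> q = (fst q, fst (snd (\<sigma> q)), snd (snd q))"

definition KK :: "('n::finite pt \<Rightarrow> 'n pt) \<Rightarrow> 'n pt \<Rightarrow> real" where
  "KK \<sigma> q = snd (snd (\<sigma> q)) - snd (snd q) - fst (snd (\<sigma> q)) \<bullet> (fst (\<sigma> q) - fst q)"

definition gfun :: "('n::finite pt \<Rightarrow> 'n pt) \<Rightarrow> 'n pt \<Rightarrow> real" where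
  "gfun \<sigma> a = KK \<sigma> (inv (Psi \<sigma>) a)"

text \<open>Phrased through the displacement, because the bound passes to \<open>Psi\<close> and
  makes it bijective by contraction, with a 2-Lipschitz inverse.\<close>

definition near_id :: "('n::finite pt \<Rightarrow> 'n pt) \<Rightarrow> bool" where
  "near_id \<sigma> \<longleftrightarrow> (\<forall>q q'. norm ((\<sigma> q' - q') - (\<sigma> q - q)) \<le> 1 / 2 * norm (q' - q))"

lemma Psi_near:
  assumes "near_id \<sigma>"
  shows "norm ((Psi \<sigma> q' - q') - (Psi \<sigma> q - q)) \<le> 1 / 2 * norm (q' - q)"
proof -
  define w where "w = (\<sigma> q' - q') - (\<sigma> q - q)"
  have "(Psi \<sigma> q' - q') - (Psi \<sigma> q - q) = (0, fst (snd w), 0)"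
    by (simp add: Psi_def w_def prod_eq_iff)
  moreover have "norm (0 :: real^'n, fst (snd w), 0 :: real) \<le> norm w"
  proof -
    have "norm (0 :: real^'n, fst (snd w), 0 :: real) = norm (fst (snd w))"
      by (simp add: norm_Pair)
    also have "\<dots> \<le> norm (snd w)" by (metis norm_fst_le prod.collapse)
    also have "\<dots> \<le> norm w" by (metis norm_snd_le prod.collapse)
    finally show ?thesis .
  qed
  moreover have "norm w \<le> 1 / 2 * norm (q' - q)"
    using assms unfolding near_id_def w_def by blast
  ultimately show ?thesis by simp
qed

lemma Psi_expand:
  assumes "near_id \<sigma>"
  shows "norm (q' - q) \<le> 2 * norm (Psi \<sigma> q' - Psi \<sigma> q)"
proof -
  have "q' - q = (Psi \<sigma> q' - Psi \<sigma> q) - ((Psi \<sigma> q' - q') - (Psi \<sigma> q - q))" by simp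
  then have "norm (q' - q) \<le> norm (Psi \<sigma> q' - Psi \<sigma> q) + norm ((Psi \<sigma> q' - q') - (Psi \<sigma> q - q))"
    using norm_triangle_ineq4 by metis
  then show ?thesis using Psi_near[OF assms, of q' q] by simp
qed

lemma Psi_bij:
  assumes "near_id \<sigma>"
  shows "bij (Psi \<sigma>)"
proof (rule bijI)
  show "inj (Psi \<sigma>)"
  proof (rule injI)
    fix q q' assume "Psi \<sigma> q = Psi \<sigma> q'"
    then show "q = q'" using Psi_expand[OF assms, of q q'] by simp
  qed
  show "surj (Psi \<sigma>)"
    unfolding surj_def
  proof
    fix a
    \<comment> \<open>Preimages of \<open>a\<close> under \<open>Psi\<close> are the fixed points of
      this contraction.\<close>
    have "\<exists>!q\<in>UNIV. a - (Psi \<sigma> q - q) = q"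
    proof (rule Banach_fix[where c = "1/2"])
      show "dist (a - (Psi \<sigma> q' - q')) (a - (Psi \<sigma> q - q)) \<le> 1 / 2 * dist q' q" for q' q
        using Psi_near[OF assms, of q q'] by (simp add: dist_norm norm_minus_commute algebra_simps)
    qed (auto simp: complete_UNIV)
    then show "\<exists>q. a = Psi \<sigma> q" by (auto simp: algebra_simps)
  qed
qed

lemma Psi_inv:
  assumes "near_id \<sigma>"
  shows "Psi \<sigma> (inv (Psi \<sigma>) a) = a" "inv (Psi \<sigma>) (Psi \<sigma> q) = q"
    "norm (inv (Psi \<sigma>) a' - inv (Psi \<sigma>) a) \<le> 2 * norm (a' - a)"
proof -
  show 1: "Psi \<sigma> (inv (Psi \<sigma>) a) = a" for a
    using Psi_bij[OF assms] by (simp add: bij_is_surj surj_f_inv_f)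
  show "inv (Psi \<sigma>) (Psi \<sigma> q) = q"
    using Psi_bij[OF assms] by (simp add: bij_is_inj)
  show "norm (inv (Psi \<sigma>) a' - inv (Psi \<sigma>) a) \<le> 2 * norm (a' - a)"
    using Psi_expand[OF assms, of "inv (Psi \<sigma>) a'" "inv (Psi \<sigma>) a"] by (simp add: 1)
qed

locale small_contact =
  fixes \<sigma> :: "'n::finite pt \<Rightarrow> 'n pt" and \<sigma>' and E :: "'n pt \<Rightarrow> real" and R :: real
  assumes der: "\<And>q. (\<sigma> has_derivative \<sigma>' q) (at q)"
    and Epos: "\<And>q. 0 < E q" and contE: "continuous_on UNIV E"
    and conf: "\<And>q v. alpha (\<sigma> q) (\<sigma>' q v) = E q * alpha q v"
    and per: "\<And>x y z. \<sigma> (x, y, z + 1) = \<sigma> (x, y, z) + (0, 0, 1)"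
    and out: "\<And>x y z. R < norm x \<or> R < norm y \<Longrightarrow> \<sigma> (x, y, z) = (x, y, z)"
    and near: "near_id \<sigma>"
begin

text \<open>The partial derivatives forced by the equations of \<open>gen_by\<close>: Y - E y, x - X
  and E - 1, taken at the preimage of \<open>a\<close>.\<close>

definition gr :: "'n pt \<Rightarrow> 'n pt" where
  "gr a = (let q = inv (Psi \<sigma>) a in
     (fst (snd (\<sigma> q)) - E q *\<^sub>R fst (snd q), fst q - fst (\<sigma> q), E q - 1))"

lemma inv_Psi_cases:
  obtains y where "inv (Psi \<sigma>) (x, P, z) = (x, y, z)" "fst (snd (\<sigma> (x, y, z))) = P"
proof -
  have "Psi \<sigma> (inv (Psi \<sigma>) (x, P, z)) = (x, P, z)" by (rule Psi_inv(1)[OF near])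
  then show ?thesis using that by (cases "inv (Psi \<sigma>) (x, P, z)") (auto simp: Psi_def)
qed

lemma cont_sigma: "continuous_on UNIV \<sigma>"
  by (rule continuous_at_imp_continuous_on) (blast intro: has_derivative_continuous der)

lemma cont_inv: "continuous_on UNIV (inv (Psi \<sigma>))"
  by (rule lipschitz_on_continuous_on[of 2])
    (auto simp: lipschitz_on_def dist_norm Psi_inv(3)[OF near])

lemma gfun_deriv: "(gfun \<sigma> has_derivative (\<lambda>v. gr a \<bullet> v)) (at a)"
proof -
  define q where "q = inv (Psi \<sigma>) a"
  define P' where "P' v = (fst v, fst (snd (\<sigma>' q v)), snd (snd v))" for v
  have P: "(Psi \<sigma> has_derivative P') (at q)"
    unfolding Psi_def P'_def
    by (intro has_derivative_Pair has_derivative_fst has_derivative_snd has_derivative_ident der)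
  have "(KK \<sigma> has_derivative (\<lambda>v. snd (snd (\<sigma>' q v)) - snd (snd v) -
      (fst (snd (\<sigma> q)) \<bullet> (fst (\<sigma>' q v) - fst v) + fst (snd (\<sigma>' q v)) \<bullet> (fst (\<sigma> q) - fst q)))) (at q)"
    unfolding KK_def
    by (intro has_derivative_diff has_derivative_inner has_derivative_fst has_derivative_snd
        has_derivative_ident der)
  \<comment> \<open>The contact condition eliminates dZ - Y dX, and only dx, dY and dz survive, the
    differentials of the mixed coordinates.\<close>
  moreover have "snd (snd (\<sigma>' q v)) - snd (snd v) -
      (fst (snd (\<sigma> q)) \<bullet> (fst (\<sigma>' q v) - fst v) + fst (snd (\<sigma>' q v)) \<bullet> (fst (\<sigma> q) - fst q)) = gr a \<bullet> P' v" for v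
    using conf[of q v]
    by (simp add: alpha_eq gr_def Let_def P'_def inner_prod_def q_def[symmetric] inner_commute algebra_simps)
  ultimately have K: "(KK \<sigma> has_derivative (\<lambda>v. gr a \<bullet> P' v)) (at q)" by simp
  have "((\<lambda>a. KK \<sigma> (inv (Psi \<sigma>) a)) has_derivative (\<lambda>h. gr a \<bullet> h)) (at a)"
  proof (rule has_derivative_via[where \<Psi> = "Psi \<sigma>" and \<Psi>' = P' and C = 2])
    show "((\<lambda>a. Psi \<sigma> (inv (Psi \<sigma>) a)) has_derivative (\<lambda>h. h)) (at a)"
      by (simp add: Psi_inv(1)[OF near])
    show "\<forall>\<^sub>F a' in at a. norm (inv (Psi \<sigma>) a' - inv (Psi \<sigma>) a) \<le> 2 * norm (a' - a)"
      by (rule always_eventually) (simp add: Psi_inv(3)[OF near])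
  qed (use K P in \<open>auto simp: q_def bounded_linear_inner_right\<close>)
  then show ?thesis by (simp add: gfun_def[abs_def])
qed

lemma cont_gr: "continuous_on UNIV gr"
proof -
  have "continuous_on UNIV (\<lambda>q. (fst (snd (\<sigma> q)) - E q *\<^sub>R fst (snd q), fst q - fst (\<sigma> q), E q - 1))"
    by (intro continuous_intros cont_sigma contE)
  from continuous_on_compose2[OF this cont_inv] show ?thesis by (simp add: gr_def[abs_def] Let_def)
qed

lemma small_genfun:
  assumes nonneg: "\<And>a. 0 \<le> gfun \<sigma> a"
  shows "genfun R (gfun \<sigma>) gr" "gen_by \<sigma> E (gfun \<sigma>) gr"
proof -
  have p: "gfun \<sigma> (x, P, z + 1) = gfun \<sigma> (x, P, z)" for x P z
  proof -
    obtain y where y: "inv (Psi \<sigma>) (x, P, z) = (x, y, z)" "fst (snd (\<sigma> (x, y, z))) = P"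
      by (rule inv_Psi_cases)
    have "Psi \<sigma> (x, y, z + 1) = (x, P, z + 1)" using y(2) by (simp add: Psi_def per)
    then have "inv (Psi \<sigma>) (x, P, z + 1) = (x, y, z + 1)" using Psi_inv(2)[OF near] by metis
    then show ?thesis using y by (simp add: gfun_def KK_def per)
  qed
  have o: "gfun \<sigma> (x, P, z) = 0" if "R < norm x \<or> R < norm P" for x P z
  proof -
    have "Psi \<sigma> (x, P, z) = (x, P, z)" using out[OF that] by (simp add: Psi_def)
    then have "inv (Psi \<sigma>) (x, P, z) = (x, P, z)" using Psi_inv(2)[OF near] by metis
    then show ?thesis using out[OF that] by (simp add: gfun_def KK_def)
  qed
  have "0 < 1 + snd (snd (gr a))" for a using Epos by (simp add: gr_def Let_def)
  then show "genfun R (gfun \<sigma>) gr"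
    unfolding genfun_def using gfun_deriv cont_gr nonneg p o by blast
  show "gen_by \<sigma> E (gfun \<sigma>) gr"
    unfolding gen_by_def
  proof (intro allI impI)
    fix x y0 z P assume P: "P = (1 + snd (snd (gr (x, P, z)))) *\<^sub>R y0 + fst (gr (x, P, z))"
    obtain y where y: "inv (Psi \<sigma>) (x, P, z) = (x, y, z)" "fst (snd (\<sigma> (x, y, z))) = P"
      by (rule inv_Psi_cases)
    have g: "gr (x, P, z) = (P - E (x, y, z) *\<^sub>R y, x - fst (\<sigma> (x, y, z)), E (x, y, z) - 1)"
      unfolding gr_def y(1) Let_def y(2) by simp
    have "E (x, y, z) *\<^sub>R y0 = E (x, y, z) *\<^sub>R y" using P unfolding g by simp
    then have y0: "y0 = y" using Epos[of "(x, y, z)"] by simp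
    show "\<sigma> (x, y0, z) = (x - fst (snd (gr (x, P, z))), P,
        z + gfun \<sigma> (x, P, z) - P \<bullet> fst (snd (gr (x, P, z)))) \<and> E (x, y0, z) = 1 + snd (snd (gr (x, P, z)))"
      using y(2) unfolding g y0 gfun_def y(1) KK_def
      by (cases "\<sigma> (x, y, z)") (simp add: inner_diff_right)
  qed
qed

end

text \<open>The derivative of the generating function along a contact isotopy, at a fixed value of its
  argument, is the contact Hamiltonian.\<close>

lemma gfun_nonneg_of_isotopy:
  fixes S :: "real \<Rightarrow> 'n::finite pt \<Rightarrow> 'n pt"
  assumes der: "\<And>t q. ((\<lambda>w. S (fst w) (snd w)) has_derivative S' t q) (at (t, q))"
    and st: "s \<le> t1" and near: "\<And>t. t \<in> {s..t1} \<Longrightarrow> near_id (S t)"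
    and conf: "\<And>t q v. t \<in> {s..t1} \<Longrightarrow> alpha (S t q) (S' t q (0, v)) = E t q * alpha q v"
    and time: "\<And>t q. t \<in> {s..t1} \<Longrightarrow> 0 \<le> alpha (S t q) (S' t q (1, 0))"
    and id: "S s = id"
  shows "0 \<le> gfun (S t1) a"
proof (cases "s = t1")
  case True
  then show ?thesis using id by (simp add: gfun_def KK_def)
next
  case False
  then have st: "s < t1" using st by simp
  \<comment> \<open>The point with mixed coordinates \<open>a\<close> at time \<open>t\<close>. It
    moves with time, and a Lipschitz estimate is what is known about its motion.\<close>
  define \<theta> where "\<theta> t = inv (Psi (S t)) a" for t
  have P\<theta>: "Psi (S t) (\<theta> t) = a" if "t \<in> {s..t1}" for t
    unfolding \<theta>_def by (rule Psi_inv(1)[OF near[OF that]])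
  have lip: "norm (\<theta> t' - \<theta> t) \<le> 2 * norm (Psi (S t') (\<theta> t) - Psi (S t) (\<theta> t))"
    if "t \<in> {s..t1}" "t' \<in> {s..t1}" for t t'
  proof -
    have "norm (\<theta> t' - inv (Psi (S t')) (Psi (S t') (\<theta> t))) \<le> 2 * norm (a - Psi (S t') (\<theta> t))"
      unfolding \<theta>_def[of t'] by (rule Psi_inv(3)[OF near[OF that(2)]])
    then show ?thesis
      using Psi_inv(2)[OF near[OF that(2)]] P\<theta>[OF that(1)] by (simp add: norm_minus_commute)
  qed
  have Sd: "((\<lambda>t. S t q) has_derivative (\<lambda>\<tau>. S' t q (\<tau>, 0))) (at t)" for t q
  proof -
    have "((\<lambda>t. (t, q)) has_derivative (\<lambda>\<tau>. (\<tau>, 0))) (at t)"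
      by (auto intro!: derivative_eq_intros)
    from has_derivative_compose[OF this, of "\<lambda>w. S (fst w) (snd w)" "S' t q"] der[of t q]
    show ?thesis by simp
  qed
  have Pd: "((\<lambda>t. Psi (S t) q) has_derivative (\<lambda>\<tau>. (0, fst (snd (S' t q (\<tau>, 0))), 0))) (at t)" for t q
    unfolding Psi_def
    by (intro has_derivative_Pair has_derivative_const has_derivative_fst has_derivative_snd Sd)
  have \<theta>c: "continuous_on {s..t1} \<theta>"
    unfolding continuous_on_def
  proof
    fix t assume t: "t \<in> {s..t1}"
    have "((\<lambda>t'. Psi (S t') (\<theta> t)) \<longlongrightarrow> Psi (S t) (\<theta> t)) (at t within {s..t1})"
      using has_derivative_continuous[OF Pd[of "\<theta> t" t]] unfolding continuous_at
      by (rule tendsto_within_subset) simp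
    then have "((\<lambda>t'. 2 * norm (Psi (S t') (\<theta> t) - Psi (S t) (\<theta> t))) \<longlongrightarrow> 2 * norm (Psi (S t) (\<theta> t) - Psi (S t) (\<theta> t)))
       (at t within {s..t1})" by (intro tendsto_intros)
    then have z: "((\<lambda>t'. 2 * norm (Psi (S t') (\<theta> t) - Psi (S t) (\<theta> t))) \<longlongrightarrow> 0) (at t within {s..t1})" by simp
    have "((\<lambda>t'. \<theta> t' - \<theta> t) \<longlongrightarrow> 0) (at t within {s..t1})"
      by (rule Lim_null_comparison[OF _ z])
        (use lip[OF t] in \<open>auto simp: eventually_at intro!: exI[of _ 1]\<close>)
    then show "(\<theta> \<longlongrightarrow> \<theta> t) (at t within {s..t1})" by (simp add: LIM_zero_iff)
  qed
  define Kh where "Kh w = KK (S (fst w)) (snd w)" for w :: "real \<times> 'n pt"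
  have Khd: "(Kh has_derivative (\<lambda>w. snd (snd (S' t q w)) - snd (snd (snd w)) -
      (fst (snd (S t q)) \<bullet> (fst (S' t q w) - fst (snd w)) + fst (snd (S' t q w)) \<bullet> (fst (S t q) - fst q)))) (at (t, q))" for t q
  proof -
    note d = der[of t q]
    note i = has_derivative_snd[OF has_derivative_ident]
    from has_derivative_diff[OF has_derivative_diff[OF has_derivative_snd[OF has_derivative_snd[OF d]]
        has_derivative_snd[OF has_derivative_snd[OF i]]]
      has_derivative_inner[OF has_derivative_fst[OF has_derivative_snd[OF d]]
        has_derivative_diff[OF has_derivative_fst[OF d] has_derivative_fst[OF i]]]]
    show ?thesis by (simp add: Kh_def[abs_def] KK_def)
  qed
  have Khc: "continuous_on UNIV Kh"
    by (rule continuous_at_imp_continuous_on) (use Khd in \<open>force intro: has_derivative_continuous\<close>)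
  have "gfun (S s) a \<le> gfun (S t1) a"
  proof (rule DERIV_nonneg_imp_increasing_open[OF less_imp_le[OF st], of "\<lambda>t. gfun (S t) a"])
    have "continuous_on {s..t1} (\<lambda>t. Kh (t, \<theta> t))"
      by (rule continuous_on_compose2[OF Khc]) (auto intro!: continuous_intros \<theta>c)
    then show "continuous_on {s..t1} (\<lambda>t. gfun (S t) a)"
      by (simp add: Kh_def gfun_def \<theta>_def)
  next
    fix t assume t: "s < t" "t < t1"
    then have tI: "t \<in> {s..t1}" by simp
    define q where "q = \<theta> t"
    define H where "H = alpha (S t q) (S' t q (1, 0))"
    define gg where "gg = (fst (snd (S t q)) - E t q *\<^sub>R fst (snd q), fst q - fst (S t q), E t q - 1)"
    \<comment> \<open>The differential of \<open>Kh\<close> in the coordinates (t, x, Y, z): the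
      Hamiltonian in the time direction and the gradient of the generating function in the
      others.\<close>
    define G where "G w = H * fst w + gg \<bullet> snd w" for w :: "real \<times> 'n pt"
    define P' where "P' w = (fst w, fst (snd w), fst (snd (S' t q w)), snd (snd (snd w)))" for w :: "real \<times> 'n pt"
    have lin: "S' t q w = fst w *\<^sub>R S' t q (1, 0) + S' t q (0, snd w)" for w
    proof -
      interpret bounded_linear "S' t q" by (rule has_derivative_bounded_linear[OF der])
      have "w = fst w *\<^sub>R (1, 0) + (0, snd w)" by (simp add: prod_eq_iff)
      then show ?thesis using add scaleR by metis
    qed
    have "G (P' w) = snd (snd (S' t q w)) - snd (snd (snd w)) -
      (fst (snd (S t q)) \<bullet> (fst (S' t q w) - fst (snd w)) + fst (snd (S' t q w)) \<bullet> (fst (S t q) - fst q))" for w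
    proof -
      have "alpha (S t q) (S' t q w) = fst w * H + E t q * alpha q (snd w)"
        unfolding lin[of w] conf[OF tI, symmetric] H_def
        by (simp add: alpha_eq algebra_simps)
      then show ?thesis
        by (simp add: G_def P'_def gg_def alpha_eq inner_prod_def inner_commute algebra_simps)
    qed
    then have K: "(Kh has_derivative (\<lambda>w. G (P' w))) (at (t, \<theta> t))"
      using Khd[of t q] by (simp add: q_def)
    have P: "((\<lambda>w. (fst w, Psi (S (fst w)) (snd w))) has_derivative P') (at (t, \<theta> t))"
      unfolding Psi_def P'_def q_def
      by (intro has_derivative_Pair has_derivative_fst has_derivative_snd has_derivative_ident der)
    have G: "bounded_linear G"
      unfolding G_def
      by (intro bounded_linear_add bounded_linear_const_mult bounded_linear_fst
          bounded_linear_compose[OF bounded_linear_inner_right bounded_linear_snd])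
    have ev: "\<forall>\<^sub>F t' in at t. t' \<in> {s<..<t1}"
      using t by (intro eventually_at_in_open') auto
    have J: "((\<lambda>t. (t, Psi (S t) (\<theta> t))) has_derivative (\<lambda>\<tau>. (\<tau>, 0))) (at t)"
    proof (rule has_derivative_transform_within_open[of "\<lambda>t. (t, a)" _ t UNIV "{s<..<t1}"])
      show "((\<lambda>t. (t, a)) has_derivative (\<lambda>\<tau>. (\<tau>, 0))) (at t)" by (auto intro!: derivative_eq_intros)
    qed (use t P\<theta> in auto)
    obtain C where C: "\<forall>\<^sub>F t' in at t. norm (Psi (S t') q - Psi (S t) q) \<le> C * norm (t' - t)"
      by (rule has_derivative_lip_at[OF Pd])
    have L: "\<forall>\<^sub>F t' in at t. norm ((t', \<theta> t') - (t, \<theta> t)) \<le> (1 + 2 * C) * norm (t' - t)"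
      using C ev
    proof eventually_elim
      case (elim t')
      have "norm ((t', \<theta> t') - (t, \<theta> t)) \<le> norm (t' - t) + norm (\<theta> t' - \<theta> t)"
        using norm_triangle_ineq[of "(t' - t, 0)" "(0, \<theta> t' - \<theta> t)"] by (simp add: norm_Pair)
      also have "norm (\<theta> t' - \<theta> t) \<le> 2 * (C * norm (t' - t))"
        using lip[OF tI, of t'] elim by (simp add: q_def)
      finally show ?case by (simp add: algebra_simps)
    qed
    have "((\<lambda>t. Kh (t, \<theta> t)) has_derivative (\<lambda>\<tau>. G (\<tau>, 0))) (at t)"
      by (rule has_derivative_via[where \<Psi> = "\<lambda>w. (fst w, Psi (S (fst w)) (snd w))" and \<Psi>' = P'
            and u = "\<lambda>t. (t, \<theta> t)" and C = "1 + 2 * C" and J = "\<lambda>\<tau>. (\<tau>, 0)"])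
        (use K P G J L in auto)
    then have "((\<lambda>t. gfun (S t) a) has_real_derivative H) (at t)"
      by (simp add: Kh_def gfun_def \<theta>_def G_def has_field_derivative_def)
    moreover have "0 \<le> H" unfolding H_def by (rule time[OF tI])
    ultimately show "\<exists>y. ((\<lambda>t. gfun (S t) a) has_real_derivative y) (at t) \<and> 0 \<le> y" by blast
  qed
  moreover have "gfun (S s) a = 0" using id by (simp add: gfun_def KK_def)
  ultimately show ?thesis by simp
qed

section \<open>Fragmenting a positive contact isotopy\<close>

lemma smooth_has_derivative: "smooth f \<Longrightarrow> (f has_derivative frechet_derivative f (at x)) (at x)"
  by (metis frechet_derivative_works smooth.cases)

lemma smooth_continuous: "smooth f \<Longrightarrow> continuous_on UNIV f"
  by (metis smooth.cases)

text \<open>Smoothness gives continuity for each fixed direction; expanding the direction in a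
  finite basis makes it joint.\<close>

lemma smooth_derivative_continuous:
  fixes f :: "'a::euclidean_space \<Rightarrow> 'b::real_normed_vector"
  assumes "smooth f"
  shows "continuous_on UNIV (\<lambda>w. frechet_derivative f (at (fst w)) (snd w))"
proof -
  have c: "continuous_on UNIV (\<lambda>x. frechet_derivative f (at x) v)" for v
    using assms by (metis smooth.cases)
  have "frechet_derivative f (at x) v = (\<Sum>b\<in>Basis. (v \<bullet> b) *\<^sub>R frechet_derivative f (at x) b)" for x v
  proof -
    interpret bounded_linear "frechet_derivative f (at x)"
      by (rule has_derivative_bounded_linear[OF smooth_has_derivative[OF assms]])
    have "frechet_derivative f (at x) (\<Sum>b\<in>Basis. (v \<bullet> b) *\<^sub>R b) = (\<Sum>b\<in>Basis. (v \<bullet> b) *\<^sub>R frechet_derivative f (at x) b)"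
      by (simp add: sum scaleR)
    then show ?thesis by (simp add: euclidean_representation)
  qed
  then have "(\<lambda>w. frechet_derivative f (at (fst w)) (snd w)) =
      (\<lambda>w. \<Sum>b\<in>Basis. (snd w \<bullet> b) *\<^sub>R frechet_derivative f (at (fst w)) b)"
    by (intro ext)
  moreover have "continuous_on UNIV (\<lambda>w::'a \<times> 'a. \<Sum>b\<in>Basis. (snd w \<bullet> b) *\<^sub>R frechet_derivative f (at (fst w)) b)"
    by (intro continuous_on_sum continuous_on_scaleR continuous_on_inner continuous_on_snd continuous_on_id
        continuous_on_const continuous_on_compose2[OF c continuous_on_fst[OF continuous_on_id]]) auto
  ultimately show ?thesis by (simp only:)
qed

locale isotopy =
  fixes \<Phi> :: "real \<Rightarrow> 'n::finite pt \<Rightarrow> 'n pt" and R :: real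
  assumes sm: "smooth (\<lambda>w. \<Phi> (fst w) (snd w))" and R: "0 \<le> R"
    and cont: "\<And>t. t \<in> {0..1} \<Longrightarrow> contactomorphism (\<Phi> t)"
    and out: "\<And>t x y z. t \<in> {0..1} \<Longrightarrow> R < norm x \<or> R < norm y \<Longrightarrow> \<Phi> t (x, y, z) = (x, y, z)"
    and start: "\<Phi> 0 = id"
begin

definition DD :: "real \<Rightarrow> 'n pt \<Rightarrow> real \<times> 'n pt \<Rightarrow> 'n pt" where
  "DD t p = frechet_derivative (\<lambda>w. \<Phi> (fst w) (snd w)) (at (t, p))"

definition iv :: "real \<Rightarrow> 'n pt \<Rightarrow> 'n pt" where "iv t = inv (\<Phi> t)"

definition Di :: "real \<Rightarrow> 'n pt \<Rightarrow> 'n pt \<Rightarrow> 'n pt" where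
  "Di t q = frechet_derivative (iv t) (at q)"

text \<open>\<open>alpha\<close> is 1 on the Reeb direction, so this value is the conformal
  factor.\<close>

definition ec :: "real \<Rightarrow> 'n pt \<Rightarrow> real" where
  "ec t p = alpha (\<Phi> t p) (DD t p (0, 0, 0, 1))"

lemma joint_deriv: "((\<lambda>w. \<Phi> (fst w) (snd w)) has_derivative DD t p) (at (t, p))"
  unfolding DD_def by (rule smooth_has_derivative[OF sm])

lemma DD_linear: "bounded_linear (DD t p)"
  by (rule has_derivative_bounded_linear[OF joint_deriv])

lemma space_deriv: "(\<Phi> t has_derivative (\<lambda>v. DD t p (0, v))) (at p)"
proof -
  have "((\<lambda>p. (t, p)) has_derivative (\<lambda>v. (0, v))) (at p)" by (auto intro!: derivative_eq_intros)
  from has_derivative_compose[OF this, of "\<lambda>w. \<Phi> (fst w) (snd w)" "DD t p"] joint_deriv[of t p]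
  show ?thesis by simp
qed

lemma time_deriv: "((\<lambda>t. \<Phi> t p) has_vector_derivative DD t p (1, 0)) (at t)"
proof -
  interpret bounded_linear "DD t p" by (rule DD_linear)
  have "((\<lambda>t. (t, p)) has_derivative (\<lambda>\<tau>. (\<tau>, 0))) (at t)" by (auto intro!: derivative_eq_intros)
  from has_derivative_compose[OF this, of "\<lambda>w. \<Phi> (fst w) (snd w)" "DD t p"] joint_deriv[of t p]
  have "((\<lambda>t. \<Phi> t p) has_derivative (\<lambda>\<tau>. DD t p (\<tau>, 0))) (at t)" by simp
  moreover have "(\<lambda>\<tau>. DD t p (\<tau>, 0)) = (\<lambda>\<tau>. \<tau> *\<^sub>R DD t p (1, 0))"
    by (intro ext) (simp only: scaleR[symmetric] scaleR_Pair, simp)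
  ultimately show ?thesis by (simp only: has_vector_derivative_def)
qed

lemma cont_Phi: "continuous_on UNIV (\<lambda>w. \<Phi> (fst w) (snd w))"
  by (rule smooth_continuous[OF sm])

lemma cont_DD: "continuous_on UNIV (\<lambda>w. DD (fst (fst w)) (snd (fst w)) (snd w))"
  using smooth_derivative_continuous[OF sm] by (simp add: DD_def)

lemma bij: "t \<in> {0..1} \<Longrightarrow> bij (\<Phi> t)"
  using cont by (auto simp: contactomorphism_def)

lemma iv1: "t \<in> {0..1} \<Longrightarrow> \<Phi> t (iv t q) = q"
  and iv2: "t \<in> {0..1} \<Longrightarrow> iv t (\<Phi> t q) = q"
  using bij[of t] by (simp_all add: iv_def bij_is_surj surj_f_inv_f bij_is_inj)

lemma iv_deriv: "t \<in> {0..1} \<Longrightarrow> (iv t has_derivative Di t q) (at q)"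
  unfolding Di_def using cont[of t] smooth_has_derivative
  by (auto simp: contactomorphism_def iv_def)

lemma cont_iv: "t \<in> {0..1} \<Longrightarrow> continuous_on UNIV (iv t)"
  using cont[of t] smooth_continuous by (auto simp: contactomorphism_def iv_def)

lemma DD_Di: "t \<in> {0..1} \<Longrightarrow> DD t (iv t q) (0, Di t q v) = v"
proof -
  assume t: "t \<in> {0..1}"
  have "((\<lambda>q. \<Phi> t (iv t q)) has_derivative (\<lambda>v. DD t (iv t q) (0, Di t q v))) (at q)"
    by (rule has_derivative_compose[OF iv_deriv[OF t] space_deriv])
  moreover have "((\<lambda>q. \<Phi> t (iv t q)) has_derivative (\<lambda>v. v)) (at q)" by (simp add: iv1[OF t])
  ultimately show ?thesis using has_derivative_unique by metis
qed

lemma Di_DD: "t \<in> {0..1} \<Longrightarrow> Di t (\<Phi> t p) (DD t p (0, v)) = v"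
proof -
  assume t: "t \<in> {0..1}"
  have "((\<lambda>p. iv t (\<Phi> t p)) has_derivative (\<lambda>v. Di t (\<Phi> t p) (DD t p (0, v)))) (at p)"
    by (rule has_derivative_compose[OF space_deriv iv_deriv[OF t]])
  moreover have "((\<lambda>p. iv t (\<Phi> t p)) has_derivative (\<lambda>v. v)) (at p)" by (simp add: iv2[OF t])
  ultimately show ?thesis using has_derivative_unique by metis
qed

lemma conf:
  assumes t: "t \<in> {0..1}"
  shows "alpha (\<Phi> t p) (DD t p (0, v)) = ec t p * alpha p v" "0 < ec t p"
proof -
  have fd: "frechet_derivative (\<Phi> t) (at p) = (\<lambda>v. DD t p (0, v))"
    by (rule frechet_derivative_at[OF space_deriv, symmetric])
  obtain g where g: "\<And>p v. alpha (\<Phi> t p) (frechet_derivative (\<Phi> t) (at p) v) = exp (g p) * alpha p v"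
    using cont[OF t] unfolding contactomorphism_def by blast
  have e: "ec t p = exp (g p)"
    using g[of p "(0, 0, 1)"] unfolding fd ec_def by (simp add: alpha_eq)
  show "alpha (\<Phi> t p) (DD t p (0, v)) = ec t p * alpha p v"
    using g[of p v] unfolding fd e .
  show "0 < ec t p" by (simp add: e)
qed

lemma per: "t \<in> {0..1} \<Longrightarrow> \<Phi> t (x, y, z + 1) = \<Phi> t (x, y, z) + (0, 0, 1)"
  using cont[of t] by (auto simp: contactomorphism_def)

lemma DD_per:
  assumes t: "t \<in> {0..1}"
  shows "DD t (x, y, z + 1) (0, v) = DD t (x, y, z) (0, v)"
proof -
  have "((\<lambda>q. q + (0, 0, 1)) has_derivative (\<lambda>v. v)) (at (x, y, z) :: 'n pt filter)"
    by (auto intro!: derivative_eq_intros)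
  from has_derivative_compose[OF this, of "\<Phi> t" "\<lambda>v. DD t (x, y, z + 1) (0, v)"] space_deriv[of t "(x, y, z + 1)"]
  have "((\<lambda>q. \<Phi> t (q + (0, 0, 1))) has_derivative (\<lambda>v. DD t (x, y, z + 1) (0, v))) (at (x, y, z))" by simp
  moreover have "(\<lambda>q. \<Phi> t (q + (0, 0, 1))) = (\<lambda>q. \<Phi> t q + (0, 0, 1))"
    using per[OF t] by auto
  moreover have "((\<lambda>q. \<Phi> t q + (0, 0, 1)) has_derivative (\<lambda>v. DD t (x, y, z) (0, v))) (at (x, y, z))"
    using has_derivative_add[OF space_deriv[of t "(x, y, z)"] has_derivative_const] by simp
  ultimately show ?thesis using has_derivative_unique by metis
qed

lemma DD_out:
  assumes t: "t \<in> {0..1}" and o: "R < norm x \<or> R < norm y"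
  shows "DD t (x, y, z) (0, v) = v"
proof -
  define S where "S = {q :: 'n pt. R < norm (fst q) \<or> R < norm (fst (snd q))}"
  have "open S" unfolding S_def
    by (intro open_Collect_disj open_Collect_less continuous_intros)
  moreover have "(x, y, z) \<in> S" using o by (auto simp: S_def)
  moreover have "q = \<Phi> t q" if "q \<in> S" for q
    using that out[OF t] by (cases q) (auto simp: S_def)
  ultimately have "(\<Phi> t has_derivative (\<lambda>v. v)) (at (x, y, z))"
    using has_derivative_transform_within_open[OF has_derivative_ident, of S "(x, y, z)" "\<Phi> t" UNIV] by blast
  then show ?thesis using has_derivative_unique[OF space_deriv] by metis
qed

definition Kp :: "'n pt set" where "Kp = cball 0 R \<times> cball 0 R \<times> {0..1}"

lemma compact_Kp: "compact Kp"
  unfolding Kp_def by (intro compact_Times) auto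

lemma reduce:
  obtains "\<And>t v. t \<in> {0..1} \<Longrightarrow> DD t p (0, v) = v"
  | p' where "p' \<in> Kp" "\<And>t v. t \<in> {0..1} \<Longrightarrow> DD t p (0, v) = DD t p' (0, v)"
proof -
  obtain x y z where p: "p = (x, y, z)" by (cases p)
  show ?thesis
  proof (cases "R < norm x \<or> R < norm y")
    case True
    then show ?thesis using that(1) DD_out p by blast
  next
    case False
    have "DD t p (0, v) = DD t (x, y, frac z) (0, v)" if t: "t \<in> {0..1}" for t v
      using periodic_frac[of "\<lambda>z. DD t (x, y, z) (0, v)" z, OF DD_per[OF t]] by (simp add: p)
    moreover have "(x, y, frac z) \<in> Kp"
      using False by (auto simp: Kp_def frac_lt_1 less_imp_le)
    ultimately show ?thesis using that(2) by blast
  qed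
qed

lemma unit_scale:
  fixes L :: "'n pt \<Rightarrow> 'n pt"
  assumes "bounded_linear L" "v \<noteq> 0"
  shows "norm (L v) = norm v * norm (L ((1 / norm v) *\<^sub>R v))"
  using assms by (simp add: linear_simps(5))

lemma bl0: "bounded_linear (\<lambda>v. DD t p (0, v))"
  by (rule has_derivative_bounded_linear[OF space_deriv])

lemma cont_DD0: "continuous_on UNIV (\<lambda>w. DD (fst w) (fst (snd w)) (0, snd (snd w)))"
proof -
  have "continuous_on UNIV (\<lambda>w :: real \<times> 'n pt \<times> 'n pt. ((fst w, fst (snd w)), (0 :: real, snd (snd w))))"
    by (intro continuous_intros)
  from continuous_on_compose2[OF cont_DD this] show ?thesis by simp
qed

text \<open>The derivatives are invertible, so their norm on unit vectors has a positive minimum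
  over a compact set. \<open>1 / c\<close> then serves as a Lipschitz constant for all inverses
  \<open>iv t\<close>.\<close>

lemma lower_bound:
  obtains c where "0 < c" "\<And>t p v. t \<in> {0..1} \<Longrightarrow> c * norm v \<le> norm (DD t p (0, v))"
proof -
  define Q where "Q = {0..1::real} \<times> Kp \<times> sphere (0 :: 'n pt) 1"
  have Q: "compact Q" unfolding Q_def by (intro compact_Times compact_Kp) auto
  have "continuous_on Q (\<lambda>w. norm (DD (fst w) (fst (snd w)) (0, snd (snd w))))"
    by (intro continuous_on_norm continuous_on_subset[OF cont_DD0]) auto
  have pos: "0 < norm (DD (fst w) (fst (snd w)) (0, snd (snd w)))" if "w \<in> Q" for w
  proof -
    have t: "fst w \<in> {0..1}" and v: "norm (snd (snd w)) = 1" using that by (auto simp: Q_def)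
    interpret bounded_linear "Di (fst w) (\<Phi> (fst w) (fst (snd w)))"
      by (rule has_derivative_bounded_linear[OF iv_deriv[OF t]])
    have "DD (fst w) (fst (snd w)) (0, snd (snd w)) \<noteq> 0"
      using Di_DD[OF t, of "fst (snd w)" "snd (snd w)"] v zero by auto
    then show ?thesis by simp
  qed
  have "\<exists>c>0. \<forall>w\<in>Q. c \<le> norm (DD (fst w) (fst (snd w)) (0, snd (snd w)))"
  proof (cases "Q = {}")
    case False
    from continuous_attains_inf[OF Q False \<open>continuous_on Q _\<close>] obtain w0 where
      "w0 \<in> Q" "\<And>w. w \<in> Q \<Longrightarrow> norm (DD (fst w0) (fst (snd w0)) (0, snd (snd w0))) \<le> norm (DD (fst w) (fst (snd w)) (0, snd (snd w)))"
      by blast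
    then show ?thesis using pos by blast
  qed (auto intro: exI[of _ 1])
  then obtain c where c: "0 < c" "\<And>w. w \<in> Q \<Longrightarrow> c \<le> norm (DD (fst w) (fst (snd w)) (0, snd (snd w)))" by blast
  have "min c 1 * norm v \<le> norm (DD t p (0, v))" if t: "t \<in> {0..1}" for t p v
  proof (cases "v = 0")
    case False
    show ?thesis
    proof (rule reduce[of p])
      assume "\<And>t v. t \<in> {0..1} \<Longrightarrow> DD t p (0, v) = v"
      then show ?thesis using t mult_right_mono[of "min c 1" 1 "norm v"] by simp
    next
      fix p' assume p': "p' \<in> Kp" "\<And>t v. t \<in> {0..1} \<Longrightarrow> DD t p (0, v) = DD t p' (0, v)"
      have "(t, p', (1 / norm v) *\<^sub>R v) \<in> Q" using t p'(1) False by (simp add: Q_def)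
      from c(2)[OF this] have "min c 1 \<le> norm (DD t p' (0, (1 / norm v) *\<^sub>R v))" by simp
      then have "norm v * min c 1 \<le> norm v * norm (DD t p' (0, (1 / norm v) *\<^sub>R v))"
        by (intro mult_left_mono) auto
      then show ?thesis using unit_scale[OF bl0 False] p'(2)[OF t] by (simp add: mult.commute)
    qed
  qed simp
  then show ?thesis using c(1) by (intro that[of "min c 1"]) auto
qed

lemma equicontinuity:
  assumes "0 < e"
  obtains d where "0 < d" "\<And>s t p v. \<lbrakk>s \<in> {0..1}; t \<in> {0..1}; \<bar>t - s\<bar> < d\<rbrakk>
    \<Longrightarrow> norm (DD t p (0, v) - DD s p (0, v)) \<le> e * norm v"
proof -
  define Q where "Q = {0..1::real} \<times> Kp \<times> sphere (0 :: 'n pt) 1"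
  have Q: "compact Q" unfolding Q_def by (intro compact_Times compact_Kp) auto
  have "uniformly_continuous_on Q (\<lambda>w. DD (fst w) (fst (snd w)) (0, snd (snd w)))"
    by (intro compact_uniformly_continuous Q continuous_on_subset[OF cont_DD0]) auto
  then obtain d where d: "0 < d" "\<And>w w'. \<lbrakk>w \<in> Q; w' \<in> Q; dist w' w < d\<rbrakk> \<Longrightarrow>
      dist (DD (fst w') (fst (snd w')) (0, snd (snd w'))) (DD (fst w) (fst (snd w)) (0, snd (snd w))) < e"
    using assms unfolding uniformly_continuous_on_def by metis
  have "norm (DD t p (0, v) - DD s p (0, v)) \<le> e * norm v"
    if st: "s \<in> {0..1}" "t \<in> {0..1}" "\<bar>t - s\<bar> < d" for s t p v
  proof (cases "v = 0")
    case True
    interpret A: bounded_linear "\<lambda>v. DD t p (0, v)" by (rule bl0)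
    interpret B: bounded_linear "\<lambda>v. DD s p (0, v)" by (rule bl0)
    show ?thesis using True A.zero B.zero by simp
  next
    case False
    show ?thesis
    proof (rule reduce[of p])
      assume "\<And>t v. t \<in> {0..1} \<Longrightarrow> DD t p (0, v) = v"
      then show ?thesis using st assms by simp
    next
      fix p' assume p': "p' \<in> Kp" "\<And>t v. t \<in> {0..1} \<Longrightarrow> DD t p (0, v) = DD t p' (0, v)"
      define u where "u = (1 / norm v) *\<^sub>R v"
      have "dist (t, p', u) (s, p', u) < d" using st(3) by (simp add: dist_Pair_Pair dist_real_def)
      then have "norm (DD t p' (0, u) - DD s p' (0, u)) < e"
        using d(2)[of "(s, p', u)" "(t, p', u)"] st p'(1) False by (simp add: Q_def u_def dist_norm)
      then have "norm v * norm (DD t p' (0, u) - DD s p' (0, u)) \<le> norm v * e"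
        by (intro mult_left_mono) auto
      then show ?thesis
        using unit_scale[OF bounded_linear_sub[OF bl0 bl0] False, of t p' s p'] p'(2) st
        by (simp add: u_def mult.commute)
    qed
  qed
  then show ?thesis using d(1) that by blast
qed

text \<open>The displacement of the step is the difference of \<open>\<Phi> t\<close> and
  \<open>\<Phi> s\<close> applied after \<open>iv s\<close>; the Lipschitz constants
  \<open>c / 2\<close> and \<open>1 / c\<close> multiply to the 1/2 of
  \<open>near_id\<close>.\<close>

lemma near_steps:
  obtains d where "0 < d" "\<And>s t. \<lbrakk>s \<in> {0..1}; t \<in> {0..1}; \<bar>t - s\<bar> < d\<rbrakk> \<Longrightarrow> near_id (\<Phi> t \<circ> iv s)"
proof -
  obtain c where c: "0 < c" "\<And>t p v. t \<in> {0..1} \<Longrightarrow> c * norm v \<le> norm (DD t p (0, v))"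
    by (rule lower_bound, rule that)
  have "0 < c / 2" using c by simp
  then obtain d where d: "0 < d" "\<And>s t p v. \<lbrakk>s \<in> {0..1}; t \<in> {0..1}; \<bar>t - s\<bar> < d\<rbrakk>
    \<Longrightarrow> norm (DD t p (0, v) - DD s p (0, v)) \<le> c / 2 * norm v"
    using equicontinuity by blast
  have "near_id (\<Phi> t \<circ> iv s)" if st: "s \<in> {0..1}" "t \<in> {0..1}" "\<bar>t - s\<bar> < d" for s t
    unfolding near_id_def
  proof (intro allI)
    fix q q'
    define w where "w p = \<Phi> t p - \<Phi> s p" for p
    have w: "norm (w p' - w p) \<le> c / 2 * norm (p' - p)" for p p'
    proof (rule differentiable_bound[of UNIV w "\<lambda>p v. DD t p (0, v) - DD s p (0, v)"])
      show "(w has_derivative (\<lambda>v. DD t p (0, v) - DD s p (0, v))) (at p within UNIV)" for p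
        unfolding w_def by (intro has_derivative_diff space_deriv)
      show "onorm (\<lambda>v. DD t p (0, v) - DD s p (0, v)) \<le> c / 2" for p
        by (rule onorm_le) (use d(2)[OF st] in simp)
    qed auto
    have i: "norm (iv s q' - iv s q) \<le> 1 / c * norm (q' - q)"
    proof (rule differentiable_bound[of UNIV "iv s" "Di s"])
      show "(iv s has_derivative Di s q) (at q within UNIV)" for q
        using iv_deriv[OF st(1)] by simp
      show "onorm (Di s q) \<le> 1 / c" for q
      proof (rule onorm_le)
        fix v
        show "norm (Di s q v) \<le> 1 / c * norm v"
          using c(2)[OF st(1), of "Di s q v" "iv s q"] DD_Di[OF st(1), of q v] c(1) by (simp add: field_simps)
      qed
    qed auto
    have "(\<Phi> t \<circ> iv s) q - q = w (iv s q)" for q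
      using iv1[OF st(1), of q] by (simp add: w_def)
    then have "norm (((\<Phi> t \<circ> iv s) q' - q') - ((\<Phi> t \<circ> iv s) q - q)) \<le> c / 2 * norm (iv s q' - iv s q)"
      using w by simp
    also have "\<dots> \<le> c / 2 * (1 / c * norm (q' - q))"
      using i c(1) by (intro mult_left_mono) auto
    finally show "norm (((\<Phi> t \<circ> iv s) q' - q') - ((\<Phi> t \<circ> iv s) q - q)) \<le> 1 / 2 * norm (q' - q)"
      using c(1) by simp
  qed
  then show ?thesis using d(1) that by blast
qed

lemma step_small_contact:
  assumes st: "s \<in> {0..1}" "t \<in> {0..1}" and near: "near_id (\<Phi> t \<circ> iv s)"
  shows "small_contact (\<Phi> t \<circ> iv s) (\<lambda>q v. DD t (iv s q) (0, Di s q v)) (\<lambda>q. ec t (iv s q) / ec s (iv s q)) R"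
proof
  show "(\<Phi> t \<circ> iv s has_derivative (\<lambda>v. DD t (iv s q) (0, Di s q v))) (at q)" for q
    unfolding o_def by (rule has_derivative_compose[OF iv_deriv[OF st(1)] space_deriv])
  show "0 < ec t (iv s q) / ec s (iv s q)" for q using conf(2) st by (intro divide_pos_pos) auto
  have "continuous_on UNIV (\<lambda>p. ec t p)" for t
  proof -
    have 1: "continuous_on UNIV (\<lambda>p. \<Phi> t p)" for t
      by (rule continuous_at_imp_continuous_on) (blast intro: has_derivative_continuous space_deriv)
    have 2: "continuous_on UNIV (\<lambda>p. DD t p (0, 0, 0, 1))"
    proof -
      have "continuous_on UNIV (\<lambda>p :: 'n pt. ((t, p), (0 :: real, (0 :: real^'n), (0 :: real^'n), 1 :: real)))"
        by (intro continuous_intros)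
      from continuous_on_compose2[OF cont_DD this] show ?thesis by simp
    qed
    show ?thesis unfolding ec_def alpha_eq by (intro continuous_intros 1 2)
  qed
  then have "continuous_on UNIV (\<lambda>p. ec t p / ec s p)"
    using conf(2)[OF st(1)] by (intro continuous_on_divide) (auto simp: less_imp_neq[symmetric])
  from continuous_on_compose2[OF this cont_iv[OF st(1)]]
  show "continuous_on UNIV (\<lambda>q. ec t (iv s q) / ec s (iv s q))" by simp
  show "alpha ((\<Phi> t \<circ> iv s) q) (DD t (iv s q) (0, Di s q v)) = ec t (iv s q) / ec s (iv s q) * alpha q v" for q v
  proof -
    have "alpha q v = ec s (iv s q) * alpha (iv s q) (Di s q v)"
      using conf(1)[OF st(1), of "iv s q" "Di s q v"] by (simp add: iv1[OF st(1)] DD_Di[OF st(1)])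
    then show ?thesis
      using conf(1)[OF st(2), of "iv s q" "Di s q v"] conf(2)[OF st(1), of "iv s q"] by simp
  qed
  show "(\<Phi> t \<circ> iv s) (x, y, z + 1) = (\<Phi> t \<circ> iv s) (x, y, z) + (0, 0, 1)" for x y z
  proof -
    obtain x' y' z' where p: "iv s (x, y, z) = (x', y', z')" by (cases "iv s (x, y, z)")
    then have "\<Phi> s (x', y', z' + 1) = (x, y, z + 1)"
      using per[OF st(1), of x' y' z'] iv1[OF st(1), of "(x, y, z)"] by simp
    then have "iv s (x, y, z + 1) = (x', y', z' + 1)" using iv2[OF st(1)] by metis
    then show ?thesis using p per[OF st(2)] by simp
  qed
  show "(\<Phi> t \<circ> iv s) (x, y, z) = (x, y, z)" if "R < norm x \<or> R < norm y" for x y z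
    using iv2[OF st(1), of "(x, y, z)"] out[OF st(1) that] out[OF st(2) that] by simp
qed (rule near)

end

locale positive_isotopy = isotopy +
  assumes ham: "\<And>t p. t \<in> {0..1} \<Longrightarrow> 0 \<le> alpha (\<Phi> t p) (DD t p (1, 0))"
begin

text \<open>Composing with \<open>iv s\<close> on the right only relabels initial points, so the
  isotopy started at time \<open>s\<close> has the same contact Hamiltonian.\<close>

lemma step_gfun_nonneg:
  assumes st: "s \<in> {0..1}" "t1 \<in> {0..1}" "s \<le> t1"
    and near: "\<And>t. t \<in> {s..t1} \<Longrightarrow> near_id (\<Phi> t \<circ> iv s)"
  shows "0 \<le> gfun (\<Phi> t1 \<circ> iv s) a"
proof (rule gfun_nonneg_of_isotopy[where S = "\<lambda>t. \<Phi> t \<circ> iv s" and s = s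
      and S' = "\<lambda>t q w. DD t (iv s q) (fst w, Di s q (snd w))" and E = "\<lambda>t q. ec t (iv s q) / ec s (iv s q)"])
  have sub: "t \<in> {0..1}" if "t \<in> {s..t1}" for t using that st by auto
  show "((\<lambda>w. (\<Phi> (fst w) \<circ> iv s) (snd w)) has_derivative (\<lambda>w. DD t (iv s q) (fst w, Di s q (snd w)))) (at (t, q))" for t q
  proof -
    have 1: "((\<lambda>w. iv s (snd w)) has_derivative (\<lambda>w. Di s q (snd w))) (at (t, q))"
      using has_derivative_compose[OF has_derivative_snd[OF has_derivative_ident, of "at (t, q)"], of "iv s" "Di s q"]
        iv_deriv[OF st(1)] by simp
    have "((\<lambda>w. (fst w, iv s (snd w))) has_derivative (\<lambda>w. (fst w, Di s q (snd w)))) (at (t, q))"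
      by (intro has_derivative_Pair has_derivative_fst has_derivative_ident 1)
    from has_derivative_compose[OF this, of "\<lambda>w. \<Phi> (fst w) (snd w)" "DD t (iv s q)"] joint_deriv
    show ?thesis by simp
  qed
  show "near_id (\<Phi> t \<circ> iv s)" if "t \<in> {s..t1}" for t by (rule near[OF that])
  show "alpha ((\<Phi> t \<circ> iv s) q) (DD t (iv s q) (fst (0, v), Di s q (snd (0, v)))) =
      ec t (iv s q) / ec s (iv s q) * alpha q v" if "t \<in> {s..t1}" for t q v
    using small_contact.conf[OF step_small_contact[OF st(1) sub[OF that] near[OF that]]] by simp
  show "0 \<le> alpha ((\<Phi> t \<circ> iv s) q) (DD t (iv s q) (fst (1, 0), Di s q (snd (1, 0))))" if "t \<in> {s..t1}" for t q
  proof -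
    interpret bounded_linear "Di s q" by (rule has_derivative_bounded_linear[OF iv_deriv[OF st(1)]])
    show ?thesis using ham[OF sub[OF that], of "iv s q"] zero by simp
  qed
  show "\<Phi> s \<circ> iv s = id" using iv1[OF st(1)] by (auto simp: fun_eq_iff)
qed (rule st)

lemma fragmentation:
  obtains m \<sigma> \<sigma>' E f g where "word m R \<sigma> E f g" "word.cmpo m \<sigma> m = \<Phi> 1"
    "\<And>i. small_contact (\<sigma> i) (\<sigma>' i) (E i) R"
proof -
  obtain d where d: "0 < d" "\<And>s t. \<lbrakk>s \<in> {0..1}; t \<in> {0..1}; \<bar>t - s\<bar> < d\<rbrakk> \<Longrightarrow> near_id (\<Phi> t \<circ> iv s)"
    by (rule near_steps, rule that)
  obtain m0 where m0: "1 / real (Suc m0) < d" using nat_approx_posE[OF d(1)] by blast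
  define m where "m = Suc m0"
  have m: "0 < m" "1 / real m < d" using m0 by (auto simp: m_def)
  define a where "a j = real j / real m" for j
  have aI: "a j \<in> {0..1}" if "j \<le> m" for j using that m by (simp add: a_def divide_le_eq)
  have aS: "a (Suc j) = a j + 1 / real m" for j using m by (simp add: a_def add_divide_distrib)
  define s where "s i = a (i mod m)" for i
  define t where "t i = a (Suc (i mod m))" for i
  have sI: "s i \<in> {0..1}" "t i \<in> {0..1}" for i
    unfolding s_def t_def using m(1) by (auto intro!: aI simp: less_imp_le Suc_le_eq simp del: atLeastAtMost_iff)
  have nr: "near_id (\<Phi> u \<circ> iv (s i))" if "u \<in> {s i..t i}" for u i
    using that m(2) aS[of "i mod m"] sI[of i] by (intro d(2)) (auto simp: s_def t_def)
  have st: "s i \<le> t i" for i using aS[of "i mod m"] m by (simp add: s_def t_def)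
  define \<sigma> where "\<sigma> i = \<Phi> (t i) \<circ> iv (s i)" for i
  define \<sigma>' where "\<sigma>' i q v = DD (t i) (iv (s i) q) (0, Di (s i) q v)" for i q v
  define E where "E i q = ec (t i) (iv (s i) q) / ec (s i) (iv (s i) q)" for i q
  have sc: "small_contact (\<sigma> i) (\<sigma>' i) (E i) R" for i
    unfolding \<sigma>_def \<sigma>'_def E_def using st by (intro step_small_contact sI nr) auto
  have nn: "0 \<le> gfun (\<sigma> i) b" for i b
    unfolding \<sigma>_def by (rule step_gfun_nonneg[OF sI(1,2) st nr])
  have w: "word m R \<sigma> E (\<lambda>i. gfun (\<sigma> i)) (\<lambda>i. small_contact.gr (\<sigma> i) (E i))"
  proof
    show "genfun R (gfun (\<sigma> i)) (small_contact.gr (\<sigma> i) (E i))"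
      "gen_by (\<sigma> i) (E i) (gfun (\<sigma> i)) (small_contact.gr (\<sigma> i) (E i))" for i
      by (rule small_contact.small_genfun[OF sc nn])+
    have "bij (iv (s i))" for i unfolding iv_def by (rule bij_imp_bij_inv[OF bij[OF sI(1)]])
    then show "inj (\<sigma> i)" for i
      unfolding \<sigma>_def using bij_is_inj[OF bij[OF sI(2)]] bij_is_inj by (blast intro: inj_compose)
  qed (use m R in auto)
  have "j \<le> m \<Longrightarrow> word.cmpo m \<sigma> j q = \<Phi> (a j) q" for j q
  proof (induction j)
    case 0
    show ?case by (simp add: word.cmpo.simps[OF w] a_def start)
  next
    case (Suc j)
    then have "j mod m = j" by simp
    have "word.cmpo m \<sigma> (Suc j) q = \<sigma> (j mod m) (word.cmpo m \<sigma> j q)"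
      by (rule word.cmpo.simps(2)[OF w])
    also have "word.cmpo m \<sigma> j q = \<Phi> (a j) q" using Suc by simp
    also have "\<sigma> (j mod m) (\<Phi> (a j) q) = \<Phi> (a (Suc j)) q"
      using Suc.prems iv2[OF aI[of j]] \<open>j mod m = j\<close> by (simp add: \<sigma>_def s_def t_def)
    finally show ?case .
  qed
  from this[of m] have "word.cmpo m \<sigma> m = \<Phi> 1" using m(1) by (simp add: a_def fun_eq_iff)
  then show ?thesis using w sc that by blast
qed

end

text \<open>Positivity is given only in the interior of the support. A negative value would persist
  on an open set of interior times, whose image under the track map \<open>X\<close> is open by
  invariance of domain and thus lies in that interior.\<close>

lemma positive_isotopy_of_Hamiltonian:
  fixes \<Phi> :: "real \<Rightarrow> 'n::finite pt \<Rightarrow> 'n pt"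
  assumes "isotopy \<Phi> R"
    and H: "\<forall>t\<in>{0..1}. \<forall>p. H t (\<Phi> t p) =
            alpha (\<Phi> t p) (vector_derivative (\<lambda>s. \<Phi> s p) (at t within {0..1}))"
    and pos: "\<forall>t p. (t, p) \<in> interior (closure {(s, q). s \<in> {0..1} \<and> H s q \<noteq> 0}) \<longrightarrow> H t p > 0"
  shows "positive_isotopy \<Phi> R"
proof -
  interpret isotopy \<Phi> R by (rule assms)
  define hh where "hh w = alpha (\<Phi> (fst w) (snd w)) (DD (fst w) (snd w) (1, 0))" for w
  have Hh: "H t (\<Phi> t p) = hh (t, p)" if "t \<in> {0..1}" for t p
    using H[rule_format, OF that, of p] vector_derivative_at_within_ivl[OF time_deriv[of p t], of 0 1] that
    by (simp add: hh_def)
  have conth: "continuous_on UNIV hh"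
  proof -
    have "continuous_on UNIV (\<lambda>w :: real \<times> 'n pt. (w, (1 :: real, 0 :: 'n pt)))"
      by (intro continuous_intros)
    from continuous_on_compose2[OF cont_DD this]
    have D: "continuous_on UNIV (\<lambda>w. DD (fst w) (snd w) (1, 0))" by simp
    show ?thesis unfolding hh_def alpha_eq by (intro continuous_intros D cont_Phi)
  qed
  have "0 \<le> hh (t0, p0)" if t0: "t0 \<in> {0..1}" for t0 p0
  proof (rule ccontr)
    assume "\<not> 0 \<le> hh (t0, p0)"
    then have neg: "hh (t0, p0) < 0" by simp
    define O1 where "O1 = {w. 0 < fst w} \<inter> {w. fst w < 1} \<inter> {w. hh w < 0}"
    have opO: "open O1"
      unfolding O1_def by (intro open_Int open_Collect_less continuous_intros conth)
    have "continuous_on UNIV (\<lambda>t. hh (t, p0))"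
      by (rule continuous_on_compose2[OF conth]) (auto intro!: continuous_intros)
    then have "open {t. hh (t, p0) < 0}" by (intro open_Collect_less continuous_intros)
    then obtain e where e: "0 < e" "ball t0 e \<subseteq> {t. hh (t, p0) < 0}"
      using neg by (auto simp: open_contains_ball)
    \<comment> \<open>Moves the time off the end points: \<open>e / 2\<close> keeps it in the ball,
      \<open>1 / 4\<close> keeps it strictly between 0 and 1.\<close>
    define t1 where "t1 = (if t0 < 1 / 2 then t0 + min (e / 2) (1 / 4) else t0 - min (e / 2) (1 / 4))"
    have "0 < t1" "t1 < 1" "t1 \<in> ball t0 e"
      using t0 e(1) by (auto simp: t1_def dist_real_def min_def)
    then have t1: "(t1, p0) \<in> O1" using e(2) by (auto simp: O1_def)
    define X where "X w = (fst w, \<Phi> (fst w) (snd w))" for w :: "real \<times> 'n pt"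
    have "open (X ` O1)"
    proof (rule invariance_of_domain[OF _ opO])
      show "continuous_on O1 X"
        unfolding X_def by (intro continuous_intros continuous_on_subset[OF cont_Phi]) auto
      show "inj_on X O1"
      proof (rule inj_onI)
        fix w w' assume w: "w \<in> O1" "w' \<in> O1" "X w = X w'"
        then have "fst w \<in> {0..1}" "fst w = fst w'" "\<Phi> (fst w) (snd w) = \<Phi> (fst w) (snd w')"
          by (auto simp: X_def O1_def)
        then have "snd w = snd w'" using injD[OF bij_is_inj[OF bij[of "fst w"]]] by blast
        then show "w = w'" using \<open>fst w = fst w'\<close> by (rule prod_eqI[rotated])
      qed
    qed
    moreover have sub: "X ` O1 \<subseteq> {(s, q). s \<in> {0..1} \<and> H s q \<noteq> 0}"
    proof
      fix v assume "v \<in> X ` O1"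
      then obtain w where w: "w \<in> O1" "v = X w" by auto
      then have "fst w \<in> {0..1}" "hh w < 0" by (auto simp: O1_def)
      then show "v \<in> {(s, q). s \<in> {0..1} \<and> H s q \<noteq> 0}"
        using Hh[of "fst w" "snd w"] by (simp add: w(2) X_def)
    qed
    ultimately have "X ` O1 \<subseteq> interior (closure {(s, q). s \<in> {0..1} \<and> H s q \<noteq> 0})"
      using interior_maximal[OF order_trans[OF _ closure_subset]] by blast
    then have "X (t1, p0) \<in> interior (closure {(s, q). s \<in> {0..1} \<and> H s q \<noteq> 0})" using t1 by blast
    then have "H t1 (\<Phi> t1 p0) > 0"
      using pos[rule_format, of t1 "\<Phi> t1 p0"] unfolding X_def fst_conv snd_conv by blast
    moreover have "H t1 (\<Phi> t1 p0) < 0" using t1 Hh[of t1 p0] by (auto simp: O1_def)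
    ultimately show False by simp
  qed
  then show ?thesis by unfold_locales (simp add: hh_def)
qed

section \<open>Counting iterated translated points\<close>

lemma proj_S1_fibre_finite:
  fixes S :: "'n::finite pt set"
  assumes "finite (proj_S1 ` S)"
  shows "finite {q \<in> S. snd (snd q) \<in> {0..C}}"
proof (rule finite_subset)
  define J where "J = (\<lambda>(p, n). p + ((0, 0, of_int n) :: 'n pt)) ` (proj_S1 ` S \<times> {0..\<lceil>C\<rceil>})"
  show "finite J" unfolding J_def by (intro finite_imageI[of "proj_S1 ` S \<times> {0..\<lceil>C\<rceil>}"] finite_cartesian_product assms) simp
  show "{q \<in> S. snd (snd q) \<in> {0..C}} \<subseteq> J"
  proof
    fix q assume q: "q \<in> {q \<in> S. snd (snd q) \<in> {0..C}}"
    have "q = proj_S1 q + (0, 0, of_int \<lfloor>snd (snd q)\<rfloor>)"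
      by (simp add: proj_S1_def prod_eq_iff frac_def)
    moreover have "\<lfloor>snd (snd q)\<rfloor> \<in> {0..\<lceil>C\<rceil>}"
      using q order_trans[OF floor_le_ceiling ceiling_mono, of "snd (snd q)" C] by simp
    ultimately show "q \<in> J" using q unfolding J_def by force
  qed
qed

text \<open>If \<open>q\<close> is a translated point of \<open>\<phi>\<^sup>k\<close> and of \<open>\<phi>\<^sup>l\<close>, \<open>k < l\<close>, with actions
  \<open>a\<^sub>k < a\<^sub>l\<close>, then \<open>q + (0, 0, a\<^sub>k)\<close> is one of \<open>\<phi>\<^sup>l\<^sup>-\<^sup>k\<close> with action \<open>a\<^sub>l - a\<^sub>k > 0\<close>;
  so \<open>k\<close> is determined by a pair of points unless it is the last index with its \<open>q\<close>.\<close>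

lemma pair_counting:
  fixes q :: "nat \<Rightarrow> 'n::finite pt" and a :: "nat \<Rightarrow> real"
  assumes fin: "finite S" and qS: "\<And>k. k \<in> {1..K} \<Longrightarrow> q k \<in> S"
    and mono: "\<And>k l. k \<in> {1..K} \<Longrightarrow> l \<in> {1..K} \<Longrightarrow> k < l \<Longrightarrow> a k < a l"
    and next_S: "\<And>k l. k \<in> {1..K} \<Longrightarrow> l \<in> {1..K} \<Longrightarrow> k < l \<Longrightarrow> q l = q k \<Longrightarrow> q k + (0, 0, a k) \<in> S"
  shows "K \<le> card S + card S * card S"
proof -
  define L where "L = {k \<in> {1..K}. \<forall>l\<in>{1..K}. k < l \<longrightarrow> q l \<noteq> q k}"
  have L: "card L \<le> card S"
  proof (rule card_inj_on_le[OF _ _ fin])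
    show "inj_on q L"
    proof (rule inj_onI)
      fix k l assume "k \<in> L" "l \<in> L" "q k = q l"
      then show "k = l" by (cases k l rule: linorder_cases) (auto simp: L_def)
    qed
    show "q ` L \<subseteq> S" using qS by (auto simp: L_def)
  qed
  have "card ({1..K} - L) \<le> card (S \<times> S)"
  proof (rule card_inj_on_le)
    show "inj_on (\<lambda>k. (q k, q k + (0, 0, a k))) ({1..K} - L)"
    proof (rule inj_onI)
      fix k l assume k: "k \<in> {1..K} - L" and l: "l \<in> {1..K} - L"
        and "(q k, q k + (0, 0, a k)) = (q l, q l + (0, 0, a l))"
      then have "a k = a l" by (simp add: prod_eq_iff)
      then show "k = l" using mono[of k l] mono[of l k] k l by (cases k l rule: linorder_cases) auto
    qed
    show "(\<lambda>k. (q k, q k + (0, 0, a k))) ` ({1..K} - L) \<subseteq> S \<times> S"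
      using qS next_S by (auto simp: L_def)
  qed (use fin in auto)
  moreover have "card {1..K} = card L + card ({1..K} - L)"
  proof -
    have "L \<subseteq> {1..K}" by (auto simp: L_def)
    from card_mono[OF _ this] card_Diff_subset[OF finite_subset[OF this] this] show ?thesis by simp
  qed
  ultimately show ?thesis using L by (simp add: card_cartesian_product)
qed

locale contact_word = word m R \<sigma> E f g
  for m R and \<sigma> :: "nat \<Rightarrow> 'n::finite pt \<Rightarrow> 'n pt" and E f g +
  fixes \<sigma>' :: "nat \<Rightarrow> 'n pt \<Rightarrow> 'n pt \<Rightarrow> 'n pt"
  assumes small: "\<And>i. small_contact (\<sigma> i) (\<sigma>' i) (E i) R"
begin

lemma cmpo_deriv:
  "\<exists>D. (cmpo j has_derivative D) (at q) \<and> (\<forall>v. alpha (cmpo j q) (D v) = fac j q * alpha q v)"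
proof (induction j)
  case 0
  have "(cmpo 0 has_derivative (\<lambda>v. v)) (at q)"
    by (rule has_derivative_transform[where f = "\<lambda>q. q" and s = UNIV]) simp_all
  then show ?case by (intro exI[of _ "\<lambda>v. v"]) simp
next
  case (Suc j)
  then obtain D where D: "(cmpo j has_derivative D) (at q)" "\<And>v. alpha (cmpo j q) (D v) = fac j q * alpha q v"
    by blast
  have "(cmpo (Suc j) has_derivative (\<lambda>v. \<sigma>' (j mod m) (cmpo j q) (D v))) (at q)"
  proof -
    have "cmpo (Suc j) = (\<lambda>q. \<sigma> (j mod m) (cmpo j q))" by auto
    then show ?thesis using has_derivative_compose[OF D(1) small_contact.der[OF small]] by (simp only:)
  qed
  moreover have "alpha (cmpo (Suc j) q) (\<sigma>' (j mod m) (cmpo j q) (D v)) = fac (Suc j) q * alpha q v" for v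
    using small_contact.conf[OF small, of "j mod m" "cmpo j q" "D v"] D(2)[of v] by simp
  ultimately show ?case by blast
qed

lemma cmpo_per: "cmpo j (q + (0, 0, 1)) = cmpo j q + (0, 0, 1)"
proof (induction j)
  case (Suc j)
  obtain x y z where "cmpo j q = (x, y, z)" by (cases "cmpo j q")
  then show ?case using Suc small_contact.per[OF small, of "j mod m" x y z] by simp
qed simp

text \<open>\<open>fac\<close> is recovered from the periodic derivative of \<open>cmpo j\<close> by
  evaluating on the Reeb direction.\<close>

lemma fac_per: "fac j (q + (0, 0, 1)) = fac j q"
proof -
  obtain D where D: "(cmpo j has_derivative D) (at q)" "\<And>v. alpha (cmpo j q) (D v) = fac j q * alpha q v"
    using cmpo_deriv by blast
  obtain D' where D': "(cmpo j has_derivative D') (at (q + (0, 0, 1)))"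
    "\<And>v. alpha (cmpo j (q + (0, 0, 1))) (D' v) = fac j (q + (0, 0, 1)) * alpha (q + (0, 0, 1)) v"
    using cmpo_deriv by blast
  have "((\<lambda>q. q + (0, 0, 1)) has_derivative (\<lambda>v. v)) (at q)" by (auto intro!: derivative_eq_intros)
  from has_derivative_compose[OF this D'(1)]
  have "((\<lambda>q. cmpo j q + (0, 0, 1)) has_derivative D') (at q)" by (simp add: cmpo_per)
  moreover have "((\<lambda>q. cmpo j q + (0, 0, 1)) has_derivative D) (at q)"
    using has_derivative_add[OF D(1) has_derivative_const] by simp
  ultimately have "D = D'" using has_derivative_unique by blast
  then show ?thesis
    using D(2)[of "(0, 0, 1)"] D'(2)[of "(0, 0, 1)"] by (simp add: alpha_eq cmpo_per)
qed

lemma translated_point_iterate: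
  assumes "(cmpo m ^^ k) q = q + (0, 0, a)" "fac (k * m) q = 1"
  shows "translated_point (cmpo m ^^ k) q" "contact_action (cmpo m ^^ k) q = a"
proof -
  obtain D where D: "(cmpo (k * m) has_derivative D) (at q)"
    "\<And>v. alpha (cmpo (k * m) q) (D v) = alpha q v"
    using cmpo_deriv[of "k * m" q] assms(2) by auto
  have fd: "frechet_derivative (cmpo (k * m)) (at q) = D"
    by (rule frechet_derivative_at[OF D(1), symmetric])
  have "conf_factor (cmpo (k * m)) q = 0"
    unfolding conf_factor_def fd D(2)
  proof (rule the_equality)
    fix c assume c: "\<forall>v. alpha q v = exp c * alpha q v"
    from c[rule_format, of "(0, 0, 1)"] show "c = 0" by (simp add: alpha_eq)
  qed simp
  then show "translated_point (cmpo m ^^ k) q"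
    using assms(1) by (simp add: translated_point_def cmpo_power)
  show "contact_action (cmpo m ^^ k) q = a" by (simp add: contact_action_def assms(1))
qed

lemma infinitely_many:
  assumes ne: "cmpo m \<noteq> id"
  shows "infinite (proj_S1 ` {q. \<exists>k::nat. k \<ge> 1 \<and>
            translated_point (cmpo m ^^ k) q \<and> contact_action (cmpo m ^^ k) q \<noteq> 0})"
proof
  define S where "S = {q. \<exists>k::nat. k \<ge> 1 \<and> translated_point (cmpo m ^^ k) q \<and> contact_action (cmpo m ^^ k) q \<noteq> 0}"
  assume "finite (proj_S1 ` {q. \<exists>k::nat. k \<ge> 1 \<and>
            translated_point (cmpo m ^^ k) q \<and> contact_action (cmpo m ^^ k) q \<noteq> 0})"
  then have fin: "finite (proj_S1 ` S)" by (simp add: S_def)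
  obtain C where C: "\<And>K. \<exists>a q. (\<forall>k\<in>{1..K}. 0 < a k \<and> a k \<le> C \<and> (cmpo m ^^ k) (q k) = q k + (0, 0, a k) \<and>
      fac (k * m) (q k) = 1) \<and> (\<forall>k\<in>{1..K}. \<forall>l\<in>{1..K}. k < l \<longrightarrow> a k < (a l :: real))"
    by (rule spectral_values[OF ne], rule that)
  \<comment> \<open>The window holds the normalised points, of height below 1, and also their
    translates by an action of at most \<open>C\<close>.\<close>
  define St where "St = {q \<in> S. snd (snd q) \<in> {0..C + 1}}"
  have finSt: "finite St" unfolding St_def by (rule proj_S1_fibre_finite[OF fin])
  define K where "K = Suc (card St + card St * card St)"
  obtain a q0 where aq: "\<And>k. k \<in> {1..K} \<Longrightarrow> 0 < a k \<and> a k \<le> C \<and> (cmpo m ^^ k) (q0 k) = q0 k + (0, 0, a k) \<and>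
      fac (k * m) (q0 k) = 1" and mono: "\<And>k l. k \<in> {1..K} \<Longrightarrow> l \<in> {1..K} \<Longrightarrow> k < l \<Longrightarrow> a k < (a l :: real)"
    using C[of K] by blast
  \<comment> \<open>Both properties of \<open>q0 k\<close> are invariant under the unit translation,
    so the height may be taken in [0, 1).\<close>
  define q where "q k = (fst (q0 k), fst (snd (q0 k)), frac (snd (snd (q0 k))))" for k
  have q: "(cmpo m ^^ k) (q k) = q k + (0, 0, a k) \<and> fac (k * m) (q k) = 1" if "k \<in> {1..K}" for k
  proof -
    obtain x y z where q0: "q0 k = (x, y, z)" by (cases "q0 k")
    define P where "P z \<longleftrightarrow> cmpo (k * m) (x, y, z) = (x, y, z) + (0, 0, a k) \<and> fac (k * m) (x, y, z) = 1" for z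
    have "P (z + 1) = P z" for z
      using cmpo_per[of "k * m" "(x, y, z)"] fac_per[of "k * m" "(x, y, z)"]
      by (cases "cmpo (k * m) (x, y, z)") (auto simp: P_def)
    then have "P (frac z) = P z" by (rule periodic_frac)
    moreover have "P z" using aq[OF that] by (simp add: P_def q0 cmpo_power)
    ultimately show ?thesis by (simp add: P_def q_def q0 cmpo_power)
  qed
  have qz: "0 \<le> snd (snd (q k))" "snd (snd (q k)) < 1" for k
    by (simp_all add: q_def frac_lt_1)
  have inS: "p \<in> S" if "1 \<le> k" "(cmpo m ^^ k) p = p + (0, 0, b)" "fac (k * m) p = 1" "b \<noteq> 0" for k p b
    unfolding S_def using that translated_point_iterate[OF that(2,3)] by auto
  have "K \<le> card St + card St * card St"
  proof (rule pair_counting[OF finSt _ mono])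
    fix k assume k: "k \<in> {1..K}"
    have "q k \<in> S" using q[OF k] aq[OF k] k by (intro inS[of k "q k" "a k"]) auto
    then show "q k \<in> St" using qz[of k] aq[OF k] by (simp add: St_def)
  next
    fix k l assume kl: "k \<in> {1..K}" "l \<in> {1..K}" "k < l" "q l = q k"
    define p where "p = q k + (0, 0, a k)"
    have pk: "(cmpo m ^^ k) (q k) = p" "fac (k * m) (q k) = 1" using q[OF kl(1)] by (auto simp: p_def)
    have lk: "l * m = (l - k) * m + k * m" using kl(3) by (simp add: add_mult_distrib[symmetric])
    have "(cmpo m ^^ (l - k)) p = (cmpo m ^^ l) (q k)"
      using kl(3) pk(1) funpow_add[of "l - k" k "cmpo m"] by simp
    also have "\<dots> = p + (0, 0, a l - a k)"
      using q[OF kl(2)] kl(4) by (simp add: p_def prod_eq_iff)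
    finally have 1: "(cmpo m ^^ (l - k)) p = p + (0, 0, a l - a k)" .
    have "fac (l * m) (q k) = fac (k * m) (q k) * fac ((l - k) * m) (cmpo (k * m) (q k))"
      unfolding lk by (rule fac_add)
    then have 2: "fac ((l - k) * m) p = 1"
      using q[OF kl(2)] kl(4) pk by (simp add: cmpo_power)
    have "p \<in> S" using kl(3) mono[OF kl(1-3)] by (intro inS[OF _ 1 2]) auto
    then show "q k + (0, 0, a k) \<in> St"
      using qz[of k] aq[OF kl(1)] by (simp add: St_def p_def)
  qed
  then show False by (simp add: K_def)
qed

end

theorem theorem4p1:
  fixes \<phi> :: "'n::finite pt \<Rightarrow> 'n pt"
  assumes "cs_contactomorphism \<phi>"
    and "positive_contactomorphism \<phi>"
    and "\<phi> \<noteq> id"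
  shows "infinite (proj_S1 ` {q. \<exists>k::nat. k \<ge> 1 \<and>
            translated_point (\<phi> ^^ k) q \<and> contact_action (\<phi> ^^ k) q \<noteq> 0})"
proof -
  obtain \<Phi> :: "real \<Rightarrow> 'n pt \<Rightarrow> 'n pt" and H B where B: "bounded B"
    and sm: "smooth (\<lambda>(t, p). \<Phi> t p)"
    and co: "\<forall>t\<in>{0..1}. contactomorphism (\<Phi> t) \<and> supported_in B (\<Phi> t)"
    and ends: "\<Phi> 0 = id" "\<Phi> 1 = \<phi>"
    and H: "\<forall>t\<in>{0..1}. \<forall>p. H t (\<Phi> t p) =
            alpha (\<Phi> t p) (vector_derivative (\<lambda>s. \<Phi> s p) (at t within {0..1}))"
    and pos: "\<forall>t p. (t, p) \<in> interior (closure {(s, q). s \<in> {0..1} \<and> H s q \<noteq> 0}) \<longrightarrow> H t p > 0"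
    using assms(2) unfolding positive_contactomorphism_def by blast
  obtain R where R: "0 < R" "\<And>w. w \<in> B \<Longrightarrow> norm w \<le> R"
    using B by (auto simp: bounded_pos)
  have RB: "norm x \<le> R \<and> norm y \<le> R" if "(x, y) \<in> B" for x y
    using R(2)[OF that] norm_fst_le[of x y] norm_snd_le[of y x] by linarith
  have iso: "isotopy \<Phi> R"
  proof
    show "smooth (\<lambda>w. \<Phi> (fst w) (snd w))" using sm by (simp add: case_prod_beta')
    show "\<Phi> t (x, y, z) = (x, y, z)" if "t \<in> {0..1}" "R < norm x \<or> R < norm y" for t x y z
      using co that RB[of x y] unfolding supported_in_def by force
  qed (use co ends R in auto)
  interpret positive_isotopy \<Phi> R by (rule positive_isotopy_of_Hamiltonian[OF iso H pos])
  obtain m \<sigma> \<sigma>' E f g where w: "word m R \<sigma> E f g" "word.cmpo m \<sigma> m = \<Phi> 1"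
    "\<And>i. small_contact (\<sigma> i) (\<sigma>' i) (E i) R"
    by (rule fragmentation, rule that)
  interpret contact_word m R \<sigma> E f g \<sigma>'
    using w by (simp add: contact_word_def contact_word_axioms_def)
  show ?thesis using infinitely_many assms(3) w(2) ends(2) by simp
qed

end
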